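(* Let $\rho>1$, $\lambda\in\mathbb{C}$, and let $I_n(R_nz;\lambda)=(1-\lambda)s_n(R_nz)-\lambda t_{n+1}(R_nz)$, where $s_n$ and $t_{n+1}$ are the sections and tails of the Mittag--Leffler function $E_{1/\rho}$. I. Let $\xi$ be a fixed point of the generalized Szegő curve $S(\rho)$ with $\arg\xi=\phi$, $0<\phi<\frac{\pi}{2\rho}$. Let $\tau=|\xi|^\rho\sin(\phi\rho)-\rho\phi$ and let the sequence $(\tau_n)$ be defined by $\tau_n\equiv\frac{\tau}{\rho}n \pmod{2\pi}$, $-\pi<\tau_n\le\pi$. Put $$w_n(\zeta)=1+\frac{\log n}{2(1-\xi^\rho)n}-\frac{\zeta-i\tau_n}{(1-\xi^\rho)n}.$$ Then, as $n\to\infty$, $$I_n\left(R_n\xi w_n(\zeta);\lambda\right)\frac{\Gamma(1+\frac n\rho)}{R_n^n\xi^n w_n(\zeta)^n}\to\begin{cases}(1-\lambda)(2\pi\rho)^{1/2}e^{\frac{\rho+1}{2\rho}(\xi^\rho-1)}e^{\zeta}-\dfrac{\xi}{1-\xi},&\text{if }|\xi|<1,\\[2mm]-\lambda(2\pi\rho)^{1/2}e^{\frac{\rho+1}{2\rho}(\xi^\rho-1)}e^{\zeta}-\dfrac{\xi}{1-\xi},&\text{if }|\xi|>1,\end{cases}$$ uniformly on every compact set of the $\zeta$-plane. II. Let $\xi=e^{-1/\rho}e^{i\phi}$, $\frac{\pi}{2\rho}<\phi\le\pi$, be a fixed point on the circular portion of $S(\rho)$, and let the sequence $(\tau_n')$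 be defined by $\tau_n'\equiv(n+1)\phi\pmod{2\pi}$, $-\pi<\tau_n'\le\pi$. Put $$w_n'(\zeta)=1+\left(\frac12-\frac1\rho\right)\frac{\log n}{n}-\frac{\zeta-i\tau_n'}{n+1}.$$ Then, as $n\to\infty$, $$I_n\left(R_n\xi w_n'(\zeta);\lambda\right)\frac{\Gamma(1+\frac n\rho)}{R_n^n\xi^nw_n'(\zeta)^n}\to\frac{(\lambda-1)\left(2\pi e^{\frac{1-\rho}{\rho}}\right)^{1/2}}{\rho^{\frac12-\frac1\rho}\,\Gamma\left(1-\frac1\rho\right)}e^{-\zeta}-\frac{\xi}{1-\xi}$$ uniformly on every compact set of the $\zeta$-plane.
   Context: For $\rho>1$, $E_{1/\rho}(z)=\sum_{j=0}^\infty \frac{z^j}{\Gamma(1+j/\rho)}$ is the Mittag--Leffler function of order $\rho$. Its sections and tails are $s_n(z)=\sum_{k=0}^n\frac{z^k}{\Gamma(1+k/\rho)}$ and $t_n(z)=\sum_{k=n}^\infty\frac{z^k}{\Gamma(1+k/\rho)}$. For $n\ge1$, $R_n=\frac{\Gamma(1+n/\rho)}{\Gamma(1+(n-1)/\rho)}$. For $\xi=|\xi|e^{i\phi}$ with $0<\phi<\frac{\pi}{2\rho}$, $\xi^\rho=|\xi|^\rho e^{i\rho\phi}$ (principal branch). The generalized Szegő curve $S(\rho)$ is the set of all points $\sigma e^{i\phi}$, $\sigma>0$, $-\frac{\pi}{2\rho}\le\phi<2\pi-\frac{\pi}{2\rho}$, such that: (i) if $-\frac{\pi}{2\rho}\le\phi\le\frac{\pi}{2\rho}$,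 then $\sigma^\rho\cos(\phi\rho)-1-\rho\log\sigma=0$ (all positive solutions $\sigma$ are included; for $0<|\phi|<\frac{\pi}{2\rho}$ there is one with $\sigma<1$ and one with $\sigma>1$); (ii) if $\frac{\pi}{2\rho}<\phi<2\pi-\frac{\pi}{2\rho}$, then $\sigma=e^{-1/\rho}$.
   Formalization: The printed formulas fail for the given R_n; corrected: in I the exponent (ρ+1)/(2ρ) becomes (ρ−1)/(2ρ); in II the exponent (1−ρ)/ρ becomes (3−ρ)/ρ, and the last term of w'_n is +(ζ−iτ'_n)/(n+1) instead of −(ζ−iτ'_n)/(n+1). *)

theory Defs
  imports "HOL-Analysis.Analysis" "HOL-Library.Real_Mod"
begin

definition ml_coeff :: "real \<Rightarrow> nat \<Rightarrow> real" where
  "ml_coeff \<rho> j = 1 / Gamma (1 + real j / \<rho>)"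

definition mittag_leffler :: "real \<Rightarrow> complex \<Rightarrow> complex" where
  "mittag_leffler \<rho> z = (\<Sum>j. of_real (ml_coeff \<rho> j) * z ^ j)"

definition ml_section :: "real \<Rightarrow> nat \<Rightarrow> complex \<Rightarrow> complex" where
  "ml_section \<rho> n z = (\<Sum>k\<le>n. of_real (ml_coeff \<rho> k) * z ^ k)"

(* The series converges for every z when rho > 0 (the function is entire), so the sum is never
   the default value that suminf takes on a divergent series. *)
definition ml_tail :: "real \<Rightarrow> nat \<Rightarrow> complex \<Rightarrow> complex" where
  "ml_tail \<rho> n z = (\<Sum>k. of_real (ml_coeff \<rho> (n + k)) * z ^ (n + k))"

definition ml_I :: "real \<Rightarrow> nat \<Rightarrow> complex \<Rightarrow> complex \<Rightarrow> complex" where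
  "ml_I \<rho> n z lam = (1 - lam) * ml_section \<rho> n z - lam * ml_tail \<rho> (n + 1) z"

(* Meaningful for n >= 1 only; the value at n = 0 plays no role in the limits.

   Correction to the source: for this R_n, Stirling's formula gives
     R_n^rho = n/rho + (rho-1)/(2 rho) + O(1/n),
   hence R_n^n is asymptotic to (n/rho)^(n/rho) e^((rho-1)/(2 rho)).  The limit constants therefore
   carry e^((rho-1)/(2 rho) (xi^rho - 1)) on the non-circular part of the curve, and
   (2 pi e^((3-rho)/rho))^(1/2) on the arc, where (3-rho)/rho = 2 (1/rho - (rho-1)/(2 rho)).  The
   source prints the exponents (rho+1)/(2 rho) and (1-rho)/rho, which belong to the ratio shifted
   by one index, Gamma(1+(n+1)/rho) / Gamma(1+n/rho). *)
definition ml_R :: "real \<Rightarrow> nat \<Rightarrow> real" where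
  "ml_R \<rho> n = Gamma (1 + real n / \<rho>) / Gamma (1 + (real n - 1) / \<rho>)"

definition szego_curve :: "real \<Rightarrow> complex set" where
  "szego_curve \<rho> =
     {of_real \<sigma> * cis \<phi> | \<sigma> \<phi>. \<sigma> > 0 \<and>
        - pi / (2 * \<rho>) \<le> \<phi> \<and> \<phi> < 2 * pi - pi / (2 * \<rho>) \<and>
        (\<phi> \<le> pi / (2 * \<rho>) \<longrightarrow> \<sigma> powr \<rho> * cos (\<phi> * \<rho>) - 1 - \<rho> * ln \<sigma> = 0) \<and>
        (pi / (2 * \<rho>) < \<phi> \<longrightarrow> \<sigma> = exp (- 1 / \<rho>))}"

(* tau n is the representative of x n modulo 2 pi in the interval (-pi, pi]. *)
definition reduced_args :: "(nat \<Rightarrow> real) \<Rightarrow> (nat \<Rightarrow> real) \<Rightarrow> bool" where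
  "reduced_args x \<tau> \<longleftrightarrow> (\<forall>n. [\<tau> n = x n] (rmod (2 * pi)) \<and> - pi < \<tau> n \<and> \<tau> n \<le> pi)"

(* Scaling at a point xi of the non-circular part of the curve, t standing for tau_n.  The complex
   power is the principal one, i.e. |xi|^rho e^(i rho phi) for phi = Arg xi. *)
definition szego_w :: "real \<Rightarrow> complex \<Rightarrow> real \<Rightarrow> nat \<Rightarrow> complex \<Rightarrow> complex" where
  "szego_w \<rho> \<xi> t n \<zeta> =
     1 + of_real (ln (real n)) / (2 * (1 - \<xi> powr of_real \<rho>) * of_nat n)
       - (\<zeta> - \<i> * of_real t) / ((1 - \<xi> powr of_real \<rho>) * of_nat n)"

(* Scaling at a point of the circular arc, t standing for tau'_n.

   Correction to the source, which prints a minus sign in front of the last summand.  Since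
   (1 + a/(n+1))^(-(n+1)) tends to e^(-a), and the factor xi^(-(n+1)) contributes e^(-i t), the
   phases cancel and the limit contains e^(-zeta) exactly for a = zeta - i t, i.e. with a plus
   sign; with a minus sign one is left with e^(zeta - 2 i t), which has no limit in general. *)
definition szego_w_arc :: "real \<Rightarrow> real \<Rightarrow> nat \<Rightarrow> complex \<Rightarrow> complex" where
  "szego_w_arc \<rho> t n \<zeta> =
     1 + of_real ((1 / 2 - 1 / \<rho>) * (ln (real n) / real n))
       + (\<zeta> - \<i> * of_real t) / of_nat (n + 1)"

definition normalized_I :: "real \<Rightarrow> complex \<Rightarrow> complex \<Rightarrow> nat \<Rightarrow> complex \<Rightarrow> complex" where
  "normalized_I \<rho> lam \<xi> n w =
     ml_I \<rho> n (of_real (ml_R \<rho> n) * \<xi> * w) lam * of_real (Gamma (1 + real n / \<rho>))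
       / (of_real (ml_R \<rho> n) ^ n * \<xi> ^ n * w ^ n)"

end

theory Submission
  imports Defs "HOL-Real_Asymp.Real_Asymp" "HOL-Complex_Analysis.Complex_Analysis"
begin

text \<open>
  Since the series for \<open>E\<close> splits into section and tail, \<open>I = (1 - lam) * E - t = s - lam * E\<close>. Divided by the
  \<open>n\<close>-th term of the series at \<open>z = R * xi * w\<close>, the tail (for \<open>|xi| < 1\<close>) and the section (for \<open>|xi| > 1\<close>)
  tend to geometric series by dominated convergence, because log-convexity of \<open>Gamma\<close> makes \<open>R\<close> increasing.

  What remains is \<open>E(z)\<close> divided by that term. Hankel's formula for \<open>1 / Gamma\<close> turns the series into a Cauchy
  integral of \<open>exp (u powr rho)\<close> over a contour consisting of two rays and an arc; moving the arc inwards across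
  \<open>z\<close> yields \<open>rho * exp (z powr rho)\<close> if \<open>z\<close> lies between the rays, and an error \<open>- 1 / (z * Gamma (1 - 1 / rho))\<close>
  up to \<open>O(|z|^-2)\<close> in every case. Combined with Stirling's formula for \<open>Gamma (1 + n / rho)\<close> and for \<open>R\<close>, the
  choice of \<open>w\<close> makes all growing terms in the exponent cancel.
\<close>

section \<open>Stirling asymptotics\<close>

text \<open>The limits need an error \<open>o(1)\<close> in an exponent of size \<open>n\<close>.
  Stirling's formula alone does not give this, because the error in
  \<open>ln (ml_R \<rho> n)\<close> is multiplied by \<open>n\<close>; hence differences of the
  Stirling error are bounded by O(1/x^2). The resulting constant
  \<open>a = (\<rho> - 1) / (2 * \<rho>)\<close> enters twice:
  \<open>R powr \<rho> = n / \<rho> + a + o(1)\<close>, and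
  \<open>Gamma (1 + n / \<rho>) / R^n\<close> carries a factor \<open>exp (- a)\<close>. With
  \<open>s = \<xi> powr \<rho>\<close> this makes \<open>exp (a * (s - 1))\<close>. On the
  non-circular part the terms of order \<open>n\<close> in the exponent are
  \<open>n / \<rho> * (s - 1 - \<rho> * Ln \<xi>)\<close>. The equation of the curve says that the
  real part vanishes; the imaginary part is the phase that \<open>\<tau>\<^sub>n\<close> removes,
  and the logarithm in \<open>w\<close> absorbs the square root in Stirling's formula. On the arc
  \<open>E\<close> only decays like \<open>1 / z\<close>, and the radius
  \<open>exp (- 1 / \<rho>)\<close> is what balances \<open>Gamma (1 + n / \<rho>) / R^n\<close>.
  Uniformity in \<zeta> comes from taking every limit along the product of
  \<open>sequentially\<close> and \<open>principal K\<close>.\<close>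

lemma pos_not_nonpos_Ints: "x > 0 \<Longrightarrow> (x::real) \<notin> \<int>\<^sub>\<le>\<^sub>0"
  by (auto elim!: nonpos_Ints_cases)

text \<open>Binet's function plus the constant \<open>ln (2 * pi) / 2\<close>, which stays inside
  until \<open>stirling_err_limit\<close> identifies it.\<close>

definition stirling_err :: "real \<Rightarrow> real" where
  "stirling_err x = ln_Gamma x - (x - 1/2) * ln x + x"

text \<open>The general term of Gudermann's series for the Stirling error.\<close>

definition stirling_step :: "real \<Rightarrow> real" where
  "stirling_step x = (x + 1/2) * (ln (x + 1) - ln x) - 1"

lemma stirling_err_step:
  assumes "x > 0"
  shows "stirling_err x - stirling_err (x + 1) = stirling_step x"
proof -
  have "ln_Gamma (x + 1) = ln x + ln_Gamma x"
    using assms less_imp_neq[OF Gamma_real_pos[OF assms], symmetric]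
    by (simp add: ln_Gamma_real_pos Gamma_plus1 ln_mult pos_not_nonpos_Ints)
  thus ?thesis unfolding stirling_err_def stirling_step_def by (simp add: algebra_simps)
qed

lemma stirling_err_telescope:
  assumes "x > 0"
  shows "stirling_err x = stirling_err (x + real n) + (\<Sum>m<n. stirling_step (x + real m))"
proof (induction n)
  case (Suc n)
  have "stirling_err (x + real n) = stirling_err (x + real (Suc n)) + stirling_step (x + real n)"
    using stirling_err_step[of "x + real n"] assms by (simp add: algebra_simps)
  with Suc show ?case by simp
qed simp

text \<open>The logarithm of Euler's limit for Gamma, with the Pochhammer symbol absorbed into
  \<open>Gamma (x + n)\<close>.\<close>

lemma ln_Gamma_shift_limit:
  fixes x :: real assumes "x > 0"
  shows "(\<lambda>n. ln_Gamma (x + real n) - ln (fact (n - 1)) - x * ln (real n)) \<longlonglongrightarrow> 0"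
proof -
  have G: "Gamma x > 0" by (rule Gamma_real_pos[OF assms])
  have "(\<lambda>n. ln (Gamma_series' x n)) \<longlonglongrightarrow> ln (Gamma x)"
    by (rule tendsto_ln[OF Gamma_series'_LIMSEQ]) (use G in auto)
  hence "(\<lambda>n. ln (Gamma x) - ln (Gamma_series' x n)) \<longlonglongrightarrow> ln (Gamma x) - ln (Gamma x)"
    by (rule tendsto_diff[OF tendsto_const])
  hence lim: "(\<lambda>n. ln (Gamma x) - ln (Gamma_series' x n)) \<longlonglongrightarrow> 0" by simp
  have "eventually (\<lambda>n. ln (Gamma x) - ln (Gamma_series' x n)
          = ln_Gamma (x + real n) - ln (fact (n - 1)) - x * ln (real n)) sequentially"
    using eventually_gt_at_top[of 0]
  proof eventually_elim
    case (elim n)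
    have p: "pochhammer x n > 0" using assms by (simp add: pochhammer_pos)
    have "Gamma (x + real n) = pochhammer x n * Gamma x"
      using pochhammer_Gamma[of x n] G pos_not_nonpos_Ints[OF assms] by (simp add: field_simps)
    hence "ln_Gamma (x + real n) = ln (pochhammer x n) + ln (Gamma x)"
      using assms p less_imp_neq[OF G, symmetric] by (simp add: ln_Gamma_real_pos ln_mult)
    moreover have "ln (Gamma_series' x n) = ln (fact (n - 1)) + x * ln (real n) - ln (pochhammer x n)"
      using p elim by (simp add: Gamma_series'_def ln_div ln_mult)
    ultimately show ?case by simp
  qed
  from Lim_transform_eventually[OF lim this] show ?thesis .
qed

text \<open>In a difference the factorials of the preceding lemma cancel. Hence telescoped sums
  leave no boundary term, although the limit of the error itself is still unknown.\<close>

lemma stirling_err_diff_limit: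
  fixes x y :: real assumes "x > 0" "y > 0"
  shows "(\<lambda>n. stirling_err (x + real n) - stirling_err (y + real n)) \<longlonglongrightarrow> 0"
proof -
  have aux: "(\<lambda>n. (x + real n - 1/2) * ln (x + real n) - (x + real n) - (y + real n - 1/2) * ln (y + real n)
              + (y + real n) - (x - y) * ln (real n)) \<longlonglongrightarrow> 0"
    by real_asymp
  from tendsto_diff[OF tendsto_diff[OF ln_Gamma_shift_limit[OF assms(1)] ln_Gamma_shift_limit[OF assms(2)]] aux]
  show ?thesis by (simp add: stirling_err_def algebra_simps)
qed

lemma nonpos_if_nondecreasing_to_0:
  fixes d :: "real \<Rightarrow> real"
  assumes "(d \<longlongrightarrow> 0) at_top" "t > 0"
    and "\<And>s. s > 0 \<Longrightarrow> \<exists>z. (d has_real_derivative z) (at s) \<and> 0 \<le> z"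
  shows "d t \<le> 0"
proof (rule tendsto_lowerbound[OF assms(1)])
  show "\<forall>\<^sub>F u in at_top. d t \<le> d u"
    using eventually_ge_at_top[of t]
  proof (rule eventually_mono)
    fix u assume "t \<le> u"
    thus "d t \<le> d u" by (rule DERIV_nonneg_imp_nondecreasing) (use assms(2,3) in auto)
  qed
qed simp

lemma stirling_step_antimono:
  assumes "0 < x" "x \<le> y" shows "stirling_step y \<le> stirling_step x"
proof -
  \<comment> \<open>The derivative of \<open>stirling_step\<close>: the integral of
    \<open>1 / t\<close> over \<open>[t, t + 1]\<close> minus its trapezoidal value. Convexity makes
    it negative; the proof uses that it increases to 0.\<close>
  define d where "d = (\<lambda>t::real. ln (t + 1) - ln t - (1 / t + 1 / (t + 1)) / 2)"
  have d_le: "d t \<le> 0" if "t > 0" for t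
  proof (rule nonpos_if_nondecreasing_to_0[OF _ that])
    show "(d \<longlongrightarrow> 0) at_top" unfolding d_def by real_asymp
    fix s :: real assume s: "s > 0"
    have "(d has_real_derivative (1 / s - 1 / (s + 1))\<^sup>2 / 2) (at s)"
      unfolding d_def using s
      by (auto intro!: derivative_eq_intros)
         (simp add: divide_simps power2_eq_square; simp add: algebra_simps)?
    thus "\<exists>z. (d has_real_derivative z) (at s) \<and> 0 \<le> z" by force
  qed
  show ?thesis
  proof (rule DERIV_nonpos_imp_nonincreasing[OF assms(2)])
    fix s assume s: "x \<le> s" "s \<le> y"
    have "(stirling_step has_real_derivative d s) (at s)"
      unfolding d_def stirling_step_def using s \<open>x > 0\<close>
      by (auto intro!: derivative_eq_intros simp: divide_simps) (simp_all add: algebra_simps)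
    thus "\<exists>z. (stirling_step has_real_derivative z) (at s) \<and> z \<le> 0" using d_le[of s] s assms by auto
  qed
qed

text \<open>Makes the decrease of \<open>stirling_step\<close> dominated by a quantity that
  telescopes. The Stirling error is asymptotically \<open>1 / (12 * x)\<close> up to its constant;
  the factor 1/4 is merely generous, since only the order in \<open>x\<close> matters later.\<close>

lemma stirling_step_lower:
  assumes "0 < x" "x \<le> y"
  shows "stirling_step x - (1 / (4 * x) - 1 / (4 * (x + 1)))
    \<le> stirling_step y - (1 / (4 * y) - 1 / (4 * (y + 1)))"
proof -
  define d where "d = (\<lambda>t::real. ln (t + 1) - ln t - (1 / t + 1 / (t + 1)) / 2
     + (1 / t\<^sup>2 - 1 / (t + 1)\<^sup>2) / 4)"
  have d_ge: "- d t \<le> 0" if "t > 0" for t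
  proof (rule nonpos_if_nondecreasing_to_0[OF _ that])
    show "((\<lambda>t. - d t) \<longlongrightarrow> 0) at_top" unfolding d_def by real_asymp
    fix s :: real assume s: "s > 0"
    have "(d has_real_derivative (1 / s - 1 / (s + 1))\<^sup>2 / 2 - (1 / s ^ 3 - 1 / (s + 1) ^ 3) / 2) (at s)"
    proof -
      have nz: "s \<noteq> 0" "s + 1 \<noteq> 0" "s > 0" using s by auto
      have "((\<lambda>t. 1 / t\<^sup>2 - 1 / (t + 1)\<^sup>2) has_real_derivative (2 / (s + 1) ^ 3 - 2 / s ^ 3)) (at s)"
        using nz by (auto intro!: derivative_eq_intros)
          (simp add: divide_simps power2_eq_square power3_eq_cube power4_eq_xxxx; algebra)
      moreover have "((\<lambda>t. ln (t + 1) - ln t - (1 / t + 1 / (t + 1)) / 2) has_real_derivative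
          (1 / s - 1 / (s + 1))\<^sup>2 / 2) (at s)"
        using nz by (auto intro!: derivative_eq_intros)
          (simp add: divide_simps power2_eq_square; simp add: algebra_simps)
      ultimately have "(d has_real_derivative
          (1 / s - 1 / (s + 1))\<^sup>2 / 2 + (2 / (s + 1) ^ 3 - 2 / s ^ 3) / 4) (at s)"
        unfolding d_def by (intro DERIV_add DERIV_cdivide)
      thus ?thesis by (simp add: algebra_simps diff_divide_distrib)
    qed
    moreover have "(1 / s - 1 / (s + 1))\<^sup>2 \<le> 1 / s ^ 3 - 1 / (s + 1) ^ 3"
    proof -
      have [simp]: "s > 0" using s by simp
      have "s \<noteq> 0" "s + 1 \<noteq> 0" using \<open>s > 0\<close> by linarith+
      hence [simp]: "s \<noteq> 0" "s + 1 \<noteq> 0" .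
      have "(1 / s - 1 / (s + 1)) = 1 / (s * (s + 1))" by (simp add: divide_simps)
      hence "(1 / s - 1 / (s + 1))\<^sup>2 = (s * (s + 1)) / (s * (s+1)) ^ 3"
        by (simp add: power2_eq_square power3_eq_cube divide_simps)
      also have "\<dots> \<le> (3 * s\<^sup>2 + 3 * s + 1) / (s * (s+1)) ^ 3"
      proof (intro divide_right_mono zero_le_power)
        have "s * s > 0" using \<open>s > 0\<close> by simp
        thus "s * (s + 1) \<le> 3 * s\<^sup>2 + 3 * s + 1" "0 \<le> s * (s + 1)"
          using \<open>s > 0\<close> unfolding power2_eq_square distrib_left by linarith+
      qed
      also have "\<dots> = 1 / s ^ 3 - 1 / (s + 1) ^ 3"
        by (simp add: power2_eq_square power3_eq_cube divide_simps) (simp add: algebra_simps)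
      finally show ?thesis .
    qed
    ultimately show "\<exists>z. ((\<lambda>t. - d t) has_real_derivative z) (at s) \<and> 0 \<le> z"
      by (intro exI conjI) (rule DERIV_minus, assumption, simp only: minus_diff_eq diff_ge_0_iff_ge divide_right_mono zero_le_numeral)
  qed
  show ?thesis
  proof (rule DERIV_nonneg_imp_nondecreasing[OF assms(2)])
    fix s assume s: "x \<le> s" "s \<le> y"
    have "((\<lambda>s. stirling_step s - (1 / (4 * s) - 1 / (4 * (s + 1)))) has_real_derivative d s) (at s)"
    proof -
      have nz: "s \<noteq> 0" "s + 1 \<noteq> 0" "s > 0" using s \<open>x > 0\<close> by auto
      have "((\<lambda>s. 1 / (4 * s) - 1 / (4 * (s + 1))) has_real_derivative - ((1 / s\<^sup>2 - 1 / (s + 1)\<^sup>2) / 4)) (at s)"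
        using nz by (auto intro!: derivative_eq_intros) (simp add: divide_simps power2_eq_square; algebra)
      moreover have "(stirling_step has_real_derivative ln (s + 1) - ln s - (1 / s + 1 / (s + 1)) / 2) (at s)"
        unfolding stirling_step_def using nz
        by (auto intro!: derivative_eq_intros simp: divide_simps) (simp_all add: algebra_simps)
      ultimately have "((\<lambda>s. stirling_step s - (1 / (4 * s) - 1 / (4 * (s + 1)))) has_real_derivative
          ln (s + 1) - ln s - (1 / s + 1 / (s + 1)) / 2 - - ((1 / s\<^sup>2 - 1 / (s + 1)\<^sup>2) / 4)) (at s)"
        by (intro DERIV_diff)
      thus ?thesis by (simp add: d_def)
    qed
    thus "\<exists>z. ((\<lambda>s. stirling_step s - (1 / (4 * s) - 1 / (4 * (s + 1)))) has_real_derivative z) (at s) \<and> 0 \<le> z"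
      using d_ge[of s] s assms by auto
  qed
qed

text \<open>Telescoping along \<open>x + n\<close> and \<open>y + n\<close>. For
  \<open>y = x + h\<close> the upper bound is of order \<open>1 / x^2\<close>, small enough to
  survive the multiplication by \<open>x\<close> in \<open>ln_Gamma_ratio_limit\<close>.\<close>

lemma stirling_err_bounds:
  assumes "0 < x" "x \<le> y"
  shows "0 \<le> stirling_err x - stirling_err y"
    and "stirling_err x - stirling_err y \<le> 1 / (4 * x) - 1 / (4 * y)"
proof -
  let ?D = "\<lambda>n. stirling_err (x + real n) - stirling_err (y + real n)"
  have eq: "stirling_err x - stirling_err y
      = ?D n + (\<Sum>m<n. stirling_step (x + real m) - stirling_step (y + real m))" for n
    using stirling_err_telescope[of x n] stirling_err_telescope[of y n] assms
    by (simp add: sum_subtractf)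
  have lim: "?D \<longlonglongrightarrow> 0" by (rule stirling_err_diff_limit) (use assms in auto)
  show "0 \<le> stirling_err x - stirling_err y"
  proof (rule tendsto_upperbound[OF lim])
    show "\<forall>\<^sub>F n in sequentially. ?D n \<le> stirling_err x - stirling_err y"
    proof (rule always_eventually, rule allI)
      fix n
      have "0 \<le> (\<Sum>m<n. stirling_step (x + real m) - stirling_step (y + real m))"
        by (intro sum_nonneg) (use stirling_step_antimono assms in auto)
      thus "?D n \<le> stirling_err x - stirling_err y" using eq[of n] by simp
    qed
  qed simp
  define k where "k = (\<lambda>t::real. 1 / (4 * t))"
  have up: "(\<Sum>m<n. stirling_step (x + real m) - stirling_step (y + real m))
       \<le> k x - k (x + real n) - (k y - k (y + real n))" for n
  proof -
    have "(\<Sum>m<n. stirling_step (x + real m) - stirling_step (y + real m))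
       \<le> (\<Sum>m<n. (k (x + real m) - k (x + real (Suc m))) - (k (y + real m) - k (y + real (Suc m))))"
    proof (rule sum_mono)
      fix m
      show "stirling_step (x + real m) - stirling_step (y + real m) \<le>
         (k (x + real m) - k (x + real (Suc m))) - (k (y + real m) - k (y + real (Suc m)))"
        using stirling_step_lower[of "x + real m" "y + real m"] assms
        by (simp add: k_def algebra_simps)
    qed
    also have "\<dots> = k x - k (x + real n) - (k y - k (y + real n))"
      using sum_lessThan_telescope'[of "\<lambda>m. k (x + real m)" n]
            sum_lessThan_telescope'[of "\<lambda>m. k (y + real m)" n]
      by (simp add: sum_subtractf)
    finally show ?thesis .
  qed
  have "(\<lambda>n. ?D n + (k x - k (x + real n) - (k y - k (y + real n)))) \<longlonglongrightarrow> 0 + (k x - 0 - (k y - 0))"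
    by (intro tendsto_intros lim) (unfold k_def, real_asymp+)
  hence lim2: "(\<lambda>n. ?D n + (k x - k (x + real n) - (k y - k (y + real n)))) \<longlonglongrightarrow> k x - k y" by simp
  show "stirling_err x - stirling_err y \<le> 1 / (4 * x) - 1 / (4 * y)"
  proof (rule tendsto_lowerbound)
    show "(\<lambda>n. ?D n + (k x - k (x + real n) - (k y - k (y + real n)))) \<longlonglongrightarrow> 1 / (4 * x) - 1 / (4 * y)"
      using lim2 by (simp add: k_def)
    show "\<forall>\<^sub>F n in sequentially. stirling_err x - stirling_err y
        \<le> ?D n + (k x - k (x + real n) - (k y - k (y + real n)))"
    proof (intro always_eventually allI)
      fix n
      show "stirling_err x - stirling_err y \<le> ?D n + (k x - k (x + real n) - (k y - k (y + real n)))"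
        using eq[of n] up[of n] by linarith
    qed
  qed simp
qed

text \<open>Monotonicity and a lower bound give a limit along the integers, the bounds above carry
  it over to real arguments, and Legendre's duplication formula identifies it.\<close>

lemma stirling_err_limit: "(stirling_err \<longlongrightarrow> ln (2 * pi) / 2) at_top"
proof -
  have "decseq (\<lambda>n. stirling_err (real (Suc n)))"
    by (intro decseq_SucI) (use stirling_err_bounds(1) in force)
  moreover have "stirling_err 1 - 1/4 \<le> stirling_err (real (Suc n))" for n
  proof -
    have "stirling_err 1 - stirling_err (real (Suc n)) \<le> 1 / 4 - 1 / (4 * real (Suc n))"
      using stirling_err_bounds(2)[of 1 "real (Suc n)"] by simp
    also have "\<dots> \<le> 1/4" by simp
    finally show ?thesis by simp
  qed
  ultimately obtain L where "(\<lambda>n. stirling_err (real (Suc n))) \<longlonglongrightarrow> L"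
    using decseq_convergent by metis
  hence L: "(\<lambda>n. stirling_err (real n)) \<longlonglongrightarrow> L" by (rule filterlim_sequentially_Suc[THEN iffD1])
  have flim: "filterlim (\<lambda>x::real. nat \<lceil>x\<rceil>) sequentially at_top"
    by real_asymp
  have "((\<lambda>x. stirling_err x - stirling_err (real (nat \<lceil>x\<rceil>))) \<longlongrightarrow> 0) at_top"
  proof (rule tendsto_sandwich[where f = "\<lambda>_. 0" and h = "\<lambda>x. 1 / (4 * x)"])
    show "((\<lambda>x::real. 1 / (4 * x)) \<longlongrightarrow> 0) at_top" by real_asymp
    show "\<forall>\<^sub>F x in at_top. 0 \<le> stirling_err x - stirling_err (real (nat \<lceil>x\<rceil>))"
      using eventually_gt_at_top[of 0] by eventually_elim (rule stirling_err_bounds, auto)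
    show "\<forall>\<^sub>F x in at_top. stirling_err x - stirling_err (real (nat \<lceil>x\<rceil>)) \<le> 1 / (4 * x)"
      using eventually_gt_at_top[of 0]
    proof eventually_elim
      case (elim x)
      have "stirling_err x - stirling_err (real (nat \<lceil>x\<rceil>)) \<le> 1 / (4 * x) - 1 / (4 * real (nat \<lceil>x\<rceil>))"
        by (rule stirling_err_bounds) (use elim in auto)
      also have "\<dots> \<le> 1 / (4 * x)" using elim by simp
      finally show ?case .
    qed
  qed auto
  from tendsto_add[OF this filterlim_compose[OF L flim]]
  have gL: "(stirling_err \<longlongrightarrow> L) at_top" by simp
  \<comment> \<open>By duplication the errors at \<open>x\<close>, \<open>x + 1/2\<close> and
    \<open>2 * x\<close> combine to this elementary function. The combination tends to
    \<open>L + L - L\<close>, so the limit of \<open>E\<close> is \<open>L\<close> itself.\<close>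
  define E where "E = (\<lambda>x::real. (1 - 2 * x) * ln 2 + ln pi / 2 - (x - 1/2) * ln x + x - x * ln (x + 1/2) + x + 1/2
        + (2 * x - 1/2) * ln (2 * x) - 2 * x)"
  have "((\<lambda>x. stirling_err x + stirling_err (x + 1/2) - stirling_err (2 * x)) \<longlongrightarrow> L + L - L) at_top"
    by (intro tendsto_intros gL filterlim_compose[OF gL]; real_asymp)
  moreover have "eventually (\<lambda>x. stirling_err x + stirling_err (x + 1/2) - stirling_err (2 * x) = E x) at_top"
    using eventually_gt_at_top[of 0]
  proof eventually_elim
    case (elim x)
    have "complex_of_real x + 1 / 2 = of_real (x + 1/2)" by simp
    hence "complex_of_real x \<notin> \<int>\<^sub>\<le>\<^sub>0 \<and> complex_of_real x + 1 / 2 \<notin> \<int>\<^sub>\<le>\<^sub>0"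
      using elim pos_not_nonpos_Ints[of x] pos_not_nonpos_Ints[of "x + 1/2"]
      by (metis add_pos_pos half_gt_zero_iff of_real_in_nonpos_Ints_iff zero_less_one)
    with Gamma_legendre_duplication[of "of_real x"]
    have "Gamma (of_real x) * Gamma (of_real (x + 1/2)) =
        exp (of_real ((1 - 2 * x) * ln 2)) * of_real (sqrt pi) * Gamma (complex_of_real (2 * x))"
      by simp
    hence "of_real (Gamma x * Gamma (x + 1/2))
        = complex_of_real (exp ((1 - 2 * x) * ln 2) * sqrt pi * Gamma (2 * x))"
      by (simp only: Gamma_complex_of_real exp_of_real of_real_mult[symmetric])
    hence "Gamma x * Gamma (x + 1/2) = exp ((1 - 2 * x) * ln 2) * sqrt pi * Gamma (2 * x)"
      by (simp only: of_real_eq_iff)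
    hence *: "ln (Gamma x * Gamma (x + 1/2)) = ln (exp ((1 - 2 * x) * ln 2) * sqrt pi * Gamma (2 * x))"
      by simp
    have "ln_Gamma x + ln_Gamma (x + 1/2) = ln (Gamma x * Gamma (x + 1/2))"
      using elim by (simp add: ln_mult_pos Gamma_real_pos ln_Gamma_real_pos)
    also note *
    also have "ln (exp ((1 - 2 * x) * ln 2) * sqrt pi * Gamma (2 * x))
        = (1 - 2 * x) * ln 2 + ln pi / 2 + ln_Gamma (2 * x)"
      using elim by (simp add: ln_mult_pos Gamma_real_pos ln_Gamma_real_pos ln_sqrt)
    finally have "ln_Gamma x + ln_Gamma (x + 1/2) = (1 - 2 * x) * ln 2 + ln pi / 2 + ln_Gamma (2 * x)" .
    thus ?case by (simp add: stirling_err_def E_def algebra_simps)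
  qed
  ultimately have "(E \<longlongrightarrow> L) at_top" by (simp add: tendsto_cong)
  moreover have "(E \<longlongrightarrow> ln 2 / 2 + ln pi / 2) at_top" unfolding E_def by real_asymp
  ultimately have "L = ln 2 / 2 + ln pi / 2" by (intro tendsto_unique[of at_top]) auto
  thus ?thesis using gL by (simp add: ln_mult add_divide_distrib)
qed


lemma ln_Gamma_plus1_conv_stirling_err:
  assumes "x > 0" shows "ln_Gamma (1 + x) = stirling_err x + (x + 1/2) * ln x - x"
proof -
  have "ln_Gamma (x + 1) = ln x + ln_Gamma x"
    using assms less_imp_neq[OF Gamma_real_pos[OF assms], symmetric]
    by (simp add: ln_Gamma_real_pos Gamma_plus1 ln_mult pos_not_nonpos_Ints)
  thus ?thesis by (simp add: stirling_err_def algebra_simps)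
qed

lemma ln_Gamma_stirling:
  "((\<lambda>x::real. ln_Gamma (1 + x) - (x * ln x - x + ln (2 * pi * x) / 2)) \<longlongrightarrow> 0) at_top"
proof (rule Lim_transform_eventually)
  show "((\<lambda>x. stirling_err x - ln (2 * pi) / 2) \<longlongrightarrow> 0) at_top"
    using tendsto_diff[OF stirling_err_limit tendsto_const[of "ln (2 * pi) / 2"]] by simp
  show "\<forall>\<^sub>F x in at_top. stirling_err x - ln (2 * pi) / 2
      = ln_Gamma (1 + x) - (x * ln x - x + ln (2 * pi * x) / 2)"
    using eventually_gt_at_top[of 0]
  proof eventually_elim
    case (elim x)
    thus ?case using ln_Gamma_plus1_conv_stirling_err[OF elim] by (simp add: ln_mult algebra_simps)
  qed
qed

text \<open>The logarithmic form of \<open>Gamma (1 + x) / Gamma (1 + x - h) = x powr h * (1 + h *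
  (1 - h) / (2 * x) + ...)\<close>. With \<open>h = 1 / \<rho>\<close> the limit is the constant
  \<open>(\<rho> - 1) / (2 * \<rho>)\<close> of the theorem.\<close>

lemma ln_Gamma_ratio_limit:
  fixes h :: real assumes h: "0 < h" "h < 1"
  shows "((\<lambda>x. x * ((ln_Gamma (1 + x) - ln_Gamma (1 + x - h)) / h - ln x)) \<longlongrightarrow> (1 - h) / 2) at_top"
proof -
  have err: "((\<lambda>x. x * (stirling_err (1 + x) - stirling_err (1 + x - h)) / h) \<longlongrightarrow> 0) at_top"
  proof (rule tendsto_sandwich[where g = "\<lambda>x. x * (stirling_err (1 + x) - stirling_err (1 + x - h)) / h"])
    show "((\<lambda>x::real. - (x * (1 / (4 * (1 + x - h)) - 1 / (4 * (1 + x))) / h)) \<longlongrightarrow> 0) at_top"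
      using h by real_asymp
    show "\<forall>\<^sub>F x in at_top. - (x * (1 / (4 * (1 + x - h)) - 1 / (4 * (1 + x))) / h)
         \<le> x * (stirling_err (1 + x) - stirling_err (1 + x - h)) / h"
      using eventually_gt_at_top[of 0]
    proof eventually_elim
      case (elim x)
      have "x * (stirling_err (1 + x - h) - stirling_err (1 + x))
         \<le> x * (1 / (4 * (1 + x - h)) - 1 / (4 * (1 + x)))"
        by (intro mult_left_mono stirling_err_bounds) (use elim h in auto)
      from divide_right_mono[OF this, of h] h show ?case
        by (simp add: diff_divide_distrib right_diff_distrib)
    qed
    show "\<forall>\<^sub>F x in at_top. x * (stirling_err (1 + x) - stirling_err (1 + x - h)) / h \<le> 0"
      using eventually_gt_at_top[of 0]
    proof eventually_elim
      case (elim x)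
      have "0 \<le> stirling_err (1 + x - h) - stirling_err (1 + x)"
        by (rule stirling_err_bounds) (use elim h in auto)
      thus ?case using elim h by (simp add: divide_le_0_iff mult_le_0_iff)
    qed
  qed auto
  have main: "((\<lambda>x::real. x * (((x + 1/2) * ln (1 + x) - (x - h + 1/2) * ln (1 + x - h) - h) / h - ln x))
     \<longlongrightarrow> (1 - h) / 2) at_top"
    using h by (real_asymp simp: field_simps)
  show ?thesis
  proof (rule Lim_transform_eventually)
    show "((\<lambda>x. x * (stirling_err (1 + x) - stirling_err (1 + x - h)) / h
       + x * (((x + 1/2) * ln (1 + x) - (x - h + 1/2) * ln (1 + x - h) - h) / h - ln x))
      \<longlongrightarrow> (1 - h) / 2) at_top"
      using tendsto_add[OF err main] by simp
    show "\<forall>\<^sub>F x in at_top. x * (stirling_err (1 + x) - stirling_err (1 + x - h)) / h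
       + x * (((x + 1/2) * ln (1 + x) - (x - h + 1/2) * ln (1 + x - h) - h) / h - ln x)
      = x * ((ln_Gamma (1 + x) - ln_Gamma (1 + x - h)) / h - ln x)"
    proof (rule always_eventually, rule allI)
      fix x :: real
      show "x * (stirling_err (1 + x) - stirling_err (1 + x - h)) / h
       + x * (((x + 1/2) * ln (1 + x) - (x - h + 1/2) * ln (1 + x - h) - h) / h - ln x)
      = x * ((ln_Gamma (1 + x) - ln_Gamma (1 + x - h)) / h - ln x)"
        using h by (simp add: stirling_err_def field_simps)
    qed
  qed
qed


section \<open>Growth and monotonicity of the ratios \<open>ml_R\<close>\<close>

lemma ml_R_pos: "\<rho> > 1 \<Longrightarrow> ml_R \<rho> n > 0"
proof -
  assume "\<rho> > 1"
  hence "1 + (real n - 1) / \<rho> > 0" "1 + real n / \<rho> > 0"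
    by (auto simp: field_simps add_pos_nonneg)
  thus ?thesis unfolding ml_R_def by (intro divide_pos_pos Gamma_real_pos)
qed

lemma ln_ml_R:
  assumes "\<rho> > 1"
  shows "ln (ml_R \<rho> n) = ln_Gamma (1 + real n / \<rho>) - ln_Gamma (1 + real n / \<rho> - 1 / \<rho>)"
proof -
  have "real n / \<rho> \<ge> 0" "1 / \<rho> < 1" using assms by simp_all
  hence "1 + real n / \<rho> - 1 / \<rho> > 0" "1 + real n / \<rho> > 0" by linarith+
  moreover from this have "ln (Gamma (1 + real n / \<rho>) / Gamma (1 + real n / \<rho> - 1 / \<rho>))
      = ln (Gamma (1 + real n / \<rho>)) - ln (Gamma (1 + real n / \<rho> - 1 / \<rho>))"
    by (intro ln_divide_pos Gamma_real_pos)
  ultimately show ?thesis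
    by (simp add: ml_R_def ln_Gamma_real_pos diff_divide_distrib add_diff_eq)
qed

lemma filterlim_real_divide_at_top:
  "\<rho> > 0 \<Longrightarrow> filterlim (\<lambda>n. real n / \<rho>) at_top sequentially"
  by real_asymp

lemma ln_ml_R_limit:
  assumes "\<rho> > 1"
  shows "(\<lambda>n. real n / \<rho> * (\<rho> * ln (ml_R \<rho> n) - ln (real n / \<rho>))) \<longlonglongrightarrow> (\<rho> - 1) / (2 * \<rho>)"
proof -
  have "0 < 1 / \<rho>" "1 / \<rho> < 1" using assms by auto
  from filterlim_compose[OF ln_Gamma_ratio_limit[OF this] filterlim_real_divide_at_top[of \<rho>]]
  show ?thesis using assms by (simp add: ln_ml_R field_simps)
qed

text \<open>The terms of order \<open>n * ln n\<close> in Stirling's formula and in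
  \<open>n * ln R\<close> cancel. The limit is what the second-order term of \<open>ln R\<close>
  leaves behind after multiplication by \<open>n\<close>.\<close>

lemma Gamma_div_ml_R_power_limit:
  assumes "\<rho> > 1"
  shows "(\<lambda>n. ln_Gamma (1 + real n / \<rho>) - real n * ln (ml_R \<rho> n)
           - (ln (2 * pi * (real n / \<rho>)) / 2 - real n / \<rho>)) \<longlonglongrightarrow> - ((\<rho> - 1) / (2 * \<rho>))"
proof -
  have "(\<lambda>n. ln_Gamma (1 + real n / \<rho>) - (real n / \<rho> * ln (real n / \<rho>) - real n / \<rho>
         + ln (2 * pi * (real n / \<rho>)) / 2)) \<longlonglongrightarrow> 0"
    by (rule filterlim_compose[OF ln_Gamma_stirling filterlim_real_divide_at_top]) (use assms in auto)
  from tendsto_diff[OF this ln_ml_R_limit[OF assms]]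
  show ?thesis using assms by (simp add: algebra_simps)
qed

lemma ln_ml_R_asymp:
  assumes "\<rho> > 1"
  shows "(\<lambda>n. \<rho> * ln (ml_R \<rho> n) - ln (real n / \<rho>)) \<longlonglongrightarrow> 0"
proof -
  have "(\<lambda>n. (real n / \<rho> * (\<rho> * ln (ml_R \<rho> n) - ln (real n / \<rho>))) / (real n / \<rho>)) \<longlonglongrightarrow> 0"
    by (rule tendsto_divide_0[OF ln_ml_R_limit[OF assms]], rule filterlim_at_top_imp_at_infinity,
        rule filterlim_real_divide_at_top) (use assms in auto)
  thus ?thesis
    by (rule Lim_transform_eventually)
       (rule eventually_mono[OF eventually_gt_at_top[of 0]], use assms in auto)
qed

text \<open>An additive error \<open>o(1)\<close> is needed here, not just asymptotic equivalence:
  \<open>exp (z powr \<rho>)\<close> turns the additive constant into a factor of the limit.\<close>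

lemma ml_R_powr_limit:
  assumes "\<rho> > 1"
  shows "(\<lambda>n. ml_R \<rho> n powr \<rho> - real n / \<rho>) \<longlonglongrightarrow> (\<rho> - 1) / (2 * \<rho>)"
proof -
  define d where "d = (\<lambda>n. \<rho> * ln (ml_R \<rho> n) - ln (real n / \<rho>))"
  \<comment> \<open>The continuous extension of \<open>(exp x - 1) / x\<close>; it keeps
    \<open>d n * e (d n) = exp (d n) - 1\<close> valid even if \<open>d n = 0\<close>.\<close>
  define e where "e = (\<lambda>x::real. if x = 0 then 1 else (exp x - 1) / x)"
  have e: "(e \<longlongrightarrow> 1) (at 0)"
    by (rule Lim_transform_eventually[of "\<lambda>x. (exp x - 1) / x"]) (real_asymp, auto simp: e_def eventually_at_filter)
  hence "isCont e 0" by (simp add: isCont_def e_def)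
  hence "(\<lambda>n. e (d n)) \<longlonglongrightarrow> e 0"
    by (rule isCont_tendsto_compose) (use ln_ml_R_asymp[OF assms] in \<open>simp add: d_def\<close>)
  from tendsto_mult[OF ln_ml_R_limit[OF assms] this]
  have "(\<lambda>n. real n / \<rho> * d n * e (d n)) \<longlonglongrightarrow> (\<rho> - 1) / (2 * \<rho>)" by (simp add: d_def e_def)
  thus ?thesis
  proof (rule Lim_transform_eventually)
    show "\<forall>\<^sub>F n in sequentially. real n / \<rho> * d n * e (d n) = ml_R \<rho> n powr \<rho> - real n / \<rho>"
      using eventually_gt_at_top[of 0]
    proof eventually_elim
      case (elim n)
      have "real n / \<rho> * exp (d n) = ml_R \<rho> n powr \<rho>"
        using elim assms ml_R_pos[OF assms, of n]
        by (simp add: d_def exp_diff powr_def)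
      moreover have "d n * e (d n) = exp (d n) - 1" by (simp add: e_def)
      ultimately show ?case by (metis (no_types) mult.assoc mult.right_neutral right_diff_distrib)
    qed
  qed
qed

lemma filterlim_ml_R: 
  assumes "\<rho> > 1" shows "filterlim (ml_R \<rho>) at_top sequentially"
proof -
  have "filterlim (\<lambda>n. (\<rho> * ln (ml_R \<rho> n) - ln (real n / \<rho>)) + ln (real n / \<rho>)) at_top sequentially"
    by (rule filterlim_tendsto_add_at_top[OF ln_ml_R_asymp[OF assms]]) (use assms in real_asymp)
  hence "filterlim (\<lambda>n. \<rho> * ln (ml_R \<rho> n)) at_top sequentially" by simp
  hence "filterlim (\<lambda>n. (1 / \<rho>) * (\<rho> * ln (ml_R \<rho> n))) at_top sequentially"
    by (rule filterlim_tendsto_pos_mult_at_top[OF tendsto_const, rotated]) (use assms in auto)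
  hence "filterlim (\<lambda>n. exp (ln (ml_R \<rho> n))) at_top sequentially"
    using assms by (intro filterlim_compose[OF exp_at_top]) simp
  thus ?thesis using ml_R_pos[OF assms] by simp
qed

lemma ml_R_ratio_limit:
  assumes "\<rho> > 1"
  shows "(\<lambda>n. ml_R \<rho> (n + k) / ml_R \<rho> n) \<longlonglongrightarrow> 1"
proof -
  have "(\<lambda>n. \<rho> * ln (ml_R \<rho> (n + k)) - ln (real (n + k) / \<rho>)) \<longlonglongrightarrow> 0"
    by (rule LIMSEQ_ignore_initial_segment[OF ln_ml_R_asymp[OF assms]])
  from tendsto_diff[OF this ln_ml_R_asymp[OF assms]]
  have 1: "(\<lambda>n. \<rho> * ln (ml_R \<rho> (n + k)) - ln (real (n + k) / \<rho>) - (\<rho> * ln (ml_R \<rho> n) - ln (real n / \<rho>))) \<longlonglongrightarrow> 0"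
    by simp
  have 2: "(\<lambda>n. ln (real (n + k) / \<rho>) - ln (real n / \<rho>)) \<longlonglongrightarrow> 0"
    using assms by real_asymp
  from tendsto_mult[OF tendsto_const[of "1/\<rho>"] tendsto_add[OF 1 2]]
  have "(\<lambda>n. ln (ml_R \<rho> (n + k)) - ln (ml_R \<rho> n)) \<longlonglongrightarrow> 0"
    using assms by (simp add: right_diff_distrib)
  from tendsto_exp[OF this] show ?thesis
    using ml_R_pos[OF assms] by (simp add: exp_diff)
qed

lemma ml_R_mono:
  assumes "\<rho> > 1" "1 \<le> n"
  shows "ml_R \<rho> n \<le> ml_R \<rho> (Suc n)"
proof -
  define x where "x = 1 + (real n - 1) / \<rho>"
  define h where "h = 1 / \<rho>"
  have x: "x > 0" "h > 0" using assms by (auto simp: x_def h_def field_simps add_pos_nonneg)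
  \<comment> \<open>\<open>x + h\<close> is the midpoint of \<open>x\<close> and
    \<open>x + 2 * h\<close>, so convexity compares two consecutive ratios.\<close>
  have "(ln \<circ> Gamma) ((1 - 1/2) *\<^sub>R x + (1/2) *\<^sub>R (x + 2 * h))
      \<le> (1 - 1/2) * (ln \<circ> Gamma) x + (1/2) * (ln \<circ> Gamma) (x + 2 * h)"
    by (rule convex_onD[OF log_convex_Gamma_real]) (use x in auto)
  hence "2 * ln (Gamma (x + h)) \<le> ln (Gamma x) + ln (Gamma (x + 2 * h))"
  proof -
    assume "(ln \<circ> Gamma) ((1 - 1/2) *\<^sub>R x + (1/2) *\<^sub>R (x + 2 * h))
      \<le> (1 - 1/2) * (ln \<circ> Gamma) x + (1/2) * (ln \<circ> Gamma) (x + 2 * h)"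
    moreover have "(1 - 1/2) *\<^sub>R x + (1/2) *\<^sub>R (x + 2 * h) = x + h" by (simp add: field_simps)
    ultimately show ?thesis by simp
  qed
  hence "ln (Gamma (x + h)) - ln (Gamma x) \<le> ln (Gamma (x + 2 * h)) - ln (Gamma (x + h))" by simp
  moreover have "Gamma x > 0" "Gamma (x + h) > 0" "Gamma (x + 2 * h) > 0"
    using x by (auto intro!: Gamma_real_pos)
  ultimately have "ln (Gamma (x + h) / Gamma x) \<le> ln (Gamma (x + 2 * h) / Gamma (x + h))"
    by (simp add: ln_div)
  hence "Gamma (x + h) / Gamma x \<le> Gamma (x + 2 * h) / Gamma (x + h)"
    using \<open>Gamma x > 0\<close> \<open>Gamma (x + h) > 0\<close> \<open>Gamma (x + 2 * h) > 0\<close> by simp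
  moreover have "x + h = 1 + real n / \<rho>" "x + 2 * h = 1 + real (Suc n) / \<rho>"
    using assms by (simp_all add: x_def h_def field_simps)
  ultimately show ?thesis unfolding ml_R_def by (simp add: x_def[symmetric])
qed

section \<open>Hankel contours\<close>

lemma continuous_on_horizontal: "continuous_on A (\<lambda>x. Complex x c)"
  by (simp add: Complex_eq[abs_def], intro continuous_intros)

lemma continuous_on_vertical: "continuous_on A (\<lambda>y. Complex c y)"
  by (simp add: Complex_eq[abs_def], intro continuous_intros)

lemma has_contour_integral_linepath_same_Im:
  assumes "a < b" "continuous_on {a..b} (\<lambda>x. f (Complex x c))"
  shows "(f has_contour_integral integral {a..b} (\<lambda>x. f (Complex x c))) (linepath (Complex a c) (Complex b c))"
proof -
  define h where "h = (\<lambda>x. f (Complex x c))"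
  have "(h has_integral integral {a..b} h) (cbox a b)"
    using assms by (auto simp: h_def intro!: integrable_integral integrable_continuous_interval)
  from has_integral_affinity[OF this, of "b - a" a] assms(1)
  have "((\<lambda>x. h ((b - a) * x + a)) has_integral (1 / (b - a)) *\<^sub>R integral {a..b} h)
          ((\<lambda>x. x / (b - a) - a / (b - a)) ` {a..b})"
    by (simp add: image_affinity_atLeastAtMost_div_diff)
  also have "(\<lambda>x. x / (b - a) - a / (b - a)) ` {a..b} = {0..1}"
    using image_affinity_atLeastAtMost_div_diff[of "b - a" "a / (b - a)" a b] assms(1)
    by (simp add: diff_divide_distrib[symmetric])
  finally have *: "((\<lambda>x. h ((b - a) * x + a)) has_integral (1 / (b - a)) *\<^sub>R integral {a..b} h) {0..1}" .
  have "Complex b c - Complex a c = of_real (b - a)" by (simp add: complex_eq_iff)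
  moreover have "linepath (Complex a c) (Complex b c) x = Complex ((b - a) * x + a) c" for x
    by (simp add: linepath_def complex_eq_iff algebra_simps)
  ultimately show ?thesis
    using has_integral_mult_left[OF *, of "of_real (b - a)"] assms(1)
    unfolding has_contour_integral_linepath by (simp add: h_def scaleR_conv_of_real mult.commute)
qed

lemma contour_integral_rectpath:
  assumes "a < a'" "b < b'"
    and cont: "continuous_on (path_image (rectpath (Complex a b) (Complex a' b'))) g"
  shows "contour_integral (rectpath (Complex a b) (Complex a' b')) g =
     integral {a..a'} (\<lambda>x. g (Complex x b)) + \<i> * integral {b..b'} (\<lambda>y. g (Complex a' y))
     - integral {a..a'} (\<lambda>x. g (Complex x b')) - \<i> * integral {b..b'} (\<lambda>y. g (Complex a y))"
proof -
  have pi: "path_image (rectpath (Complex a b) (Complex a' b')) =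
      {w. Re w \<in> {a, a'} \<and> Im w \<in> {b..b'}} \<union> {w. Im w \<in> {b, b'} \<and> Re w \<in> {a..a'}}"
    using path_image_rectpath[of "Complex a b" "Complex a' b'"] assms by auto
  have ch: "continuous_on {a..a'} (\<lambda>x. g (Complex x c))" if "c \<in> {b, b'}" for c
    by (rule continuous_on_compose2[OF cont continuous_on_horizontal]) (use that assms(1,2) in \<open>auto simp: pi\<close>)
  have cv: "continuous_on {b..b'} (\<lambda>y. g (Complex c y))" if "c \<in> {a, a'}" for c
    by (rule continuous_on_compose2[OF cont continuous_on_vertical]) (use that assms(1,2) in \<open>auto simp: pi\<close>)
  have h: "(g has_contour_integral integral {a..a'} (\<lambda>x. g (Complex x c))) (linepath (Complex a c) (Complex a' c))"
    if "c \<in> {b, b'}" for c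
    by (rule has_contour_integral_linepath_same_Im[OF assms(1) ch[OF that]])
  have v: "(g has_contour_integral \<i> * integral {b..b'} (\<lambda>y. g (Complex c y))) (linepath (Complex c b) (Complex c b'))"
    if "c \<in> {a, a'}" for c
    using integrable_integral[OF integrable_continuous_interval[OF cv[OF that]]]
    by (subst has_contour_integral_linepath_same_Re_iff[OF _ _ _ _ assms(2)]) auto
  let ?b = "Complex a' b" and ?d = "Complex a b'"
  have hr: "(g has_contour_integral - integral {a..a'} (\<lambda>x. g (Complex x b'))) (linepath (Complex a' b') ?d)"
    using has_contour_integral_reversepath[OF valid_path_linepath h[of b']] by simp
  have vr: "(g has_contour_integral - (\<i> * integral {b..b'} (\<lambda>y. g (Complex a y)))) (linepath ?d (Complex a b))"
    using has_contour_integral_reversepath[OF valid_path_linepath v[of a]] by simp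
  have h1: "(g has_contour_integral integral {a..a'} (\<lambda>x. g (Complex x b))) (linepath (Complex a b) ?b)"
    by (rule h) simp
  have v1: "(g has_contour_integral \<i> * integral {b..b'} (\<lambda>y. g (Complex a' y))) (linepath ?b (Complex a' b'))"
    by (rule v) simp
  note j1 = has_contour_integral_join[OF hr vr valid_path_linepath valid_path_linepath]
  note j2 = has_contour_integral_join[OF v1 j1 valid_path_linepath valid_path_join[OF valid_path_linepath valid_path_linepath]]
  have "(g has_contour_integral integral {a..a'} (\<lambda>x. g (Complex x b))
     + (\<i> * integral {b..b'} (\<lambda>y. g (Complex a' y))
     + (- integral {a..a'} (\<lambda>x. g (Complex x b')) + - (\<i> * integral {b..b'} (\<lambda>y. g (Complex a y))))))
      (rectpath (Complex a b) (Complex a' b'))"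
    unfolding rectpath_def Let_def complex.sel
    by (rule has_contour_integral_join[OF h1 j2 valid_path_linepath]) simp_all
  thus ?thesis by (intro contour_integral_unique) (simp add: algebra_simps)
qed

text \<open>
  Contours are taken in the logarithmic coordinate \<open>v = ln u\<close>, so that rays and arcs become horizontal half-lines
  and vertical segments, and sector estimates become estimates on rectangles.
\<close>

definition ray :: "(complex \<Rightarrow> complex) \<Rightarrow> real \<Rightarrow> real \<Rightarrow> complex" where
  "ray g a b = integral {a..} (\<lambda>x. g (Complex x b))"

definition edge :: "(complex \<Rightarrow> complex) \<Rightarrow> real \<Rightarrow> real \<Rightarrow> complex" where
  "edge g a b = integral {- b..b} (\<lambda>y. g (Complex a y))"

text \<open>Orientation: inwards along the lower ray, up the edge, outwards along the upper ray. In
  \<open>u = exp v\<close> the rays have arguments \<open>- b\<close> and \<open>b\<close>, chosen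
  later so that \<open>exp (u powr \<rho>)\<close> decays along them.\<close>

definition hankel :: "(complex \<Rightarrow> complex) \<Rightarrow> real \<Rightarrow> real \<Rightarrow> complex" where
  "hankel g a b = ray g a b - ray g a (- b) + \<i> * edge g a b"

definition hcontour :: "real \<Rightarrow> real \<Rightarrow> complex set" where
  "hcontour a b = {v. Re v \<ge> a \<and> \<bar>Im v\<bar> = b} \<union> {v. Re v = a \<and> \<bar>Im v\<bar> \<le> b}"

text \<open>One fixed rate of decay, \<open>1 / |u|\<close> in the original coordinate, makes both
  rays absolutely convergent and bounds the whole integral by a multiple of
  \<open>exp (- a)\<close>.\<close>

definition hbounded :: "(complex \<Rightarrow> complex) \<Rightarrow> real \<Rightarrow> real \<Rightarrow> real \<Rightarrow> bool" where
  "hbounded g a b D \<longleftrightarrow> continuous_on (hcontour a b) g \<and>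
     (\<forall>v\<in>hcontour a b. norm (g v) \<le> D * exp (- Re v))"

lemma ray_integrable:
  assumes "continuous_on {a..} (\<lambda>x. g (Complex x b))"
    and "\<And>x. x \<ge> a \<Longrightarrow> norm (g (Complex x b)) \<le> D * exp (- x)"
  shows "(\<lambda>x. g (Complex x b)) integrable_on {a..}"
    and "norm (ray g a b) \<le> D * exp (- a)"
proof -
  have e: "((\<lambda>x. D * exp (- x)) has_integral D * exp (- a)) {a..}"
    using has_integral_mult_right[OF has_integral_exp_minus_to_infinity[of 1 a], of D] by simp
  show int: "(\<lambda>x. g (Complex x b)) integrable_on {a..}"
  proof (rule measurable_bounded_by_integrable_imp_integrable)
    show "(\<lambda>x. g (Complex x b)) \<in> borel_measurable (lebesgue_on {a..})"
      by (rule continuous_imp_measurable_on_sets_lebesgue[OF assms(1)]) auto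
    show "(\<lambda>x. D * exp (- x)) integrable_on {a..}" using e by (rule has_integral_integrable)
  qed (use assms(2) in auto)
  show "norm (ray g a b) \<le> D * exp (- a)"
    unfolding ray_def integral_unique[OF e, symmetric]
    by (rule integral_norm_bound_integral[OF int has_integral_integrable[OF e]]) (use assms(2) in auto)
qed

lemma hcontour_simps:
  "b \<ge> 0 \<Longrightarrow> x \<ge> a \<Longrightarrow> Complex x b \<in> hcontour a b"
  "b \<ge> 0 \<Longrightarrow> x \<ge> a \<Longrightarrow> Complex x (- b) \<in> hcontour a b"
  "\<bar>y\<bar> \<le> b \<Longrightarrow> Complex a y \<in> hcontour a b"
  by (auto simp: hcontour_def)

lemma hbounded_continuous:
  assumes "hbounded g a b D" "b \<ge> 0"
  shows "continuous_on {a..} (\<lambda>x. g (Complex x b))"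
    and "continuous_on {a..} (\<lambda>x. g (Complex x (- b)))"
    and "continuous_on {- b..b} (\<lambda>y. g (Complex a y))"
proof -
  have cont: "continuous_on (hcontour a b) g" using assms(1) by (simp add: hbounded_def)
  show "continuous_on {a..} (\<lambda>x. g (Complex x b))"
    by (rule continuous_on_compose2[OF cont continuous_on_horizontal])
       (use assms(2) in \<open>auto simp: hcontour_simps\<close>)
  show "continuous_on {a..} (\<lambda>x. g (Complex x (- b)))"
    by (rule continuous_on_compose2[OF cont continuous_on_horizontal])
       (use assms(2) in \<open>auto simp: hcontour_def\<close>)
  show "continuous_on {- b..b} (\<lambda>y. g (Complex a y))"
    by (rule continuous_on_compose2[OF cont continuous_on_vertical])
       (auto simp: hcontour_def)
qed

lemma hbounded_integrable:
  assumes "hbounded g a b D" "b \<ge> 0"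
  shows "(\<lambda>x. g (Complex x b)) integrable_on {a..}"
    and "(\<lambda>x. g (Complex x (- b))) integrable_on {a..}"
    and "(\<lambda>y. g (Complex a y)) integrable_on {- b..b}"
proof -
  have *: "norm (g (Complex x b)) \<le> D * exp (- x)" "norm (g (Complex x (- b))) \<le> D * exp (- x)" if "x \<ge> a" for x
    using assms that hcontour_simps[of b a x] unfolding hbounded_def by force+
  show "(\<lambda>x. g (Complex x b)) integrable_on {a..}" "(\<lambda>x. g (Complex x (- b))) integrable_on {a..}"
    by (rule ray_integrable(1)[OF _ *(1)] ray_integrable(1)[OF _ *(2)]; use hbounded_continuous[OF assms] in simp)+
  show "(\<lambda>y. g (Complex a y)) integrable_on {- b..b}"
    by (intro integrable_continuous_interval hbounded_continuous[OF assms])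
qed

text \<open>The last factor counts two rays, each contributing \<open>D * exp (- a)\<close>, and an
  edge of length \<open>2 * b\<close>.\<close>

lemma hankel_bound:
  assumes "hbounded g a b D" "b \<ge> 0"
  shows "norm (hankel g a b) \<le> D * exp (- a) * (2 + 2 * b)"
proof -
  have *: "norm (g (Complex x b)) \<le> D * exp (- x)" "norm (g (Complex x (- b))) \<le> D * exp (- x)" if "x \<ge> a" for x
    using assms that hcontour_simps[of b a x] unfolding hbounded_def by force+
  have "norm (ray g a b) \<le> D * exp (- a)" "norm (ray g a (- b)) \<le> D * exp (- a)"
    by (rule ray_integrable(2)[OF _ *(1)] ray_integrable(2)[OF _ *(2)]; use hbounded_continuous[OF assms] in simp)+
  moreover have "norm (edge g a b) \<le> D * exp (- a) * (b - (- b))"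
    unfolding edge_def
  proof (rule integral_bound)
    fix y assume "y \<in> {- b..b}"
    thus "norm (g (Complex a y)) \<le> D * exp (- a)"
      using assms hcontour_simps(3)[of y b a] unfolding hbounded_def by force
  qed (use assms hbounded_continuous[OF assms] in auto)
  moreover have "norm (hankel g a b) \<le> norm (ray g a b) + norm (ray g a (- b)) + norm (edge g a b)"
    unfolding hankel_def
    by (intro norm_triangle_le add_mono norm_triangle_ineq4) (simp add: norm_mult)
  ultimately show ?thesis by (simp add: algebra_simps)
qed

section \<open>Linearity and deformation of Hankel integrals\<close>

lemma hbounded_add:
  assumes "hbounded f a b D" "hbounded g a b D'"
  shows "hbounded (\<lambda>v. f v + g v) a b (D + D')"
  using assms unfolding hbounded_def
  by (auto intro!: continuous_intros norm_triangle_le simp: distrib_right add_mono)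

lemma hbounded_cmult:
  assumes "hbounded f a b D"
  shows "hbounded (\<lambda>v. c * f v) a b (norm c * D)"
  using assms unfolding hbounded_def
  by (auto intro!: continuous_intros mult_left_mono simp: norm_mult mult.assoc)

lemma hankel_add:
  assumes "hbounded f a b D" "hbounded g a b D'" "b \<ge> 0"
  shows "hankel (\<lambda>v. f v + g v) a b = hankel f a b + hankel g a b"
  using hbounded_integrable[OF assms(1,3)] hbounded_integrable[OF assms(2,3)]
  by (simp add: hankel_def ray_def edge_def integral_add algebra_simps)

lemma hankel_cmult: "hankel (\<lambda>v. c * f v) a b = c * hankel f a b"
  by (simp add: hankel_def ray_def edge_def algebra_simps)

lemma ray_split:
  assumes "a \<le> a'" "continuous_on {a..} (\<lambda>x. g (Complex x b))"
    and "\<And>x. x \<ge> a \<Longrightarrow> norm (g (Complex x b)) \<le> D * exp (- x)"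
  shows "ray g a b = integral {a..a'} (\<lambda>x. g (Complex x b)) + ray g a' b"
proof -
  have "{a..} = {a..a'} \<union> {a'..}" using assms(1) by auto
  moreover have "{a..a'} \<inter> {a'..} = {a'}" using assms(1) by auto
  moreover have "(\<lambda>x. g (Complex x b)) integrable_on {a..a'}"
    by (rule integrable_continuous_interval, rule continuous_on_subset[OF assms(2)]) auto
  moreover have "(\<lambda>x. g (Complex x b)) integrable_on {a'..}"
    by (rule ray_integrable(1)[where D = D], rule continuous_on_subset[OF assms(2)]) (use assms in auto)
  ultimately show ?thesis unfolding ray_def by (simp add: integral_Un)
qed

lemma hbounded_ray_split:
  assumes "a \<le> a'" "hbounded g a b D" "b \<ge> 0"
  shows "ray g a b = integral {a..a'} (\<lambda>x. g (Complex x b)) + ray g a' b"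
    and "ray g a (- b) = integral {a..a'} (\<lambda>x. g (Complex x (- b))) + ray g a' (- b)"
proof -
  have *: "norm (g (Complex x b)) \<le> D * exp (- x)" "norm (g (Complex x (- b))) \<le> D * exp (- x)" if "x \<ge> a" for x
    using assms that hcontour_simps[of b a x] unfolding hbounded_def by force+
  show "ray g a b = integral {a..a'} (\<lambda>x. g (Complex x b)) + ray g a' b"
    by (rule ray_split[OF assms(1) hbounded_continuous(1)[OF assms(2,3)] *(1)])
  show "ray g a (- b) = integral {a..a'} (\<lambda>x. g (Complex x (- b))) + ray g a' (- b)"
    by (rule ray_split[OF assms(1) hbounded_continuous(2)[OF assms(2,3)] *(2)])
qed

text \<open>Beyond \<open>a'\<close> the rays agree and drop out; the two edges and the remaining
  ray segments are the sides of the rectangle. The function may have poles inside it.\<close>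

lemma hankel_shift:
  assumes "a < a'" "b > 0" "hbounded g a b D"
    and "continuous_on (path_image (rectpath (Complex a (- b)) (Complex a' b))) g"
  shows "hankel g a' b - hankel g a b = contour_integral (rectpath (Complex a (- b)) (Complex a' b)) g"
  using contour_integral_rectpath[of a a' "- b" b g] assms
    hbounded_ray_split[OF less_imp_le[OF assms(1)] assms(3)]
  by (simp add: hankel_def edge_def algebra_simps)

lemma rectpath_in_cbox: 
  "a \<le> a' \<Longrightarrow> b \<le> b' \<Longrightarrow> path_image (rectpath (Complex a b) (Complex a' b')) \<subseteq> {v. a \<le> Re v \<and> Re v \<le> a' \<and> b \<le> Im v \<and> Im v \<le> b'}"
  using path_image_rectpath_subset_cbox[of "Complex a b" "Complex a' b'"] by (auto simp: in_cbox_complex_iff)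

lemma contour_integral_rectpath_0:
  assumes "a \<le> a'" "b \<le> b'" "g holomorphic_on {v. a \<le> Re v \<and> Re v \<le> a' \<and> b \<le> Im v \<and> Im v \<le> b'}"
  shows "contour_integral (rectpath (Complex a b) (Complex a' b')) g = 0"
proof -
  have "{v. a \<le> Re v \<and> Re v \<le> a' \<and> b \<le> Im v \<and> Im v \<le> b'} = cbox (Complex a b) (Complex a' b')"
    by (auto simp: in_cbox_complex_iff)
  hence "convex {v. a \<le> Re v \<and> Re v \<le> a' \<and> b \<le> Im v \<and> Im v \<le> b'}" by (metis convex_box(1))
  from Cauchy_theorem_convex_simple[OF assms(3) this] rectpath_in_cbox[OF assms(1,2)]
  show ?thesis by (intro contour_integral_unique) auto
qed

lemma hankel_shift_0:
  assumes "a \<le> a'" "b > 0" "hbounded g a b D"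
    and hol: "g holomorphic_on {v. a \<le> Re v \<and> Re v \<le> a' \<and> - b \<le> Im v \<and> Im v \<le> b}"
  shows "hankel g a' b = hankel g a b"
proof (cases "a = a'")
  case False
  hence "a < a'" using assms by simp
  moreover have "continuous_on (path_image (rectpath (Complex a (- b)) (Complex a' b))) g"
    using holomorphic_on_imp_continuous_on[OF hol] rectpath_in_cbox[of a a' "- b" b] assms
    by (auto intro: continuous_on_subset)
  ultimately show ?thesis
    using hankel_shift[OF _ assms(2,3), of a'] contour_integral_rectpath_0[OF assms(1) _ hol] assms(2) by simp
qed simp

text \<open>Cauchy's theorem on the rectangle cut off at \<open>X\<close>, whose far side vanishes
  exponentially as \<open>X\<close> grows.\<close>

lemma ray_rotate:
  assumes "b1 < b2" and hol: "g holomorphic_on {v. a \<le> Re v \<and> b1 \<le> Im v \<and> Im v \<le> b2}"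
    and bd: "\<And>x y. x \<ge> a \<Longrightarrow> b1 \<le> y \<Longrightarrow> y \<le> b2 \<Longrightarrow> norm (g (Complex x y)) \<le> D * exp (- x)"
  shows "ray g a b1 - ray g a b2 = \<i> * integral {b1..b2} (\<lambda>y. g (Complex a y))"
proof -
  let ?S = "{v. a \<le> Re v \<and> b1 \<le> Im v \<and> Im v \<le> b2}"
  have cont: "continuous_on ?S g" by (rule holomorphic_on_imp_continuous_on[OF hol])
  have ch: "continuous_on {X..} (\<lambda>x. g (Complex x c))" if "c \<in> {b1, b2}" "X \<ge> a" for c X
    by (rule continuous_on_compose2[OF cont continuous_on_horizontal]) (use that assms(1) in auto)
  have cv: "continuous_on {b1..b2} (\<lambda>y. g (Complex x y))" if "x \<ge> a" for x
    by (rule continuous_on_compose2[OF cont continuous_on_vertical]) (use that assms(1) in auto)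
  define L where "L = ray g a b1 - ray g a b2 - \<i> * integral {b1..b2} (\<lambda>y. g (Complex a y))"
  \<comment> \<open>The 2 counts the remainders of the two rays beyond \<open>X\<close>, and
    \<open>b2 - b1\<close> is the length of the far side.\<close>
  have "norm L \<le> D * exp (- X) * (2 + (b2 - b1))" if "X > a" for X
  proof -
    have i: "ray g a c = integral {a..X} (\<lambda>x. g (Complex x c)) + ray g X c" if "c \<in> {b1, b2}" for c
      by (rule ray_split[where D = D]) (use ch[OF that] bd that assms(1) \<open>X > a\<close> in auto)
    have r: "norm (ray g X c) \<le> D * exp (- X)" if "c \<in> {b1, b2}" for c
      by (rule ray_integrable(2)[where g = g and D = D]) (use ch[OF that] bd that assms(1) \<open>X > a\<close> in auto)
    have e: "norm (integral {b1..b2} (\<lambda>y. g (Complex X y))) \<le> D * exp (- X) * (b2 - b1)"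
      by (rule integral_bound) (use cv assms(1) bd \<open>X > a\<close> in auto)
    have hol': "g holomorphic_on {v. a \<le> Re v \<and> Re v \<le> X \<and> b1 \<le> Im v \<and> Im v \<le> b2}"
      by (rule holomorphic_on_subset[OF hol]) auto
    have 0: "contour_integral (rectpath (Complex a b1) (Complex X b2)) g = 0"
      by (rule contour_integral_rectpath_0[OF _ _ hol']) (use that assms(1) in auto)
    have "continuous_on (path_image (rectpath (Complex a b1) (Complex X b2))) g"
      using holomorphic_on_imp_continuous_on[OF hol'] rectpath_in_cbox[of a X b1 b2] assms that
      by (auto intro: continuous_on_subset)
    from contour_integral_rectpath[OF that assms(1) this] 0
    have "integral {a..X} (\<lambda>x. g (Complex x b1)) + \<i> * integral {b1..b2} (\<lambda>y. g (Complex X y))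
     - integral {a..X} (\<lambda>x. g (Complex x b2)) - \<i> * integral {b1..b2} (\<lambda>y. g (Complex a y)) = 0"
      by simp
    hence "L = ray g X b1 - ray g X b2 - \<i> * integral {b1..b2} (\<lambda>y. g (Complex X y))"
      unfolding L_def using i[of b1] i[of b2]
      by (simp add: algebra_simps)
    hence "norm L \<le> norm (ray g X b1) + norm (ray g X b2) + norm (integral {b1..b2} (\<lambda>y. g (Complex X y)))"
      by (auto intro!: norm_triangle_le_diff order.trans[OF norm_triangle_ineq4] add_mono simp: norm_mult)
    also have "\<dots> \<le> D * exp (- X) + D * exp (- X) + D * exp (- X) * (b2 - b1)"
      using r e by (intro add_mono) auto
    finally show ?thesis by (simp add: algebra_simps)
  qed
  hence "eventually (\<lambda>X. norm L \<le> D * exp (- X) * (2 + (b2 - b1))) at_top"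
    using eventually_gt_at_top[of a] by (rule eventually_mono[rotated])
  moreover have "((\<lambda>X. D * exp (- X) * (2 + (b2 - b1))) \<longlongrightarrow> D * 0 * (2 + (b2 - b1))) at_top"
    by (intro tendsto_intros) real_asymp
  ultimately have "norm L \<le> D * 0 * (2 + (b2 - b1))"
    by (intro tendsto_lowerbound[of _ _ at_top]) auto
  thus ?thesis by (simp add: L_def)
qed

lemma hankel_rotate:
  assumes "0 < b1" "b1 < b2" and hol: "g holomorphic_on UNIV"
    and bd: "\<And>x y. x \<ge> a \<Longrightarrow> b1 \<le> \<bar>y\<bar> \<Longrightarrow> \<bar>y\<bar> \<le> b2 \<Longrightarrow> norm (g (Complex x y)) \<le> D * exp (- x)"
  shows "hankel g a b1 = hankel g a b2"
proof -
  have up: "ray g a b1 - ray g a b2 = \<i> * integral {b1..b2} (\<lambda>y. g (Complex a y))"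
    by (rule ray_rotate[OF _ holomorphic_on_subset[OF hol], where D = D]) (use assms in auto)
  have dn: "ray g a (- b2) - ray g a (- b1) = \<i> * integral {- b2..- b1} (\<lambda>y. g (Complex a y))"
    by (rule ray_rotate[OF _ holomorphic_on_subset[OF hol], where D = D]) (use assms in auto)
  have cont: "continuous_on A (\<lambda>y. g (Complex a y))" for A
    by (rule continuous_on_compose2[OF holomorphic_on_imp_continuous_on[OF hol] continuous_on_vertical]) auto
  have int: "(\<lambda>y. g (Complex a y)) integrable_on {s..t}" for s t
    by (intro integrable_continuous_interval cont)
  have 1: "integral {- b2..- b1} (\<lambda>y. g (Complex a y)) + integral {- b1..b2} (\<lambda>y. g (Complex a y))
     = edge g a b2"
    unfolding edge_def by (rule Henstock_Kurzweil_Integration.integral_combine) (use assms int in auto)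
  have 2: "edge g a b1 + integral {b1..b2} (\<lambda>y. g (Complex a y)) = integral {- b1..b2} (\<lambda>y. g (Complex a y))"
    unfolding edge_def by (rule Henstock_Kurzweil_Integration.integral_combine) (use assms int in auto)
  show ?thesis using up dn unfolding hankel_def 1[symmetric] 2[symmetric] by (simp add: algebra_simps)
qed

section \<open>The Hankel integral for the reciprocal Gamma function\<close>

lemma pos_if_mult_gt:
  fixes \<rho> b :: real
  assumes "\<rho> > 0" "pi / 2 < \<rho> * b" shows "b > 0"
proof -
  have "0 < \<rho> * b" using assms(2) pi_gt_zero by linarith
  thus ?thesis using assms(1) by (simp add: zero_less_mult_iff)
qed

text \<open>In \<open>u = exp v\<close> this is \<open>exp (u powr \<rho>) * u powr (- k)\<close>,
  with \<open>dv = du / u\<close>. Substituting \<open>t = u powr \<rho>\<close> gives, up to the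
  factor \<open>1 / \<rho>\<close>, Hankel's integrand
  \<open>exp t * t powr (- k / \<rho> - 1)\<close> for
  \<open>1 / Gamma (1 + k / \<rho>)\<close>.\<close>

definition hkernel :: "real \<Rightarrow> real \<Rightarrow> complex \<Rightarrow> complex" where
  "hkernel \<rho> k v = exp (exp (of_real \<rho> * v) - of_real k * v)"

lemma hkernel_holomorphic: "hkernel \<rho> k holomorphic_on A"
  unfolding hkernel_def[abs_def] by (intro holomorphic_intros)

lemma continuous_on_hkernel: "continuous_on A (hkernel \<rho> k)"
  by (intro holomorphic_on_imp_continuous_on hkernel_holomorphic)

lemma norm_hkernel: "norm (hkernel \<rho> k (Complex x y)) = exp (exp (\<rho> * x) * cos (\<rho> * y) - k * x)"
  by (simp add: hkernel_def norm_exp_eq_Re Re_exp)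

lemma hkernel_diff: "hkernel \<rho> (k - l) v = exp (of_real l * v) * hkernel \<rho> k v"
  by (simp add: hkernel_def exp_add[symmetric] algebra_simps)

lemma double_exp_decay:
  fixes \<rho> \<kappa> k a :: real
  assumes "\<rho> > 0" "\<kappa> > 0"
  obtains D where "D \<ge> 0" "\<And>x. x \<ge> a \<Longrightarrow> exp (- \<kappa> * exp (\<rho> * x) - k * x) \<le> D * exp (- x)"
proof -
  define f where "f = (\<lambda>x. exp (- \<kappa> * exp (\<rho> * x) - k * x + x))"
  have "(f \<longlongrightarrow> 0) at_top" unfolding f_def using assms by real_asymp
  hence "eventually (\<lambda>x. f x < 1) at_top" by (rule order_tendstoD) simp
  then obtain X where X: "\<And>x. x \<ge> X \<Longrightarrow> f x < 1" by (auto simp: eventually_at_top_linorder)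
  have "compact (f ` {a..X})"
    unfolding f_def by (intro compact_continuous_image continuous_intros) auto
  then obtain M where M: "\<And>x. x \<in> {a..X} \<Longrightarrow> norm (f x) \<le> M"
    using compact_imp_bounded[of "f ` {a..X}"] unfolding bounded_iff by blast
  show thesis
  proof (rule that[of "max 1 M"])
    fix x assume "x \<ge> a"
    hence "f x \<le> max 1 M" using X[of x] M[of x] by (cases "x \<le> X") auto
    hence "f x * exp (- x) \<le> max 1 M * exp (- x)" by (intro mult_right_mono) auto
    also have "f x * exp (- x) = exp (- \<kappa> * exp (\<rho> * x) - k * x)"
      by (simp add: f_def exp_add[symmetric])
    finally show "exp (- \<kappa> * exp (\<rho> * x) - k * x) \<le> max 1 M * exp (- x)" .
  qed auto
qed

text \<open>In both sectors \<open>cos (\<rho> * y)\<close> is at most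
  \<open>cos (\<rho> * b) < 0\<close>. The resulting double exponential decay absorbs
  \<open>exp (- k * x)\<close> for every real \<open>k\<close>.\<close>

lemma hkernel_sector_decay:
  assumes "\<rho> > 0" "pi / 2 < \<rho> * b"
  obtains D where "D \<ge> 0" "\<And>x y. x \<ge> a \<Longrightarrow> b \<le> \<bar>y\<bar> \<Longrightarrow> \<rho> * \<bar>y\<bar> \<le> pi \<Longrightarrow>
    norm (hkernel \<rho> k (Complex x y)) \<le> D * exp (- x)"
proof (cases "\<rho> * b \<le> pi")
  case True
  define \<kappa> where "\<kappa> = - cos (\<rho> * b)"
  have "cos (\<rho> * b) < cos (pi / 2)"
    using assms True by (intro cos_monotone_0_pi) auto
  hence "\<kappa> > 0" by (simp add: \<kappa>_def)
  from double_exp_decay[OF assms(1) this, of a k] obtain D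
    where D: "D \<ge> 0" "\<And>x. x \<ge> a \<Longrightarrow> exp (- \<kappa> * exp (\<rho> * x) - k * x) \<le> D * exp (- x)" by blast
  show thesis
  proof (rule that[OF D(1)])
    fix x y :: real assume *: "x \<ge> a" "b \<le> \<bar>y\<bar>" "\<rho> * \<bar>y\<bar> \<le> pi"
    have "cos (\<rho> * y) = cos (\<rho> * \<bar>y\<bar>)" by (cases "y \<ge> 0") auto
    also have "\<dots> \<le> - \<kappa>" unfolding \<kappa>_def minus_minus
    proof (rule cos_monotone_0_pi_le)
      show "0 \<le> \<rho> * b" using assms(2) pi_gt_zero by linarith
      show "\<rho> * b \<le> \<rho> * \<bar>y\<bar>" using * assms(1) by simp
    qed (rule *(3))
    finally have "exp (\<rho> * x) * cos (\<rho> * y) \<le> exp (\<rho> * x) * (- \<kappa>)"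
      by (intro mult_left_mono) auto
    hence "norm (hkernel \<rho> k (Complex x y)) \<le> exp (- \<kappa> * exp (\<rho> * x) - k * x)"
      by (simp add: norm_hkernel mult.commute)
    also have "\<dots> \<le> D * exp (- x)" by (rule D(2)[OF *(1)])
    finally show "norm (hkernel \<rho> k (Complex x y)) \<le> D * exp (- x)" .
  qed
next
  case False
  \<comment> \<open>No \<open>y\<close> satisfies both constraints in this case, so any constant
    will do.\<close>
  show thesis
  proof (rule that[of 0])
    fix x y :: real assume *: "x \<ge> a" "b \<le> \<bar>y\<bar>" "\<rho> * \<bar>y\<bar> \<le> pi"
    have "\<rho> * b \<le> \<rho> * \<bar>y\<bar>" using * assms(1) by simp
    hence "\<rho> * b \<le> pi" using *(3) by linarith
    thus "norm (hkernel \<rho> k (Complex x y)) \<le> 0 * exp (- x)" using False by simp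
  qed simp
qed

lemma hbounded_hkernel:
  assumes "\<rho> > 0" "pi / 2 < \<rho> * b" "\<rho> * b \<le> pi"
  obtains D where "D \<ge> 0" "hbounded (hkernel \<rho> k) a b D"
proof -
  obtain D where D: "D \<ge> 0" 
    "\<And>x y. x \<ge> a \<Longrightarrow> b \<le> \<bar>y\<bar> \<Longrightarrow> \<rho> * \<bar>y\<bar> \<le> pi \<Longrightarrow> norm (hkernel \<rho> k (Complex x y)) \<le> D * exp (- x)"
    by (rule hkernel_sector_decay[OF assms(1,2), of a k]) blast
  \<comment> \<open>\<open>M\<close> pays for the edge, where only \<open>cos \<le> 1\<close> is
    available; its summand \<open>a\<close> compensates \<open>exp (- Re v)\<close> there.\<close>
  define M where "M = exp (exp (\<rho> * a) - k * a + a)"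
  show thesis
  proof (rule that[of "D + M"])
    show "hbounded (hkernel \<rho> k) a b (D + M)"
      unfolding hbounded_def
    proof (intro conjI ballI continuous_on_hkernel)
      fix v assume v: "v \<in> hcontour a b"
      have eq: "v = Complex (Re v) (Im v)" by simp
      show "norm (hkernel \<rho> k v) \<le> (D + M) * exp (- Re v)"
      proof (cases "Re v \<ge> a \<and> \<bar>Im v\<bar> = b")
        case True
        hence "norm (hkernel \<rho> k v) \<le> D * exp (- Re v)"
          using D(2)[of "Re v" "Im v"] assms by simp
        also have "\<dots> \<le> (D + M) * exp (- Re v)" by (simp add: M_def)
        finally show ?thesis .
      next
        case False
        hence "Re v = a" using v by (auto simp: hcontour_def)
        have "exp (\<rho> * a) * cos (\<rho> * Im v) \<le> exp (\<rho> * a) * 1" by (intro mult_left_mono) auto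
        hence "norm (hkernel \<rho> k v) \<le> exp (exp (\<rho> * a) - k * a)"
          using norm_hkernel[of \<rho> k a "Im v"] eq unfolding \<open>Re v = a\<close> by simp
        also have "\<dots> = M * exp (- Re v)" by (simp add: M_def exp_add[symmetric] \<open>Re v = a\<close>)
        also have "\<dots> \<le> (D + M) * exp (- Re v)" using D(1) by (simp add: distrib_right)
        finally show ?thesis .
      qed
    qed
  qed (use D(1) in \<open>simp add: M_def\<close>)
qed

text \<open>Allows the contour to be placed on the cut, with \<open>a\<close> tending to minus
  infinity, for the evaluation, and elsewhere for the application.\<close>

lemma hankel_hkernel_indep:
  assumes "\<rho> > 0" "pi / 2 < \<rho> * b" "\<rho> * b \<le> pi" "pi / 2 < \<rho> * b'" "\<rho> * b' \<le> pi"
  shows "hankel (hkernel \<rho> k) a b = hankel (hkernel \<rho> k) a' b'"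
proof -
  have shift: "hankel (hkernel \<rho> k) s c = hankel (hkernel \<rho> k) t c"
    if "pi / 2 < \<rho> * c" "\<rho> * c \<le> pi" for s t c
  proof -
    have *: "hankel (hkernel \<rho> k) t c = hankel (hkernel \<rho> k) s c" if "s \<le> t" for s t :: real
    proof -
      obtain D where D: "hbounded (hkernel \<rho> k) s c D"
        by (rule hbounded_hkernel[OF assms(1) \<open>pi / 2 < \<rho> * c\<close> \<open>\<rho> * c \<le> pi\<close>])
      have "c > 0" by (rule pos_if_mult_gt[OF assms(1) \<open>pi / 2 < \<rho> * c\<close>])
      thus ?thesis by (rule hankel_shift_0[OF that _ D hkernel_holomorphic])
    qed
    show ?thesis
    proof (cases "s \<le> t")
      case True
      show ?thesis by (rule *[OF True, symmetric])
    next
      case False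
      thus ?thesis by (intro *) simp
    qed
  qed
  have rot: "hankel (hkernel \<rho> k) a c = hankel (hkernel \<rho> k) a c'"
    if "c < c'" "pi / 2 < \<rho> * c" "\<rho> * c' \<le> pi" for c c'
  proof -
    obtain D where D: "\<And>x y. x \<ge> a \<Longrightarrow> c \<le> \<bar>y\<bar> \<Longrightarrow> \<rho> * \<bar>y\<bar> \<le> pi \<Longrightarrow> norm (hkernel \<rho> k (Complex x y)) \<le> D * exp (- x)"
      by (rule hkernel_sector_decay[OF assms(1) \<open>pi / 2 < \<rho> * c\<close>, of a k]) blast
    have "c > 0" by (rule pos_if_mult_gt[OF assms(1) \<open>pi / 2 < \<rho> * c\<close>])
    show ?thesis
    proof (rule hankel_rotate[OF \<open>c > 0\<close> \<open>c < c'\<close> hkernel_holomorphic])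
      fix x y assume *: "x \<ge> a" "c \<le> \<bar>y\<bar>" "\<bar>y\<bar> \<le> c'"
      have "\<rho> * \<bar>y\<bar> \<le> \<rho> * c'" using *(3) assms(1) by simp
      thus "norm (hkernel \<rho> k (Complex x y)) \<le> D * exp (- x)" using D * \<open>\<rho> * c' \<le> pi\<close> by auto
    qed
  qed
  have "hankel (hkernel \<rho> k) a b = hankel (hkernel \<rho> k) a b'"
  proof (cases b b' rule: linorder_cases)
    case less
    thus ?thesis by (rule rot) (use assms in auto)
  next
    case greater
    thus ?thesis by (intro rot[symmetric]) (use assms in auto)
  qed simp
  also have "\<dots> = hankel (hkernel \<rho> k) a' b'" by (rule shift) (use assms in auto)
  finally show ?thesis .
qed

text \<open>The primitive vanishes at both infinite ends of the contour, so its increments along the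
  three pieces cancel.\<close>

lemma hankel_deriv_0:
  assumes "b > 0" and der: "\<And>v. (g has_field_derivative g' v) (at v)"
    and g: "hbounded g a b D" and g': "hbounded g' a b D'"
  shows "hankel g' a b = 0"
proof -
  have vh: "((\<lambda>x. g (Complex x c)) has_vector_derivative g' (Complex x c)) (at x)" for x c
  proof -
    have "((\<lambda>x. Complex x c) has_vector_derivative 1) (at x)"
      by (auto simp: Complex_eq[abs_def] intro!: derivative_eq_intros)
    from field_vector_diff_chain_at[OF this der] show ?thesis by (simp add: o_def)
  qed
  have vv: "((\<lambda>y. g (Complex c y)) has_vector_derivative \<i> * g' (Complex c y)) (at y)" for y c
  proof -
    have "((\<lambda>y. Complex c y) has_vector_derivative \<i>) (at y)"
      by (auto simp: Complex_eq[abs_def] intro!: derivative_eq_intros)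
    from field_vector_diff_chain_at[OF this der] show ?thesis by (simp add: o_def)
  qed
  have ray: "ray g' a c = - g (Complex a c)" if c: "c \<in> {b, - b}" for c
  proof -
    define L where "L = ray g' a c + g (Complex a c)"
    have bd: "norm (g' (Complex x c)) \<le> D' * exp (- x)" "norm (g (Complex x c)) \<le> D * exp (- x)" if "x \<ge> a" for x
      using g g' c hcontour_simps(1,2)[of b a x] that assms(1) unfolding hbounded_def by force+
    have cont: "continuous_on {a..} (\<lambda>x. g' (Complex x c))"
      using hbounded_continuous(1,2)[OF g'] assms(1) c by auto
    have "norm L \<le> (D + D') * exp (- X)" if "X > a" for X
    proof -
      have "((\<lambda>x. g' (Complex x c)) has_integral (g (Complex X c) - g (Complex a c))) {a..X}"
        by (intro fundamental_theorem_of_calculus has_vector_derivative_at_within[OF vh]) (use that in simp)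
      hence "L = g (Complex X c) + ray g' X c"
        using ray_split[OF less_imp_le[OF that] cont bd(1)] by (simp add: L_def integral_unique)
      moreover have "norm (ray g' X c) \<le> D' * exp (- X)"
        by (rule ray_integrable(2), rule continuous_on_subset[OF cont]) (use bd that in auto)
      ultimately show ?thesis using bd(2)[of X] that norm_triangle_ineq[of "g (Complex X c)" "ray g' X c"]
        by (simp add: distrib_right)
    qed
    hence "eventually (\<lambda>X. norm L \<le> (D + D') * exp (- X)) at_top"
      using eventually_gt_at_top[of a] by (rule eventually_mono[rotated])
    moreover have "((\<lambda>X. (D + D') * exp (- X)) \<longlongrightarrow> (D + D') * 0) at_top"
      by (intro tendsto_intros) real_asymp
    ultimately have "norm L \<le> (D + D') * 0"
      by (intro tendsto_lowerbound[of _ _ at_top]) auto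
    thus ?thesis by (simp add: L_def eq_neg_iff_add_eq_0)
  qed
  have "((\<lambda>y. \<i> * g' (Complex a y)) has_integral (g (Complex a b) - g (Complex a (- b)))) {- b..b}"
    by (intro fundamental_theorem_of_calculus has_vector_derivative_at_within[OF vv]) (use assms in simp)
  hence "\<i> * edge g' a b = g (Complex a b) - g (Complex a (- b))"
    unfolding edge_def by (simp add: integral_unique flip: integral_mult_right)
  thus ?thesis unfolding hankel_def using ray by simp
qed

text \<open>Obtained by integrating the derivative of \<open>hkernel \<rho> k\<close>; it mirrors
  the functional equation of Gamma and serves to raise \<open>k\<close> in steps of
  \<open>\<rho>\<close>.\<close>

lemma hankel_hkernel_rec:
  assumes "\<rho> > 0" "pi / 2 < \<rho> * b" "\<rho> * b \<le> pi"
  shows "of_real \<rho> * hankel (hkernel \<rho> (k - \<rho>)) a b = of_real k * hankel (hkernel \<rho> k) a b"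
proof -
  have b: "b > 0" by (rule pos_if_mult_gt[of \<rho>]) (use assms in auto)
  obtain D where D: "hbounded (hkernel \<rho> k) a b D" by (rule hbounded_hkernel[OF assms])
  obtain D' where D': "hbounded (hkernel \<rho> (k - \<rho>)) a b D'" by (rule hbounded_hkernel[OF assms])
  define g' where "g' = (\<lambda>v. of_real \<rho> * hkernel \<rho> (k - \<rho>) v + of_real (- k) * hkernel \<rho> k v)"
  have "hankel g' a b = 0"
  proof (rule hankel_deriv_0[OF b _ D])
    show "(hkernel \<rho> k has_field_derivative g' v) (at v)" for v
      unfolding g'_def hkernel_diff unfolding hkernel_def
      by (auto intro!: derivative_eq_intros simp: algebra_simps)
    show "hbounded g' a b (norm (of_real \<rho> :: complex) * D' + norm (of_real (- k) :: complex) * D)"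
      unfolding g'_def by (intro hbounded_add hbounded_cmult D D')
  qed
  also have "hankel g' a b = of_real \<rho> * hankel (hkernel \<rho> (k - \<rho>)) a b + of_real (- k) * hankel (hkernel \<rho> k) a b"
    unfolding g'_def using b
    by (subst hankel_add[OF hbounded_cmult[OF D'] hbounded_cmult[OF D]]) (simp_all only: hankel_cmult less_imp_le)
  finally show ?thesis by simp
qed


text \<open>For \<open>b = pi / \<rho>\<close> both rays lie where \<open>u powr \<rho>\<close> is
  negative real, so the two values differ only in the phase of \<open>exp (- k * v)\<close>.\<close>

lemma hkernel_on_cut:
  assumes "\<rho> > 0"
  shows "hkernel \<rho> k (Complex x (pi / \<rho>)) = of_real (exp (- exp (\<rho> * x) - k * x)) * cis (- (k * pi / \<rho>))"
    and "hkernel \<rho> k (Complex x (- (pi / \<rho>))) = of_real (exp (- exp (\<rho> * x) - k * x)) * cis (k * pi / \<rho>)"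
proof -
  have 1: "of_real \<rho> * Complex x (pi / \<rho>) = of_real (\<rho> * x) + \<i> * of_real pi"
     "of_real \<rho> * Complex x (- (pi / \<rho>)) = of_real (\<rho> * x) - \<i> * of_real pi"
    using assms by (simp_all add: complex_eq_iff)
  have 2: "exp (of_real (\<rho> * x) + \<i> * of_real pi) = - of_real (exp (\<rho> * x))"
     "exp (of_real (\<rho> * x) - \<i> * of_real pi) = - of_real (exp (\<rho> * x))"
    by (simp_all only: exp_add exp_diff exp_of_real exp_pi_i' exp_pi_i) simp_all
  have 3: "- of_real (exp (\<rho> * x)) - of_real k * Complex x (pi / \<rho>)
       = of_real (- exp (\<rho> * x) - k * x) + \<i> * of_real (- (k * pi / \<rho>))"
     "- of_real (exp (\<rho> * x)) - of_real k * Complex x (- (pi / \<rho>))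
       = of_real (- exp (\<rho> * x) - k * x) + \<i> * of_real (k * pi / \<rho>)"
    by (simp_all add: complex_eq_iff)
  show "hkernel \<rho> k (Complex x (pi / \<rho>)) = of_real (exp (- exp (\<rho> * x) - k * x)) * cis (- (k * pi / \<rho>))"
    "hkernel \<rho> k (Complex x (- (pi / \<rho>))) = of_real (exp (- exp (\<rho> * x) - k * x)) * cis (k * pi / \<rho>)"
    unfolding hkernel_def 1 2 3 by (simp_all only: exp_add exp_of_real cis_conv_exp)
qed

text \<open>By \<open>t = exp (\<rho> * x)\<close> this is the upper incomplete Gamma function of
  order \<open>- k / \<rho>\<close> at \<open>exp (\<rho> * a)\<close>, divided by
  \<open>\<rho>\<close>.\<close>

definition gamma_piece :: "real \<Rightarrow> real \<Rightarrow> real \<Rightarrow> real" where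
  "gamma_piece \<rho> k a = integral {a..} (\<lambda>x. exp (- exp (\<rho> * x) - k * x))"

lemma hankel_on_cut:
  assumes "\<rho> > 0"
  shows "hankel (hkernel \<rho> k) a (pi / \<rho>) =
     \<i> * edge (hkernel \<rho> k) a (pi / \<rho>) - 2 * \<i> * of_real (sin (k * pi / \<rho>) * gamma_piece \<rho> k a)"
proof -
  have "\<exists>D. D \<ge> 0 \<and> (\<forall>x\<ge>a. exp (- 1 * exp (\<rho> * x) - k * x) \<le> D * exp (- x))"
    using double_exp_decay[of \<rho> 1 a k] assms by (metis zero_less_one)
  then obtain D where D: "\<And>x. x \<ge> a \<Longrightarrow> exp (- exp (\<rho> * x) - k * x) \<le> D * exp (- x)" by auto
  define m where "m = (\<lambda>x. complex_of_real (exp (- exp (\<rho> * x) - k * x)))"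
  have "(\<lambda>x. m (Re (Complex x 0))) integrable_on {a..}"
    by (rule ray_integrable(1)[where g = "\<lambda>v. m (Re v)" and D = D])
       (use D in \<open>auto simp: m_def intro!: continuous_intros\<close>)
  hence int: "m integrable_on {a..}" by simp
  hence "(\<lambda>x. Re (m x)) integrable_on {a..}" using integrable_linear[OF _ bounded_linear_Re] by (auto simp: o_def)
  hence "((\<lambda>x. exp (- exp (\<rho> * x) - k * x)) has_integral gamma_piece \<rho> k a) {a..}"
    unfolding gamma_piece_def m_def by (simp add: integrable_integral)
  hence m: "(m has_integral of_real (gamma_piece \<rho> k a)) {a..}"
    unfolding m_def by (rule has_integral_of_real)
  have "ray (hkernel \<rho> k) a (pi / \<rho>) = of_real (gamma_piece \<rho> k a) * cis (- (k * pi / \<rho>))"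
    "ray (hkernel \<rho> k) a (- (pi / \<rho>)) = of_real (gamma_piece \<rho> k a) * cis (k * pi / \<rho>)"
    unfolding ray_def hkernel_on_cut[OF assms]
    by (rule integral_unique, rule has_integral_mult_left[OF m[unfolded m_def]])+
  thus ?thesis unfolding hankel_def by (simp add: complex_eq_iff algebra_simps)
qed

text \<open>The part missing from Euler's integral lies over \<open>[0, exp (\<rho> * a)]\<close>
  and is at most the integral of \<open>t powr (s - 1)\<close>, which vanishes in the limit because
  \<open>s > 0\<close>.\<close>

lemma gamma_piece_limit:
  assumes "\<rho> > 0" "k < 0"
  shows "(gamma_piece \<rho> k \<longlongrightarrow> Gamma (- k / \<rho>) / \<rho>) at_bot"
proof -
  define s where "s = - k / \<rho>"
  have s: "s > 0" using divide_neg_pos[of k \<rho>] assms by (simp add: s_def)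
  define f where "f = (\<lambda>t::real. t powr (s - 1) / exp t)"
  have G: "(f has_integral Gamma s) {0..}" unfolding f_def by (rule Gamma_integral_real[OF s])
  have abs: "f absolutely_integrable_on {0..}"
    by (rule nonnegative_absolutely_integrable_1[OF has_integral_integrable[OF G]]) (simp add: f_def)
  have bound: "\<bar>gamma_piece \<rho> k a - Gamma s / \<rho>\<bar> \<le> exp (\<rho> * s * a) / (\<rho> * s)" for a
  proof -
    define c where "c = exp (\<rho> * a)"
    have c: "c > 0" by (simp add: c_def)
    have abs': "f absolutely_integrable_on {c..}" by (rule set_integrable_subset[OF abs]) (use c in auto)
    have int0: "f integrable_on {0..c}"
      by (rule set_lebesgue_integral_eq_integral(1), rule set_integrable_subset[OF abs]) (use c in auto)
    have "(\<lambda>x. exp (\<rho> * x)) ` {a..} = {c..}"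
    proof (intro set_eqI iffI)
      fix t assume "t \<in> {c..}"
      hence "t > 0" using c by auto
      hence "t = exp (\<rho> * (ln t / \<rho>))" "ln t \<ge> \<rho> * a"
        using c assms \<open>t \<in> {c..}\<close> by (auto simp: c_def ln_ge_iff)
      thus "t \<in> (\<lambda>x. exp (\<rho> * x)) ` {a..}" using assms by (intro image_eqI[of _ _ "ln t / \<rho>"]) (auto simp: field_simps)
    qed (use assms in \<open>auto simp: c_def\<close>)
    hence "(\<lambda>x. \<bar>\<rho> * exp (\<rho> * x)\<bar> * f (exp (\<rho> * x))) absolutely_integrable_on {a..} \<and>
       integral {a..} (\<lambda>x. \<bar>\<rho> * exp (\<rho> * x)\<bar> * f (exp (\<rho> * x))) = integral {c..} f"
      using abs' assms by (subst has_absolute_integral_change_of_variables_1')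
        (auto intro!: derivative_eq_intros inj_onI)
    moreover have "\<bar>\<rho> * exp (\<rho> * x)\<bar> * f (exp (\<rho> * x)) = \<rho> * exp (- exp (\<rho> * x) - k * x)" for x
    proof -
      have "- (k * x) = \<rho> * x + \<rho> * x * (s - 1)" using assms by (simp add: s_def field_simps)
      hence "exp (- exp (\<rho> * x) - k * x) = exp (\<rho> * x) * exp (\<rho> * x * (s - 1)) / exp (exp (\<rho> * x))"
        by (simp add: exp_add[symmetric] exp_diff[symmetric])
      thus ?thesis using assms by (simp add: f_def powr_def mult_ac)
    qed
    ultimately have "\<rho> * gamma_piece \<rho> k a = integral {c..} f"
      unfolding gamma_piece_def by simp
    moreover have "integral {0..} f = integral {0..c} f + integral {c..} f"
    proof -
      have "{0..} = {0..c} \<union> {c..}" "{0..c} \<inter> {c..} = {c}" using c by auto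
      thus ?thesis using int0 set_lebesgue_integral_eq_integral(1)[OF abs'] by (simp add: integral_Un)
    qed
    moreover have "integral {0..} f = Gamma s" by (rule integral_unique[OF G])
    ultimately have eq: "\<rho> * gamma_piece \<rho> k a - Gamma s = - integral {0..c} f" by simp
    have p: "((\<lambda>t. t powr (s - 1)) has_integral c powr s / s) {0..c}"
      using has_integral_powr_from_0[of "s - 1" c] s c by simp
    have "norm (integral {0..c} f) \<le> integral {0..c} (\<lambda>t. t powr (s - 1))"
    proof (rule integral_norm_bound_integral[OF int0 has_integral_integrable[OF p]])
      fix t assume "t \<in> {0..c}"
      thus "norm (f t) \<le> t powr (s - 1)" by (simp add: f_def divide_le_eq mult_le_cancel_left1)
    qed
    hence "\<bar>integral {0..c} f\<bar> \<le> exp (\<rho> * s * a) / s"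
      using integral_unique[OF p] by (simp add: c_def powr_def mult_ac)
    hence "\<bar>\<rho> * gamma_piece \<rho> k a - Gamma s\<bar> / \<rho> \<le> exp (\<rho> * s * a) / s / \<rho>"
      unfolding eq using assms by (intro divide_right_mono) auto
    moreover have "gamma_piece \<rho> k a - Gamma s / \<rho> = (\<rho> * gamma_piece \<rho> k a - Gamma s) / \<rho>"
      using assms by (simp add: field_simps)
    ultimately show ?thesis using assms by (simp add: mult_ac)
  qed
  have "((\<lambda>a. gamma_piece \<rho> k a - Gamma s / \<rho>) \<longlongrightarrow> 0) at_bot"
  proof (rule Lim_null_comparison)
    show "\<forall>\<^sub>F a in at_bot. norm (gamma_piece \<rho> k a - Gamma s / \<rho>) \<le> exp (\<rho> * s * a) / (\<rho> * s)"
      using bound by simp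
    show "((\<lambda>a. exp (\<rho> * s * a) / (\<rho> * s)) \<longlongrightarrow> 0) at_bot"
      using assms s by real_asymp
  qed
  thus ?thesis unfolding s_def[symmetric] by (simp add: LIM_zero_iff)
qed

lemma edge_limit_neg:
  assumes "\<rho> > 0" "k < 0" "b \<ge> 0"
  shows "((\<lambda>a. edge (hkernel \<rho> k) a b) \<longlongrightarrow> 0) at_bot"
proof (rule Lim_null_comparison)
  have "norm (edge (hkernel \<rho> k) a b) \<le> exp (exp (\<rho> * a) - k * a) * (b - (- b))" for a
    unfolding edge_def
  proof (rule integral_bound)
    show "continuous_on {- b..b} (\<lambda>y. hkernel \<rho> k (Complex a y))"
      by (rule continuous_on_compose2[OF continuous_on_hkernel[of UNIV] continuous_on_vertical]) auto
    fix y
    have "exp (\<rho> * a) * cos (\<rho> * y) \<le> exp (\<rho> * a) * 1" by (intro mult_left_mono) auto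
    thus "norm (hkernel \<rho> k (Complex a y)) \<le> exp (exp (\<rho> * a) - k * a)"
      by (simp add: norm_hkernel)
  qed (use assms in auto)
  thus "\<forall>\<^sub>F a in at_bot. norm (edge (hkernel \<rho> k) a b) \<le> exp (exp (\<rho> * a) - k * a) * (b - (- b))" by simp
  define l where "l = - k"
  have "l > 0" using assms by (simp add: l_def)
  have "((\<lambda>a. exp (exp (\<rho> * a)) * exp (l * a)) \<longlongrightarrow> 1 * 0) at_bot"
    by (rule tendsto_mult) (use assms(1) \<open>l > 0\<close> in real_asymp)+
  hence "((\<lambda>a. exp (exp (\<rho> * a) - k * a)) \<longlongrightarrow> 0) at_bot"
    by (simp add: l_def exp_diff exp_minus field_simps)
  thus "((\<lambda>a. exp (exp (\<rho> * a) - k * a) * (b - (- b))) \<longlongrightarrow> 0) at_bot"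
    by (rule tendsto_mult_left_zero)
qed

text \<open>At \<open>k = 0\<close> the integrand tends to 1 on the edge, so the full length
  \<open>2 * b\<close> survives. The rays contribute nothing for this \<open>k\<close>, their phases
  being equal.\<close>

lemma edge_limit_0:
  assumes "\<rho> > 0" "b \<ge> 0"
  shows "((\<lambda>a. edge (hkernel \<rho> 0) a b) \<longlongrightarrow> of_real (2 * b)) at_bot"
proof -
  have "((\<lambda>a. edge (hkernel \<rho> 0) a b - of_real (2 * b)) \<longlongrightarrow> 0) at_bot"
  proof (rule Lim_null_comparison)
    have "norm (edge (hkernel \<rho> 0) a b - of_real (2 * b)) \<le> exp (exp (\<rho> * a)) * exp (\<rho> * a) * (b - (- b))" for a
    proof -
      have cont: "continuous_on {- b..b} (\<lambda>y. hkernel \<rho> 0 (Complex a y))"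
        by (rule continuous_on_compose2[OF continuous_on_hkernel[of UNIV] continuous_on_vertical]) auto
      have "edge (hkernel \<rho> 0) a b - of_real (2 * b) = integral {- b..b} (\<lambda>y. hkernel \<rho> 0 (Complex a y) - 1)"
        unfolding edge_def using assms
        by (subst integral_diff[OF integrable_continuous_interval[OF cont]])
           (auto simp: scaleR_conv_of_real)
      also have "norm \<dots> \<le> exp (exp (\<rho> * a)) * exp (\<rho> * a) * (b - (- b))"
      proof (rule integral_bound)
        show "continuous_on {- b..b} (\<lambda>y. hkernel \<rho> 0 (Complex a y) - 1)"
          by (intro continuous_intros cont)
        fix y
        define w where "w = exp (of_real \<rho> * Complex a y)"
        have w: "norm w = exp (\<rho> * a)" by (simp add: w_def)
        have "norm (exp w - 1) \<le> exp \<bar>Re w\<bar> * norm w" using Taylor_exp[of w 0] by simp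
        also have "\<dots> \<le> exp (norm w) * norm w" by (intro mult_right_mono) (auto simp: abs_Re_le_cmod)
        finally show "norm (hkernel \<rho> 0 (Complex a y) - 1) \<le> exp (exp (\<rho> * a)) * exp (\<rho> * a)"
          unfolding w by (simp add: hkernel_def w_def)
      qed (use assms in auto)
      finally show ?thesis .
    qed
    thus "\<forall>\<^sub>F a in at_bot. norm (edge (hkernel \<rho> 0) a b - of_real (2 * b))
        \<le> exp (exp (\<rho> * a)) * exp (\<rho> * a) * (b - (- b))" by simp
    have "((\<lambda>a. exp (exp (\<rho> * a)) * exp (\<rho> * a)) \<longlongrightarrow> 0) at_bot"
      using assms by real_asymp
    thus "((\<lambda>a. exp (exp (\<rho> * a)) * exp (\<rho> * a) * (b - (- b))) \<longlongrightarrow> 0) at_bot"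
      by (rule tendsto_mult_left_zero)
  qed
  thus ?thesis by (simp add: LIM_zero_iff)
qed

text \<open>The rays are put on the cut and the arc shrinks to the origin. For \<open>k < 0\<close>
  only the rays survive, and Euler's reflection formula turns sine times Gamma into
  \<open>1 / Gamma\<close>; for \<open>k = 0\<close> only the edge survives. In this range
  \<open>- k / \<rho>\<close> lies in \<open>[0, 1)\<close>.\<close>

lemma hankel_hkernel_base:
  assumes "\<rho> > 0" "- \<rho> < k" "k \<le> 0"
  shows "hankel (hkernel \<rho> k) a (pi / \<rho>) = 2 * pi * \<i> / \<rho> * of_real (1 / Gamma (1 + k / \<rho>))"
proof -
  have const: "hankel (hkernel \<rho> k) a' (pi / \<rho>) = hankel (hkernel \<rho> k) a (pi / \<rho>)" for a'
    by (rule hankel_hkernel_indep) (use assms in auto)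
  have lim: "((\<lambda>a'. hankel (hkernel \<rho> k) a' (pi / \<rho>)) \<longlongrightarrow> hankel (hkernel \<rho> k) a (pi / \<rho>)) at_bot"
    by (subst const) simp
  have "((\<lambda>a'. hankel (hkernel \<rho> k) a' (pi / \<rho>)) \<longlongrightarrow> 2 * pi * \<i> / \<rho> * of_real (1 / Gamma (1 + k / \<rho>))) at_bot"
  proof (cases "k = 0")
    case True
    have *: "((\<lambda>a'. edge (hkernel \<rho> 0) a' (pi / \<rho>)) \<longlongrightarrow> of_real (2 * (pi / \<rho>))) at_bot"
      using assms by (intro edge_limit_0) auto
    have "\<i> * of_real (2 * (pi / \<rho>)) = 2 * pi * \<i> / \<rho> * of_real (1 / Gamma (1 + k / \<rho>))"
      using True by simp
    with tendsto_mult_left[OF *, of "\<i>"] True assms show ?thesis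
      by (simp only: hankel_on_cut) simp
  next
    case False
    hence k: "k < 0" using assms by simp
    define s where "s = - k / \<rho>"
    have s: "0 < s" "s < 1" using k assms by (simp_all add: s_def field_simps)
    have "((\<lambda>a'. \<i> * edge (hkernel \<rho> k) a' (pi / \<rho>) - 2 * \<i> * of_real (sin (k * pi / \<rho>) * gamma_piece \<rho> k a'))
       \<longlongrightarrow> \<i> * 0 - 2 * \<i> * of_real (sin (k * pi / \<rho>) * (Gamma (- k / \<rho>) / \<rho>))) at_bot"
      using k assms by (intro tendsto_intros edge_limit_neg gamma_piece_limit) auto
    moreover have "sin (k * pi / \<rho>) * (Gamma (- k / \<rho>) / \<rho>) = - (pi / (\<rho> * Gamma (1 + k / \<rho>)))"
    proof -
      have "sin (pi * s) > 0" by (intro sin_gt_zero) (use s in auto)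
      have "Gamma (complex_of_real s) * Gamma (complex_of_real (1 - s)) = of_real pi / sin (of_real (pi * s))"
        using Gamma_reflection_complex[of "of_real s"] by simp
      hence "complex_of_real (Gamma s * Gamma (1 - s)) = of_real (pi / sin (pi * s))"
        by (simp only: Gamma_complex_of_real sin_of_real of_real_mult[symmetric] of_real_divide[symmetric])
      hence "Gamma s * Gamma (1 - s) = pi / sin (pi * s)" by (simp only: of_real_eq_iff)
      hence "Gamma s * Gamma (1 - s) * sin (pi * s) = pi"
        by (subst (asm) nonzero_eq_divide_eq) (use \<open>sin (pi * s) > 0\<close> in auto)
      hence "sin (pi * s) * Gamma s * Gamma (1 - s) = pi" by (simp only: mult_ac)
      moreover have "Gamma (1 - s) > 0" by (rule Gamma_real_pos) (use s in auto)
      ultimately have "sin (pi * s) * Gamma s = pi / Gamma (1 - s)" by (simp add: eq_divide_eq)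
      moreover have "sin (k * pi / \<rho>) = - sin (pi * s)" by (simp add: s_def mult.commute)
      ultimately have "sin (k * pi / \<rho>) * Gamma s = - (pi / Gamma (1 - s))" by simp
      moreover have "1 - s = 1 + k / \<rho>" by (simp add: s_def)
      ultimately have "sin (k * pi / \<rho>) * Gamma s / \<rho> = - (pi / Gamma (1 + k / \<rho>)) / \<rho>" by simp
      thus ?thesis by (simp add: s_def mult.commute)
    qed
    ultimately have "((\<lambda>a'. hankel (hkernel \<rho> k) a' (pi / \<rho>)) \<longlongrightarrow>
        \<i> * 0 - 2 * \<i> * of_real (- (pi / (\<rho> * Gamma (1 + k / \<rho>))))) at_bot"
      by (simp only: hankel_on_cut[OF assms(1)])
    thus ?thesis by (simp add: mult_ac)
  qed
  from tendsto_unique[OF _ lim this] show ?thesis by simp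
qed

text \<open>The recurrence extends the base strip upwards in steps of \<open>\<rho>\<close>.
  Negative \<open>k\<close> are kept because \<open>k = - 1\<close> supplies the constant
  \<open>1 / Gamma (1 - 1 / \<rho>)\<close> of the algebraic term.\<close>

lemma hankel_hkernel:
  assumes "\<rho> > 0" "- \<rho> < k" "pi / 2 < \<rho> * b" "\<rho> * b \<le> pi"
  shows "hankel (hkernel \<rho> k) a b = 2 * pi * \<i> / \<rho> * of_real (1 / Gamma (1 + k / \<rho>))"
proof -
  have "hankel (hkernel \<rho> k) a (pi / \<rho>) = 2 * pi * \<i> / \<rho> * of_real (1 / Gamma (1 + k / \<rho>))"
    if "- \<rho> < k" "k \<le> real n * \<rho>" for n k
    using that
  proof (induction n arbitrary: k)
    case 0
    thus ?case using hankel_hkernel_base assms(1) by simp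
  next
    case (Suc n)
    show ?case
    proof (cases "k \<le> 0")
      case True
      thus ?thesis using hankel_hkernel_base assms(1) Suc by simp
    next
      case False
      define G where "G = Gamma (k / \<rho>)"
      have kr: "k / \<rho> > 0" using False assms(1) by simp
      hence G: "G > 0" unfolding G_def by (rule Gamma_real_pos)
      have "k / \<rho> \<notin> \<int>\<^sub>\<le>\<^sub>0" using kr by (auto elim!: nonpos_Ints_cases)
      hence rec: "Gamma (1 + k / \<rho>) = (k / \<rho>) * G"
        using Gamma_plus1[of "k / \<rho>"] by (simp add: add.commute G_def)
      have "1 + (k - \<rho>) / \<rho> = k / \<rho>" using assms(1) by (simp add: field_simps)
      moreover have "hankel (hkernel \<rho> (k - \<rho>)) a (pi / \<rho>) = 2 * pi * \<i> / \<rho> * of_real (1 / Gamma (1 + (k - \<rho>) / \<rho>))"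
        by (rule Suc.IH) (use Suc.prems False in \<open>auto simp: algebra_simps\<close>)
      moreover have "of_real \<rho> * hankel (hkernel \<rho> (k - \<rho>)) a (pi / \<rho>) = of_real k * hankel (hkernel \<rho> k) a (pi / \<rho>)"
        by (rule hankel_hkernel_rec) (use assms in auto)
      ultimately have "of_real k * hankel (hkernel \<rho> k) a (pi / \<rho>) = of_real \<rho> * (2 * pi * \<i> / \<rho> * of_real (1 / G))"
        by (simp add: G_def)
      moreover have "of_real k * (2 * pi * \<i> / \<rho> * of_real (1 / Gamma (1 + k / \<rho>)))
          = of_real \<rho> * (2 * pi * \<i> / \<rho> * of_real (1 / G))"
        unfolding rec using False assms(1) G by simp
      ultimately have "of_real k * hankel (hkernel \<rho> k) a (pi / \<rho>)
          = of_real k * (2 * pi * \<i> / \<rho> * of_real (1 / Gamma (1 + k / \<rho>)))" by metis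
      thus ?thesis using False by (subst (asm) mult_cancel_left) simp
    qed
  qed
  moreover obtain n where "k / \<rho> \<le> real n" using real_arch_simple by blast
  hence "k \<le> real n * \<rho>" using assms(1) by (simp add: field_simps)
  moreover have "hankel (hkernel \<rho> k) a b = hankel (hkernel \<rho> k) a (pi / \<rho>)"
    by (rule hankel_hkernel_indep) (use assms in auto)
  ultimately show ?thesis using assms(2) by metis
qed

section \<open>Asymptotics of the Mittag-Leffler function\<close>

text \<open>In the coordinate \<open>u = exp v\<close> this is the Cauchy kernel \<open>exp (u powr \<rho>) du / (u - z)\<close>.\<close>
definition cauchy_kernel :: "real \<Rightarrow> complex \<Rightarrow> complex \<Rightarrow> complex" where
  "cauchy_kernel \<rho> z v = hkernel \<rho> 0 v / (1 - z * exp (- v))"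

lemma hkernel_nat: "hkernel \<rho> (real j) v = hkernel \<rho> 0 v * exp (- v) ^ j"
  by (simp add: hkernel_def exp_diff exp_minus field_simps flip: exp_of_nat_mult)

lemma hankel_cong:
  assumes "b \<ge> 0" "\<And>v. v \<in> hcontour a b \<Longrightarrow> f v = g v"
  shows "hankel f a b = hankel g a b"
proof -
  have "ray f a b = ray g a b" "ray f a (- b) = ray g a (- b)" "edge f a b = edge g a b"
    unfolding ray_def edge_def by (rule integral_cong, use assms hcontour_simps in auto)+
  thus ?thesis by (simp add: hankel_def)
qed

lemma Re_hcontour: "v \<in> hcontour a b \<Longrightarrow> a \<le> Re v"
  by (auto simp: hcontour_def)

text \<open>A finite geometric sum with the explicit remainder \<open>r N\<close> replaces an
  interchange of series and integral. The condition on \<open>a\<close> makes the ratio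
  \<open>q\<close> at most 1/2 on the contour, so the remainder is geometrically small, and
  summability of the series comes out as well.\<close>

lemma mittag_leffler_sums_hankel:
  assumes "\<rho> > 0" "pi / 2 < \<rho> * b" "\<rho> * b \<le> pi" "2 * norm z \<le> exp a"
  shows "(\<lambda>j. of_real (ml_coeff \<rho> j) * z ^ j) sums (\<rho> / (2 * pi * \<i>) * hankel (cauchy_kernel \<rho> z) a b)"
proof -
  have b: "b > 0" by (rule pos_if_mult_gt[of \<rho>]) (use assms in auto)
  obtain D where D: "D \<ge> 0" "hbounded (hkernel \<rho> 0) a b D" by (rule hbounded_hkernel[OF assms(1-3)])
  define q where "q = (\<lambda>v. z * exp (- v))"
  have q: "norm (q v) \<le> 1 / 2" if "v \<in> hcontour a b" for v
  proof -
    have "2 * norm z \<le> exp (Re v)" using Re_hcontour[OF that] by (intro order_trans[OF assms(4)]) simp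
    thus ?thesis by (simp add: q_def norm_mult norm_divide exp_minus field_simps)
  qed
  have q1: "norm (1 - q v) \<ge> 1 / 2" if "v \<in> hcontour a b" for v
    using q[OF that] norm_triangle_ineq2[of 1 "q v"] by simp
  define r where "r = (\<lambda>N v. q v ^ N * cauchy_kernel \<rho> z v)"
  have r_eq: "r N v = q v ^ N * (hkernel \<rho> 0 v / (1 - q v))" for N v
    by (simp add: r_def cauchy_kernel_def q_def)
  have r: "hbounded (r N) a b (2 * D * (1 / 2) ^ N)" for N
    unfolding hbounded_def
  proof (intro conjI ballI)
    have "1 - q v \<noteq> 0" if "v \<in> hcontour a b" for v using q1[OF that] by auto
    thus "continuous_on (hcontour a b) (r N)"
      unfolding r_def cauchy_kernel_def q_def by (intro continuous_intros continuous_on_hkernel) auto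
    fix v assume v: "v \<in> hcontour a b"
    have 1: "norm (hkernel \<rho> 0 v) \<le> D * exp (- Re v)"
      using D(2) v unfolding hbounded_def by blast
    have 2: "norm (q v) ^ N \<le> (1 / 2) ^ N" by (rule power_mono[OF q[OF v]]) simp
    have 3: "inverse (norm (1 - q v)) \<le> inverse (1 / 2)" by (rule le_imp_inverse_le[OF q1[OF v]]) simp
    have 4: "norm (hkernel \<rho> 0 v) * inverse (norm (1 - q v)) \<le> (D * exp (- Re v)) * inverse (1 / 2)"
      by (rule mult_mono[OF 1 3]) (use D(1) in simp_all)
    have "norm (r N v) = norm (q v) ^ N * (norm (hkernel \<rho> 0 v) * inverse (norm (1 - q v)))"
      unfolding r_eq by (simp only: norm_mult norm_power norm_divide norm_inverse divide_inverse)
    also have "\<dots> \<le> (1 / 2) ^ N * ((D * exp (- Re v)) * inverse (1 / 2))"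
      by (rule mult_mono[OF 2 4]) simp_all
    finally show "norm (r N v) \<le> 2 * D * (1 / 2) ^ N * exp (- Re v)" by (simp add: mult_ac)
  qed
  have part: "hankel (cauchy_kernel \<rho> z) a b = (\<Sum>j<N. z ^ j * hankel (hkernel \<rho> (real j)) a b) + hankel (r N) a b" for N
  proof (induction N)
    case (Suc N)
    obtain E where E: "hbounded (hkernel \<rho> (real N)) a b E" by (rule hbounded_hkernel[OF assms(1-3)])
    have "hankel (r N) a b = hankel (\<lambda>v. z ^ N * hkernel \<rho> (real N) v + r (Suc N) v) a b"
    proof (rule hankel_cong)
      fix v assume v: "v \<in> hcontour a b"
      hence ne: "1 - q v \<noteq> 0" using q1[OF v] by auto
      define t where "t = hkernel \<rho> 0 v / (1 - q v)"
      have h: "hkernel \<rho> 0 v = (1 - q v) * t" using ne by (simp add: t_def)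
      have "z ^ N * (hkernel \<rho> 0 v * exp (- v) ^ N) = q v ^ N * hkernel \<rho> 0 v"
        unfolding q_def power_mult_distrib by (simp only: mult_ac)
      also have "\<dots> = q v ^ N * t - q v ^ Suc N * t"
        unfolding h by (simp only: left_diff_distrib right_diff_distrib power_Suc mult_ac mult_1_left)
      finally show "r N v = z ^ N * hkernel \<rho> (real N) v + r (Suc N) v"
        unfolding r_eq hkernel_nat t_def[symmetric] by simp
    qed (use b in simp)
    also have "\<dots> = z ^ N * hankel (hkernel \<rho> (real N)) a b + hankel (r (Suc N)) a b"
      using hankel_add[OF hbounded_cmult[OF E] r] b by (simp add: hankel_cmult)
    finally show ?case using Suc.IH by simp
  qed (simp add: r_def)
  have coeff: "\<rho> / (2 * pi * \<i>) * (z ^ j * hankel (hkernel \<rho> (real j)) a b) = of_real (ml_coeff \<rho> j) * z ^ j" for j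
  proof -
    have *: "\<rho> / (2 * pi * \<i>) * (X * (2 * pi * \<i> / \<rho> * G)) = G * X" for X G :: complex
      using assms(1) by (simp add: field_simps)
    have "hankel (hkernel \<rho> (real j)) a b = 2 * pi * \<i> / \<rho> * of_real (1 / Gamma (1 + real j / \<rho>))"
      by (rule hankel_hkernel) (use assms in auto)
    thus ?thesis by (simp only: * ml_coeff_def)
  qed
  have "(\<lambda>N. hankel (r N) a b) \<longlonglongrightarrow> 0"
  proof (rule Lim_null_comparison)
    show "\<forall>\<^sub>F N in sequentially. norm (hankel (r N) a b) \<le> 2 * D * (1 / 2) ^ N * exp (- a) * (2 + 2 * b)"
      using hankel_bound[OF r] b by (intro always_eventually allI) simp
    have "(\<lambda>N. 2 * D * (1 / 2) ^ N * exp (- a) * (2 + 2 * b)) \<longlonglongrightarrow> 2 * D * 0 * exp (- a) * (2 + 2 * b)"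
      by (intro tendsto_intros LIMSEQ_power_zero) auto
    thus "(\<lambda>N. 2 * D * (1 / 2) ^ N * exp (- a) * (2 + 2 * b)) \<longlonglongrightarrow> 0" by simp
  qed
  hence "(\<lambda>N. \<rho> / (2 * pi * \<i>) * (hankel (cauchy_kernel \<rho> z) a b - hankel (r N) a b))
      \<longlonglongrightarrow> \<rho> / (2 * pi * \<i>) * (hankel (cauchy_kernel \<rho> z) a b - 0)"
    by (intro tendsto_intros)
  moreover have "\<rho> / (2 * pi * \<i>) * (hankel (cauchy_kernel \<rho> z) a b - hankel (r N) a b)
     = (\<Sum>j<N. of_real (ml_coeff \<rho> j) * z ^ j)" for N
    unfolding part[of N] coeff[symmetric] by (simp add: sum_distrib_left)
  ultimately show ?thesis unfolding sums_def by simp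
qed

section \<open>Moving the contour across the pole\<close>

lemma cauchy_kernel_denom_eq_0_iff: "1 - z * exp (- v) = 0 \<longleftrightarrow> exp v = (z::complex)"
  by (auto simp: exp_minus field_simps)

abbreviation hankel_term :: "real \<Rightarrow> real \<Rightarrow> complex \<Rightarrow> complex" where
  "hankel_term \<rho> b z \<equiv> \<rho> / (2 * pi * \<i>) * hankel (cauchy_kernel \<rho> z) 0 b"

text \<open>Written as \<open>hkernel \<rho> (-1) v / (exp v - z)\<close>, the kernel has a
  denominator controlled by the distance of \<open>z\<close> from the contour, measured relative to
  \<open>|z|\<close>.\<close>

lemma hbounded_cauchy_kernel:
  assumes "\<rho> > 0" "pi / 2 < \<rho> * b" "\<rho> * b \<le> pi" "c > 0" "z \<noteq> 0"
    and sep: "\<And>v. v \<in> hcontour 0 b \<Longrightarrow> norm (exp v - z) \<ge> c * norm z"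
  obtains D where "hbounded (cauchy_kernel \<rho> z) 0 b D"
proof -
  obtain D where D: "D \<ge> 0" "hbounded (hkernel \<rho> (-1)) 0 b D" by (rule hbounded_hkernel[OF assms(1-3)])
  have ne: "exp v \<noteq> z" if "v \<in> hcontour 0 b" for v
  proof
    assume "exp v = z"
    hence "c * norm z \<le> 0" using sep[OF that] by simp
    thus False using assms(4,5) by (simp add: mult_le_0_iff)
  qed
  show thesis
  proof (rule that[of "D / (c * norm z)"], unfold hbounded_def, intro conjI ballI)
    show "continuous_on (hcontour 0 b) (cauchy_kernel \<rho> z)"
      unfolding cauchy_kernel_def[abs_def]
      by (intro continuous_intros continuous_on_hkernel) (use ne cauchy_kernel_denom_eq_0_iff in auto)
    fix v assume v: "v \<in> hcontour 0 b"
    have "cauchy_kernel \<rho> z v = hkernel \<rho> (-1) v / (exp v - z)"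
      using ne[OF v] hkernel_diff[of \<rho> 0 1 v]
      by (simp add: cauchy_kernel_def exp_minus field_simps)
    also have "norm \<dots> \<le> D * exp (- Re v) / (c * norm z)"
      unfolding norm_divide
      by (intro frac_le) (use D v sep[OF v] assms in \<open>auto simp: hbounded_def\<close>)
    finally show "norm (cauchy_kernel \<rho> z v) \<le> D / (c * norm z) * exp (- Re v)" by simp
  qed
qed

lemma cauchy_kernel_holomorphic:
  assumes "\<And>v. v \<in> A \<Longrightarrow> exp v \<noteq> z"
  shows "cauchy_kernel \<rho> z holomorphic_on A"
  unfolding cauchy_kernel_def[abs_def]
  by (intro holomorphic_intros hkernel_holomorphic) (use assms cauchy_kernel_denom_eq_0_iff in auto)

text \<open>The strip contains no logarithm of \<open>z\<close>, so no pole is crossed when the edge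
  moves in from a large \<open>a\<close> to 0.\<close>

lemma mittag_leffler_hankel_outside:
  assumes "\<rho> > 0" "pi / 2 < \<rho> * b" "\<rho> * b \<le> pi" "c > 0" "z \<noteq> 0"
    and sep: "\<And>v. v \<in> hcontour 0 b \<Longrightarrow> norm (exp v - z) \<ge> c * norm z"
    and out: "\<And>v. \<bar>Im v\<bar> \<le> b \<Longrightarrow> exp v \<noteq> z"
  shows "mittag_leffler \<rho> z = hankel_term \<rho> b z"
proof -
  have b: "b > 0" by (rule pos_if_mult_gt[of \<rho>]) (use assms in auto)
  define a where "a = max 0 (ln (2 * norm z))"
  have "a \<ge> 0" by (simp add: a_def)
  have "2 * norm z = exp (ln (2 * norm z))" using assms(5) by simp
  also have "\<dots> \<le> exp a" by (simp add: a_def)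
  finally have a: "a \<ge> 0" "2 * norm z \<le> exp a" using \<open>a \<ge> 0\<close> by auto
  obtain D where D: "hbounded (cauchy_kernel \<rho> z) 0 b D" by (rule hbounded_cauchy_kernel[OF assms(1-6)])
  have "hankel (cauchy_kernel \<rho> z) a b = hankel (cauchy_kernel \<rho> z) 0 b"
    by (rule hankel_shift_0[OF a(1) b D], rule cauchy_kernel_holomorphic, rule out) auto
  with sums_unique[OF mittag_leffler_sums_hankel[OF assms(1-3) a(2)]] show ?thesis
    by (simp add: mittag_leffler_def)
qed

lemma exp_inj_strip:
  assumes "exp v = exp w" "\<bar>Im v - Im w\<bar> < 2 * pi"
  shows "v = (w::complex)"
proof -
  from assms(1) obtain n :: int where n: "v = w + of_int (2 * n) * of_real pi * \<i>"
    using exp_eq by (auto simp: mult_ac)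
  have "n = 0"
  proof (rule ccontr)
    assume "n \<noteq> 0"
    hence "real_of_int \<bar>n\<bar> \<ge> 1" by linarith
    hence "2 * pi * 1 \<le> 2 * pi * \<bar>real_of_int n\<bar>" by (intro mult_left_mono) auto
    also have "\<dots> = \<bar>Im v - Im w\<bar>" unfolding n by (simp add: abs_mult)
    finally show False using assms(2) by simp
  qed
  thus ?thesis using n by simp
qed

text \<open>Stating the result for a logarithm \<open>v0\<close> of \<open>z\<close> avoids a choice
  of branch for \<open>z powr \<rho>\<close>. Since \<open>\<rho> > 1\<close>, the contour stays in
  \<open>|Im v| < pi\<close>, where \<open>v0\<close> is the only pole.\<close>

lemma mittag_leffler_hankel_inside:
  assumes "\<rho> > 1" "pi / 2 < \<rho> * b" "\<rho> * b \<le> pi" "c > 0"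
    and sep: "\<And>v. v \<in> hcontour 0 b \<Longrightarrow> norm (exp v - exp v0) \<ge> c * norm (exp v0)"
    and v0: "Re v0 > 0" "\<bar>Im v0\<bar> < b"
  shows "mittag_leffler \<rho> (exp v0) =
     \<rho> * exp (exp (\<rho> * v0)) + hankel_term \<rho> b (exp v0)"
proof -
  have \<rho>: "\<rho> > 0" using assms by simp
  have b: "b > 0" by (rule pos_if_mult_gt[of \<rho>]) (use assms in auto)
  have "1 * b < \<rho> * b" by (rule mult_strict_right_mono) (use b assms in auto)
  hence bpi: "b < pi" using assms(3) by simp
  let ?g = "cauchy_kernel \<rho> (exp v0)"
  \<comment> \<open>\<open>ln 2\<close> supplies the factor 2 required for the geometric
    series.\<close>
  define a where "a = Re v0 + ln 2"
  have a: "a > Re v0" "2 * norm (exp v0) \<le> exp a" by (auto simp: a_def exp_add)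
  define S where "S = {v. Im v < pi} \<inter> {v. Im v > - pi}"
  have S: "open S" "connected S"
    unfolding S_def by (auto intro!: open_Int open_halfspace_Im_gt open_halfspace_Im_lt convex_connected
       convex_Int convex_halfspace_Im_gt convex_halfspace_Im_lt)
  have ne: "exp v \<noteq> exp v0" if "v \<in> S - {v0}" for v
  proof
    assume "exp v = exp v0"
    hence "v = v0" by (rule exp_inj_strip) (use that v0 bpi in \<open>auto simp: S_def\<close>)
    thus False using that by simp
  qed
  have hol: "?g holomorphic_on S - {v0}" by (rule cauchy_kernel_holomorphic) (rule ne)
  let ?R = "rectpath (Complex 0 (- b)) (Complex a b)"
  have inbox: "v0 \<in> box (Complex 0 (- b)) (Complex a b)"
    using v0 a by (auto simp: in_box_complex_iff)
  have sub: "path_image ?R \<subseteq> S - {v0}"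
  proof -
    have "v0 \<notin> path_image ?R"
      using path_image_rectpath_inter_box[of "Complex 0 (- b)" "Complex a b"] inbox b a v0 by auto
    moreover have "path_image ?R \<subseteq> S"
      using rectpath_in_cbox[of 0 a "- b" b] b a v0 bpi by (force simp: S_def)
    ultimately show ?thesis by auto
  qed
  have "contour_integral ?R ?g = 2 * pi * \<i> * (\<Sum>p\<in>{v0}. winding_number ?R p * residue ?g p)"
  proof (rule Residue_theorem[OF S _ hol])
    show "\<forall>z. z \<notin> S \<longrightarrow> winding_number ?R z = 0"
    proof (intro allI impI)
      fix z assume "z \<notin> S"
      thus "winding_number ?R z = 0"
        using b a v0 bpi by (intro winding_number_rectpath_outside) (auto simp: S_def in_cbox_complex_iff)
    qed
  qed (use sub in auto)
  also have "\<dots> = 2 * pi * \<i> * residue ?g v0" by (simp add: winding_number_rectpath[OF inbox])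
  \<comment> \<open>The denominator has derivative 1 at its zero \<open>v0\<close>, so the residue
    is the numerator.\<close>
  also have "residue ?g v0 = hkernel \<rho> 0 v0 / 1"
    unfolding cauchy_kernel_def[abs_def]
  proof (rule residue_simple_pole_deriv)
    show "((\<lambda>v. 1 - exp v0 * exp (- v)) has_field_derivative 1) (at v0)"
      by (auto intro!: derivative_eq_intros simp flip: exp_add)
    show "(\<lambda>v. 1 - exp v0 * exp (- v)) holomorphic_on S" by (intro holomorphic_intros)
    show "v0 \<in> S" using v0 bpi by (auto simp: S_def)
    show "hkernel \<rho> 0 holomorphic_on S" by (rule hkernel_holomorphic)
    show "hkernel \<rho> 0 v0 \<noteq> 0" by (simp add: hkernel_def)
  qed (use S in \<open>auto simp flip: exp_add\<close>)
  finally have int: "contour_integral ?R ?g = 2 * pi * \<i> * exp (exp (\<rho> * v0))" by (simp add: hkernel_def)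
  obtain D where D: "hbounded ?g 0 b D" by (rule hbounded_cauchy_kernel[OF \<rho> assms(2-4) _ sep]) auto
  have "hankel ?g a b - hankel ?g 0 b = contour_integral ?R ?g"
    by (rule hankel_shift[OF _ b D])
       (use a v0 sub holomorphic_on_imp_continuous_on[OF hol] in \<open>auto intro: continuous_on_subset\<close>)
  hence "hankel ?g a b = 2 * pi * \<i> * exp (exp (\<rho> * v0)) + hankel ?g 0 b"
    unfolding int by (simp add: diff_eq_eq)
  moreover have "mittag_leffler \<rho> (exp v0) = \<rho> / (2 * pi * \<i>) * hankel ?g a b"
    using sums_unique[OF mittag_leffler_sums_hankel[OF \<rho> assms(2,3) a(2)]] by (simp add: mittag_leffler_def)
  ultimately show ?thesis by (simp add: field_simps)
qed

text \<open>Rests on \<open>1 / (u - z) = - 1 / z + u / (z * (u - z))\<close>. The first term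
  integrates by Hankel's formula at \<open>k = - 1\<close>, admissible because
  \<open>\<rho> > 1\<close>; in the second \<open>|u - z| \<ge> c * |z|\<close> gives the order
  \<open>|z|^-2\<close>. The constant depends on \<open>c\<close> but not on \<open>z\<close>, as
  uniformity requires.\<close>

lemma hankel_cauchy_kernel_asymp:
  assumes "\<rho> > 1" "pi / 2 < \<rho> * b" "\<rho> * b \<le> pi" "c > 0"
  obtains C where "C \<ge> 0" "\<And>z. z \<noteq> 0 \<Longrightarrow> (\<And>v. v \<in> hcontour 0 b \<Longrightarrow> norm (exp v - z) \<ge> c * norm z) \<Longrightarrow>
    norm (hankel_term \<rho> b z + of_real (1 / Gamma (1 - 1 / \<rho>)) / z) \<le> C / norm z ^ 2"
proof -
  have \<rho>: "\<rho> > 0" using assms by simp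
  have b: "b > 0" by (rule pos_if_mult_gt[of \<rho>]) (use assms in auto)
  obtain D1 where D1: "hbounded (hkernel \<rho> (-1)) 0 b D1" by (rule hbounded_hkernel[OF \<rho> assms(2,3)])
  obtain D where D: "D \<ge> 0" "hbounded (hkernel \<rho> (-2)) 0 b D" by (rule hbounded_hkernel[OF \<rho> assms(2,3)])
  define C where "C = \<rho> / (2 * pi) * (D / c * (2 + 2 * b))"
  show thesis
  proof (rule that[of C])
    show "C \<ge> 0" using D b assms by (simp add: C_def)
    fix z :: complex assume z: "z \<noteq> 0" and sep: "\<And>v. v \<in> hcontour 0 b \<Longrightarrow> norm (exp v - z) \<ge> c * norm z"
    define g where "g = (\<lambda>v. hkernel \<rho> (-2) v / (exp v - z))"
    have ne: "exp v \<noteq> z" if "v \<in> hcontour 0 b" for v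
    proof
      assume "exp v = z"
      hence "c * norm z \<le> 0" using sep[OF that] by simp
      thus False using assms(4) z by (simp add: mult_le_0_iff)
    qed
    have g: "hbounded g 0 b (D / (c * norm z))"
      unfolding hbounded_def
    proof (intro conjI ballI)
      show "continuous_on (hcontour 0 b) g"
        unfolding g_def by (intro continuous_intros continuous_on_hkernel) (use ne in auto)
      fix v assume v: "v \<in> hcontour 0 b"
      have "norm (g v) \<le> D * exp (- Re v) / (c * norm z)"
        unfolding g_def norm_divide
        by (intro frac_le) (use D v sep[OF v] assms z in \<open>auto simp: hbounded_def\<close>)
      thus "norm (g v) \<le> D / (c * norm z) * exp (- Re v)" by simp
    qed
    have "hankel (cauchy_kernel \<rho> z) 0 b = hankel (\<lambda>v. (- 1 / z) * hkernel \<rho> (-1) v + (1 / z) * g v) 0 b"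
    proof (rule hankel_cong)
      fix v assume v: "v \<in> hcontour 0 b"
      have k: "hkernel \<rho> (-1) v = exp v * hkernel \<rho> 0 v" "hkernel \<rho> (-2) v = exp v * exp v * hkernel \<rho> 0 v"
        using hkernel_diff[of \<rho> 0 1 v] hkernel_diff[of \<rho> 0 2 v] by (simp_all flip: exp_add)
      \<comment> \<open>The splitting of the Cauchy kernel, multiplied by \<open>u = exp v\<close>
        because \<open>du = u * dv\<close>.\<close>
      have "exp v * inverse (exp v - z) = - (1 / z) * exp v + (1 / z) * (exp v * exp v * inverse (exp v - z))"
        using ne[OF v] z by (simp add: field_simps)
      hence "hkernel \<rho> 0 v * (exp v * inverse (exp v - z)) = (- 1 / z) * hkernel \<rho> (-1) v + (1 / z) * g v"
        unfolding g_def k by (simp only:) (simp add: algebra_simps divide_inverse)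
      moreover have "cauchy_kernel \<rho> z v = hkernel \<rho> 0 v * (exp v * inverse (exp v - z))"
        using ne[OF v] by (simp add: cauchy_kernel_def exp_minus field_simps)
      ultimately show "cauchy_kernel \<rho> z v = (- 1 / z) * hkernel \<rho> (-1) v + (1 / z) * g v" by simp
    qed (use b in simp)
    also have "\<dots> = (- 1 / z) * hankel (hkernel \<rho> (-1)) 0 b + (1 / z) * hankel g 0 b"
      using b by (subst hankel_add[OF hbounded_cmult[OF D1] hbounded_cmult[OF g]]) (simp_all only: hankel_cmult less_imp_le)
    also have "hankel (hkernel \<rho> (-1)) 0 b = 2 * pi * \<i> / \<rho> * of_real (1 / Gamma (1 + (-1) / \<rho>))"
      by (rule hankel_hkernel) (use assms in auto)
    finally have eq: "hankel (cauchy_kernel \<rho> z) 0 b =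
        - 1 / z * (2 * pi * \<i> / \<rho> * of_real (1 / Gamma (1 + (-1) / \<rho>))) + 1 / z * hankel g 0 b" .
    have "\<rho> / (2 * pi * \<i>) * (- 1 / z * (2 * pi * \<i> / \<rho> * G) + 1 / z * H) + G / z
       = \<rho> / (2 * pi * \<i>) * (1 / z) * H" for G H :: complex
      using \<rho> z by (simp add: field_simps)
    from this[of "of_real (1 / Gamma (1 + (-1) / \<rho>))" "hankel g 0 b"]
    have "hankel_term \<rho> b z + of_real (1 / Gamma (1 - 1 / \<rho>)) / z
       = \<rho> / (2 * pi * \<i>) * (1 / z) * hankel g 0 b"
      unfolding eq by simp
    hence "norm (hankel_term \<rho> b z + of_real (1 / Gamma (1 - 1 / \<rho>)) / z)
       = \<rho> / (2 * pi) * (1 / norm z) * norm (hankel g 0 b)"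
      using \<rho> by (simp add: norm_mult norm_divide)
    also have "\<dots> \<le> \<rho> / (2 * pi) * (1 / norm z) * (D / (c * norm z) * exp (- 0) * (2 + 2 * b))"
      using hankel_bound[OF g] b \<rho> by (intro mult_left_mono) auto
    also have "\<dots> = C / norm z ^ 2" by (simp add: C_def power2_eq_square)
    finally show "norm (hankel_term \<rho> b z + of_real (1 / Gamma (1 - 1 / \<rho>)) / z)
       \<le> C / norm z ^ 2" .
  qed
qed

section \<open>Sections and tails\<close>

text \<open>Turns uniform convergence into an ordinary limit in the pair
  \<open>(n, \<zeta>)\<close>, so that the usual limit rules deliver uniformity.\<close>

lemma uniform_limit_iff_prod_filter:
  fixes f :: "'a \<Rightarrow> 'b \<Rightarrow> 'c :: real_normed_vector"
  shows "uniform_limit K f l F \<longleftrightarrow>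
    ((\<lambda>p. f (fst p) (snd p) - l (snd p)) \<longlongrightarrow> 0) (F \<times>\<^sub>F principal K)"
proof -
  have "eventually P (F \<times>\<^sub>F principal K) \<longleftrightarrow> eventually (\<lambda>n. \<forall>x\<in>K. P (n, x)) F" for P
  proof
    assume "eventually P (F \<times>\<^sub>F principal K)"
    then obtain Pf Pg where *: "eventually Pf F" "\<forall>x\<in>K. Pg x" "\<And>n x. Pf n \<Longrightarrow> Pg x \<Longrightarrow> P (n, x)"
      by (auto simp: eventually_prod_filter eventually_principal)
    from *(1) show "eventually (\<lambda>n. \<forall>x\<in>K. P (n, x)) F"
      by (rule eventually_mono) (use *(2,3) in auto)
  next
    assume *: "eventually (\<lambda>n. \<forall>x\<in>K. P (n, x)) F"
    show "eventually P (F \<times>\<^sub>F principal K)"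
      unfolding eventually_prod_filter eventually_principal
      by (intro exI[of _ "\<lambda>n. \<forall>x\<in>K. P (n, x)"] exI[of _ "\<lambda>x. x \<in> K"] conjI *) auto
  qed
  thus ?thesis unfolding uniform_limit_iff tendsto_iff dist_norm by simp
qed

section \<open>Ratios of coefficients\<close>

lemma ml_coeff_pos: "\<rho> > 0 \<Longrightarrow> ml_coeff \<rho> n > 0"
  unfolding ml_coeff_def by (intro divide_pos_pos Gamma_real_pos add_pos_nonneg) auto

lemma ml_R_eq: "ml_R \<rho> (Suc n) = ml_coeff \<rho> n / ml_coeff \<rho> (Suc n)"
  by (simp add: ml_R_def ml_coeff_def)

lemma ml_coeff_Suc:
  assumes "\<rho> > 1" shows "ml_coeff \<rho> (Suc n) = ml_coeff \<rho> n / ml_R \<rho> (Suc n)"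
proof -
  have "ml_coeff \<rho> n > 0" "ml_coeff \<rho> (Suc n) > 0" using assms by (auto intro: ml_coeff_pos)
  thus ?thesis by (simp add: ml_R_eq)
qed

lemma ml_R_mono_le:
  assumes "\<rho> > 1" "1 \<le> m" "m \<le> n" shows "ml_R \<rho> m \<le> ml_R \<rho> n"
  using assms(3)
proof (induction rule: dec_induct)
  case (step n)
  thus ?case using ml_R_mono[OF assms(1), of n] assms(2) by linarith
qed simp

lemma inverse_ml_coeff_eq_exp:
  assumes "\<rho> > 1"
  shows "1 / complex_of_real (ml_coeff \<rho> n) = exp (of_real (ln_Gamma (1 + real n / \<rho>)))"
proof -
  have "1 + real n / \<rho> > 0" using assms by (intro add_pos_nonneg) auto
  thus ?thesis by (simp add: ml_coeff_def exp_of_real ln_Gamma_real_pos Gamma_real_pos)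
qed

text \<open>The term of index \<open>n + k\<close> relative to the term of index \<open>n\<close> at
  \<open>z = ml_R \<rho> n\<close>. It is the product of
  \<open>ml_R \<rho> n / ml_R \<rho> (n + i)\<close> over \<open>1 \<le> i \<le> k\<close>, hence at
  most 1 by monotonicity.\<close>

definition coeff_up :: "real \<Rightarrow> nat \<Rightarrow> nat \<Rightarrow> real" where
  "coeff_up \<rho> n k = ml_coeff \<rho> (n + k) * ml_R \<rho> n ^ k / ml_coeff \<rho> n"

text \<open>The analogue for the index \<open>n - k\<close>: for \<open>k \<le> n\<close> it is the
  product of \<open>ml_R \<rho> (n - i) / ml_R \<rho> n\<close> over \<open>i < k\<close>.\<close>

definition coeff_down :: "real \<Rightarrow> nat \<Rightarrow> nat \<Rightarrow> real" where
  "coeff_down \<rho> n k = ml_coeff \<rho> (n - k) / (ml_coeff \<rho> n * ml_R \<rho> n ^ k)"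

lemma coeff_up_Suc:
  assumes "\<rho> > 1"
  shows "coeff_up \<rho> n (Suc k) = coeff_up \<rho> n k * (ml_R \<rho> n / ml_R \<rho> (n + Suc k))"
  using ml_coeff_Suc[OF assms, of "n + k"] by (simp add: coeff_up_def mult_ac)

lemma coeff_up_bounds:
  assumes "\<rho> > 1" "n \<ge> 1" shows "0 < coeff_up \<rho> n k \<and> coeff_up \<rho> n k \<le> 1"
proof (induction k)
  case 0
  have "ml_coeff \<rho> n > 0" using assms by (intro ml_coeff_pos) auto
  thus ?case by (simp add: coeff_up_def)
next
  case (Suc k)
  have "ml_R \<rho> n / ml_R \<rho> (n + Suc k) \<le> 1"
    using ml_R_mono_le[OF assms, of "n + Suc k"] ml_R_pos[OF assms(1)] by (simp add: divide_le_eq)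
  moreover have "ml_R \<rho> n / ml_R \<rho> (n + Suc k) > 0" using ml_R_pos[OF assms(1)] by simp
  ultimately show ?case unfolding coeff_up_Suc[OF assms(1)] using Suc
    by (intro conjI mult_pos_pos mult_le_one) auto
qed

lemma coeff_up_limit:
  assumes "\<rho> > 1" shows "(\<lambda>n. coeff_up \<rho> n k) \<longlonglongrightarrow> 1"
proof (induction k)
  case 0
  have "ml_coeff \<rho> n \<noteq> 0" for n using ml_coeff_pos[of \<rho> n] assms by simp
  thus ?case by (simp add: coeff_up_def)
next
  case (Suc k)
  have "(\<lambda>n. inverse (ml_R \<rho> (n + Suc k) / ml_R \<rho> n)) \<longlonglongrightarrow> inverse 1"
    by (intro tendsto_inverse ml_R_ratio_limit assms) simp
  from tendsto_mult[OF Suc this] show ?case unfolding coeff_up_Suc[OF assms] by simp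
qed

lemma coeff_down_bounds:
  assumes "\<rho> > 1" "k \<le> n" shows "0 < coeff_down \<rho> n k \<and> coeff_down \<rho> n k \<le> 1"
  using assms(2)
proof (induction k)
  case 0
  have "ml_coeff \<rho> n > 0" using assms by (intro ml_coeff_pos) auto
  thus ?case by (simp add: coeff_down_def)
next
  case (Suc k)
  define m where "m = n - Suc k"
  have m: "n - k = Suc m" "Suc m \<le> n" using Suc.prems by (auto simp: m_def)
  have R: "ml_R \<rho> (Suc m) > 0" "ml_R \<rho> n > 0" using ml_R_pos[OF assms(1)] by auto
  have eq: "coeff_down \<rho> n (Suc k) = coeff_down \<rho> n k * (ml_R \<rho> (Suc m) / ml_R \<rho> n)"
    using ml_coeff_Suc[OF assms(1), of m] R m(1) by (simp add: coeff_down_def m_def[symmetric])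
  have "ml_R \<rho> (Suc m) / ml_R \<rho> n \<le> 1"
    using ml_R_mono_le[OF assms(1) _ m(2)] R by simp
  moreover have "ml_R \<rho> (Suc m) / ml_R \<rho> n > 0" using R by simp
  moreover have "0 < coeff_down \<rho> n k" "coeff_down \<rho> n k \<le> 1" using Suc by auto
  ultimately show ?case unfolding eq by (intro conjI mult_pos_pos mult_le_one) (use R in auto)
qed

text \<open>Replacing \<open>n\<close> by \<open>m + k\<close> removes the truncated subtraction and
  reduces the claim to \<open>coeff_up\<close>.\<close>

lemma coeff_down_limit:
  assumes "\<rho> > 1" shows "(\<lambda>n. coeff_down \<rho> n k) \<longlonglongrightarrow> 1"
proof (rule LIMSEQ_offset[of _ k])
  have "(\<lambda>m. inverse (coeff_up \<rho> m k) * inverse (ml_R \<rho> (m + k) / ml_R \<rho> m) ^ k) \<longlonglongrightarrow> inverse 1 * inverse 1 ^ k"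
    by (intro tendsto_intros coeff_up_limit ml_R_ratio_limit assms) auto
  moreover have "inverse (coeff_up \<rho> m k) * inverse (ml_R \<rho> (m + k) / ml_R \<rho> m) ^ k = coeff_down \<rho> (m + k) k" for m
    using ml_R_pos[OF assms, of m] ml_R_pos[OF assms, of "m + k"]
    by (simp add: coeff_up_def coeff_down_def power_divide field_simps)
  ultimately show "(\<lambda>m. coeff_down \<rho> (m + k) k) \<longlonglongrightarrow> 1" by simp
qed

abbreviation scaled_ratio :: "(complex \<Rightarrow> complex) \<Rightarrow> real \<Rightarrow> nat \<Rightarrow> complex \<Rightarrow> complex" where
  "scaled_ratio f \<rho> n q \<equiv> f (of_real (ml_R \<rho> n) * q) / (of_real (ml_coeff \<rho> n) * (of_real (ml_R \<rho> n) * q) ^ n)"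

lemma ml_tail_limit:
  fixes q :: "'p \<Rightarrow> complex" and N :: "'p \<Rightarrow> nat"
  assumes "\<rho> > 1" "filterlim N sequentially F" "(q \<longlongrightarrow> \<xi>) F" "norm \<xi> < 1" "\<xi> \<noteq> 0"
  shows "((\<lambda>p. scaled_ratio (ml_tail \<rho> (N p + 1)) \<rho> (N p) (q p)) \<longlongrightarrow> \<xi> / (1 - \<xi>)) F"
proof (cases "F = bot")
  \<comment> \<open>Tannery's theorem needs a nontrivial filter; the trivial one arises from an
    empty compact set.\<close>
  case False
  obtain r where r: "norm \<xi> < r" "r < 1" using dense[OF assms(4)] by blast
  have r0: "r > 0" using r(1) norm_ge_zero[of \<xi>] by linarith
  define a where "a = (\<lambda>k p. of_real (coeff_up \<rho> (N p) (Suc k)) * q p ^ Suc k)"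
  have "((\<lambda>p. norm (q p)) \<longlongrightarrow> norm \<xi>) F" by (intro tendsto_intros assms)
  hence ev: "eventually (\<lambda>p. norm (q p) < r) F" by (rule order_tendstoD) (rule r(1))
  have ev1: "eventually (\<lambda>p. N p \<ge> 1) F"
    using assms(2) by (auto simp: filterlim_at_top)
  have bound: "norm (a k p) \<le> r ^ Suc k" if "norm (q p) < r" "N p \<ge> 1" for k p
  proof -
    have "\<bar>coeff_up \<rho> (N p) (Suc k)\<bar> * norm (q p) ^ Suc k \<le> 1 * r ^ Suc k"
      using coeff_up_bounds[OF assms(1) that(2), of "Suc k"] that(1) r0 by (intro mult_mono power_mono) auto
    thus ?thesis by (simp add: a_def norm_mult norm_power del: power_Suc)
  qed
  have sr: "summable (\<lambda>k. r ^ Suc k)" using r r0 by (subst summable_Suc_iff) (auto intro!: summable_geometric)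
  have "((\<lambda>p. suminf (\<lambda>k. a k p)) \<longlongrightarrow> (\<Sum>k. \<xi> ^ Suc k)) F"
  proof (rule tannerys_theorem[THEN conjunct2, THEN conjunct2])
    show "((\<lambda>p. a k p) \<longlongrightarrow> \<xi> ^ Suc k) F" for k
    proof -
      have "((\<lambda>p. complex_of_real (coeff_up \<rho> (N p) (Suc k))) \<longlongrightarrow> of_real 1) F"
        by (intro tendsto_of_real filterlim_compose[OF coeff_up_limit assms(2)] assms(1))
      from tendsto_mult[OF this tendsto_power[OF assms(3), of "Suc k"]] show ?thesis unfolding a_def by simp
    qed
    have "eventually (\<lambda>(k::nat, p). norm (q p) < r \<and> N p \<ge> 1) (at_top \<times>\<^sub>F F)"
      by (subst eventually_prod2) (use ev ev1 in \<open>auto intro: eventually_conj\<close>)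
    thus "\<forall>\<^sub>F (k, p) in at_top \<times>\<^sub>F F. norm (a k p) \<le> r ^ Suc k"
      by (rule eventually_mono) (use bound in auto)
  qed (rule sr, rule False)
  also have "(\<Sum>k. \<xi> ^ Suc k) = \<xi> / (1 - \<xi>)"
    using suminf_mult[OF summable_geometric[OF assms(4)], of \<xi>] suminf_geometric[OF assms(4)] by simp
  finally have lim: "((\<lambda>p. suminf (\<lambda>k. a k p)) \<longlongrightarrow> \<xi> / (1 - \<xi>)) F" .
  have "eventually (\<lambda>p. q p \<noteq> 0) F" using tendsto_imp_eventually_ne[OF assms(3,5)] .
  with ev have "eventually (\<lambda>p. suminf (\<lambda>k. a k p) = scaled_ratio (ml_tail \<rho> (N p + 1)) \<rho> (N p) (q p)) F"
    using ev1
  proof eventually_elim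
    case (elim p)
    define z where "z = of_real (ml_R \<rho> (N p)) * q p"
    define n where "n = N p"
    have z: "z \<noteq> 0" using elim ml_R_pos[OF assms(1), of n] by (simp add: z_def n_def)
    have c: "ml_coeff \<rho> n > 0" using assms(1) by (intro ml_coeff_pos) simp
    have ak: "a k p = of_real (ml_coeff \<rho> (n + 1 + k)) * z ^ (n + 1 + k) / (of_real (ml_coeff \<rho> n) * z ^ n)" for k
    proof -
      have "a k p = of_real (ml_coeff \<rho> (n + Suc k)) / of_real (ml_coeff \<rho> n) * z ^ Suc k"
        unfolding a_def coeff_up_def z_def n_def[symmetric] power_mult_distrib by (simp del: power_Suc)
      thus ?thesis using z by (simp add: power_add)
    qed
    have "summable (\<lambda>k. a k p)" by (rule summable_comparison_test'[OF sr]) (use bound elim in auto)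
    from suminf_mult[OF this, of "of_real (ml_coeff \<rho> n) * z ^ n"]
    have "ml_tail \<rho> (n + 1) z = (of_real (ml_coeff \<rho> n) * z ^ n) * suminf (\<lambda>k. a k p)"
      using z c by (simp add: ml_tail_def ak)
    hence "suminf (\<lambda>k. a k p) = ml_tail \<rho> (n + 1) z / (of_real (ml_coeff \<rho> n) * z ^ n)"
      using z c by simp
    thus ?case by (simp only: z_def n_def)
  qed
  from Lim_transform_eventually[OF lim this] show ?thesis .
qed simp

text \<open>Read backwards from index \<open>n\<close>, the sum runs over powers of
  \<open>1 / q\<close> and is dominated geometrically; setting the terms with \<open>k > n\<close>
  to 0 makes it a series. The limit \<open>1 / (1 - 1 / \<xi>)\<close> equals
  \<open>- \<xi> / (1 - \<xi>)\<close>.\<close>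

lemma ml_section_limit:
  fixes q :: "'p \<Rightarrow> complex" and N :: "'p \<Rightarrow> nat"
  assumes "\<rho> > 1" "filterlim N sequentially F" "(q \<longlongrightarrow> \<xi>) F" "norm \<xi> > 1"
  shows "((\<lambda>p. scaled_ratio (ml_section \<rho> (N p)) \<rho> (N p) (q p)) \<longlongrightarrow> - \<xi> / (1 - \<xi>)) F"
proof (cases "F = bot")
  case False
  obtain r where r: "1 < r" "r < norm \<xi>" using dense[OF assms(4)] by blast
  define s where "s = inverse r"
  have s: "0 < s" "s < 1" using r by (auto simp: s_def field_simps)
  have \<xi>0: "\<xi> \<noteq> 0" using assms(4) by auto
  define a where "a = (\<lambda>k p. if k \<le> N p then of_real (coeff_down \<rho> (N p) k) * inverse (q p) ^ k else 0)"
  have "((\<lambda>p. norm (q p)) \<longlongrightarrow> norm \<xi>) F" by (intro tendsto_intros assms)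
  hence ev: "eventually (\<lambda>p. norm (q p) > r) F" by (rule order_tendstoD) (rule r(2))
  have bound: "norm (a k p) \<le> s ^ k" if "norm (q p) > r" for k p
  proof (cases "k \<le> N p")
    case True
    have "inverse (norm (q p)) \<le> s" unfolding s_def using that r by (intro le_imp_inverse_le) auto
    hence "\<bar>coeff_down \<rho> (N p) k\<bar> * inverse (norm (q p)) ^ k \<le> 1 * s ^ k"
      using coeff_down_bounds[OF assms(1) True] s by (intro mult_mono power_mono) auto
    thus ?thesis using True by (simp add: a_def norm_mult norm_power norm_inverse)
  qed (use s in \<open>simp add: a_def\<close>)
  have "((\<lambda>p. suminf (\<lambda>k. a k p)) \<longlongrightarrow> (\<Sum>k. inverse \<xi> ^ k)) F"
  proof (rule tannerys_theorem[THEN conjunct2, THEN conjunct2])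
    show "((\<lambda>p. a k p) \<longlongrightarrow> inverse \<xi> ^ k) F" for k
    proof (rule Lim_transform_eventually)
      have "((\<lambda>p. complex_of_real (coeff_down \<rho> (N p) k)) \<longlongrightarrow> of_real 1) F"
        by (intro tendsto_of_real filterlim_compose[OF coeff_down_limit assms(2)] assms(1))
      from tendsto_mult[OF this tendsto_power[OF tendsto_inverse[OF assms(3) \<xi>0], of k]]
      show "((\<lambda>p. of_real (coeff_down \<rho> (N p) k) * inverse (q p) ^ k) \<longlongrightarrow> inverse \<xi> ^ k) F" by simp
      have "eventually (\<lambda>p. N p \<ge> k) F" using assms(2) by (auto simp: filterlim_at_top)
      thus "eventually (\<lambda>p. of_real (coeff_down \<rho> (N p) k) * inverse (q p) ^ k = a k p) F"
        by (rule eventually_mono) (simp add: a_def)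
    qed
    have "eventually (\<lambda>(k::nat, p). norm (q p) > r) (at_top \<times>\<^sub>F F)"
      by (subst eventually_prod2) (use ev in auto)
    thus "\<forall>\<^sub>F (k, p) in at_top \<times>\<^sub>F F. norm (a k p) \<le> s ^ k"
      by (rule eventually_mono) (use bound in auto)
    show "summable (\<lambda>k. s ^ k)" using s by (auto intro!: summable_geometric)
  qed (rule False)
  also have "(\<Sum>k. inverse \<xi> ^ k) = - \<xi> / (1 - \<xi>)"
  proof -
    have "norm (inverse \<xi>) < 1" using assms(4) \<xi>0 by (simp add: norm_inverse inverse_less_1_iff)
    from suminf_geometric[OF this] have "(\<Sum>k. inverse \<xi> ^ k) = 1 / (1 - inverse \<xi>)" .
    also have "\<dots> = - \<xi> / (1 - \<xi>)"
    proof -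
      have "\<xi> \<noteq> 1" using assms(4) by auto
      hence "1 - \<xi> \<noteq> 0" "1 - inverse \<xi> \<noteq> 0" using \<xi>0 by (auto simp: field_simps)
      thus ?thesis using \<xi>0 by (simp add: field_simps)
    qed
    finally show ?thesis .
  qed
  finally have lim: "((\<lambda>p. suminf (\<lambda>k. a k p)) \<longlongrightarrow> - \<xi> / (1 - \<xi>)) F" .
  have "eventually (\<lambda>p. suminf (\<lambda>k. a k p) = scaled_ratio (ml_section \<rho> (N p)) \<rho> (N p) (q p)) F"
    using ev
  proof eventually_elim
    case (elim p)
    define z where "z = of_real (ml_R \<rho> (N p)) * q p"
    define n where "n = N p"
    have q0: "q p \<noteq> 0" using elim r by auto
    have R: "ml_R \<rho> n > 0" using ml_R_pos[OF assms(1)] .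
    have z: "z \<noteq> 0" using q0 R by (simp add: z_def n_def)
    have "suminf (\<lambda>k. a k p) = (\<Sum>k\<le>n. a k p)" by (rule suminf_finite) (auto simp: a_def n_def)
    also have "\<dots> = (\<Sum>k\<le>n. of_real (ml_coeff \<rho> (n - k)) * z ^ (n - k) / (of_real (ml_coeff \<rho> n) * z ^ n))"
    proof (rule sum.cong)
      fix k assume "k \<in> {..n}"
      hence k: "k \<le> n" by simp
      have "z ^ n = z ^ (n - k) * z ^ k" using k by (simp flip: power_add)
      hence "z ^ (n - k) / z ^ n = 1 / z ^ k" using z by simp
      moreover have "a k p = of_real (ml_coeff \<rho> (n - k)) / of_real (ml_coeff \<rho> n) * (1 / z ^ k)"
        using k unfolding a_def coeff_down_def z_def n_def[symmetric] power_mult_distrib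
        by (simp add: power_inverse divide_inverse)
      ultimately have "a k p = of_real (ml_coeff \<rho> (n - k)) / of_real (ml_coeff \<rho> n) * (z ^ (n - k) / z ^ n)" by simp
      thus "a k p = of_real (ml_coeff \<rho> (n - k)) * z ^ (n - k) / (of_real (ml_coeff \<rho> n) * z ^ n)" by simp
    qed simp
    also have "\<dots> = (\<Sum>k\<le>n. of_real (ml_coeff \<rho> k) * z ^ k / (of_real (ml_coeff \<rho> n) * z ^ n))"
      by (rule sum.nat_diff_reindex[of "\<lambda>k. of_real (ml_coeff \<rho> k) * z ^ k / (of_real (ml_coeff \<rho> n) * z ^ n)" "Suc n",
            simplified lessThan_Suc_atMost, simplified])
    also have "\<dots> = ml_section \<rho> n z / (of_real (ml_coeff \<rho> n) * z ^ n)"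
      by (simp add: ml_section_def sum_divide_distrib)
    finally show ?case by (simp only: z_def n_def)
  qed
  from Lim_transform_eventually[OF lim this] show ?thesis .
qed simp

lemma summable_mittag_leffler:
  assumes "\<rho> > 1" shows "summable (\<lambda>j. of_real (ml_coeff \<rho> j) * z ^ j :: complex)"
proof -
  obtain a where a: "2 * norm z \<le> exp a"
    by (metis exp_ge_add_one_self add.commute le_add_same_cancel2 order_trans zero_le_one)
  have "\<rho> * (pi / \<rho>) = pi" using assms by simp
  from mittag_leffler_sums_hankel[of \<rho> "pi / \<rho>" z a] this a assms show ?thesis
    by (auto simp: sums_iff)
qed

section \<open>Splitting into section and tail\<close>

lemma mittag_leffler_split:
  assumes "\<rho> > 1" shows "mittag_leffler \<rho> z = ml_section \<rho> n z + ml_tail \<rho> (n + 1) z"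
  using suminf_split_initial_segment[OF summable_mittag_leffler[OF assms, of z], of "n + 1"]
  by (simp add: mittag_leffler_def ml_section_def ml_tail_def lessThan_Suc_atMost add_ac)

lemma ml_I_eq:
  assumes "\<rho> > 1"
  shows "ml_I \<rho> n z lam = (1 - lam) * mittag_leffler \<rho> z - ml_tail \<rho> (n + 1) z"
    and "ml_I \<rho> n z lam = ml_section \<rho> n z - lam * mittag_leffler \<rho> z"
  using mittag_leffler_split[OF assms, of z n] by (simp_all add: ml_I_def algebra_simps)

lemma normalized_I_eq:
  "normalized_I \<rho> lam \<xi> n w = ml_I \<rho> n (of_real (ml_R \<rho> n) * (\<xi> * w)) lam /
     (of_real (ml_coeff \<rho> n) * (of_real (ml_R \<rho> n) * (\<xi> * w)) ^ n)"
  by (simp add: normalized_I_def ml_coeff_def power_mult_distrib mult.assoc)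

section \<open>The scaling limits\<close>

text \<open>The factor \<open>cis \<beta>\<close> turns the ray of argument \<open>- \<beta>\<close>
  into the real axis, so the distance of \<open>z\<close> from that ray is at least
  \<open>|Im (z * cis \<beta>)|\<close>, which is proportional to \<open>|z|\<close>. The edge maps
  into the unit circle, while \<open>|z| \<ge> 2\<close> eventually.\<close>

lemma hcontour_separation:
  fixes q :: "'p \<Rightarrow> complex" and R :: "'p \<Rightarrow> real"
  assumes "(q \<longlongrightarrow> \<xi>) F" "\<xi> \<noteq> 0" "filterlim R at_top F" "b \<ge> 0"
    and "Im (\<xi> * cis b) \<noteq> 0" "Im (\<xi> * cis (- b)) \<noteq> 0"
  obtains c where "c > 0" "eventually (\<lambda>p. \<forall>v\<in>hcontour 0 b.
      norm (exp v - of_real (R p) * q p) \<ge> c * norm (of_real (R p) * q p)) F"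
proof -
  define m where "m = (\<lambda>\<beta>. \<bar>Im (\<xi> * cis \<beta>)\<bar> / norm \<xi>)"
  have m: "m b > 0" "m (- b) > 0" using assms by (auto simp: m_def)
  \<comment> \<open>1/2 serves the edge, where \<open>|z| - 1 \<ge> |z| / 2\<close>; halving
    \<open>m\<close> leaves room for \<open>q\<close> to differ from its limit.\<close>
  define c where "c = min (1 / 2) (min (m b / 2) (m (- b) / 2))"
  have c: "c > 0" using m by (simp add: c_def)
  have c2: "c \<le> 1 / 2" "c < m b" "c < m (- b)" using m by (auto simp: c_def)
  have lim: "((\<lambda>p. \<bar>Im (q p * cis \<beta>)\<bar> / norm (q p)) \<longlongrightarrow> m \<beta>) F" for \<beta>
    unfolding m_def using assms(1,2) by (intro tendsto_intros) auto
  have 1: "eventually (\<lambda>p. \<bar>Im (q p * cis b)\<bar> / norm (q p) > c) F"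
    by (rule order_tendstoD(1)[OF lim c2(2)])
  have 2: "eventually (\<lambda>p. \<bar>Im (q p * cis (- b))\<bar> / norm (q p) > c) F"
    by (rule order_tendstoD(1)[OF lim c2(3)])
  have "((\<lambda>p. norm (q p)) \<longlongrightarrow> norm \<xi>) F" by (intro tendsto_intros assms)
  hence "filterlim (\<lambda>p. norm (q p) * R p) at_top F"
    by (rule filterlim_tendsto_pos_mult_at_top) (use assms in auto)
  hence 3: "eventually (\<lambda>p. norm (q p) * R p \<ge> 2) F" by (auto simp: filterlim_at_top)
  have 4: "eventually (\<lambda>p. R p > 0) F" using assms(3) by (auto simp: filterlim_at_top_dense)
  have "eventually (\<lambda>p. \<forall>v\<in>hcontour 0 b.
      norm (exp v - of_real (R p) * q p) \<ge> c * norm (of_real (R p) * q p)) F"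
    using 1 2 3 4
  proof eventually_elim
    case (elim p)
    define z where "z = of_real (R p) * q p"
    have nz: "norm z = R p * norm (q p)" using elim by (simp add: z_def norm_mult)
    have q0: "norm (q p) > 0" using elim by (cases "q p = 0") auto
    have side: "norm (exp v - z) \<ge> c * norm z" if "Im v = - \<beta>" "\<bar>Im (q p * cis \<beta>)\<bar> / norm (q p) > c" for v \<beta>
    proof -
      have "c * norm z \<le> R p * \<bar>Im (q p * cis \<beta>)\<bar>"
        using that(2) q0 elim unfolding nz by (simp add: pos_less_divide_eq mult_ac)
      also have "\<dots> = \<bar>Im (z * cis \<beta>)\<bar>"
      proof -
        have "Im (z * cis \<beta>) = R p * Im (q p * cis \<beta>)" by (simp add: z_def algebra_simps)
        thus ?thesis using elim by (simp add: abs_mult)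
      qed
      also have "\<dots> = \<bar>Im ((exp v - z) * cis \<beta>)\<bar>"
      proof -
        have "exp v * cis \<beta> = of_real (exp (Re v))"
          using that(1) by (simp add: exp_eq_polar mult.assoc cis_mult)
        hence "Im (exp v * cis \<beta>) = 0" by simp
        thus ?thesis by (simp add: left_diff_distrib)
      qed
      also have "\<dots> \<le> norm ((exp v - z) * cis \<beta>)" by (rule abs_Im_le_cmod)
      also have "\<dots> = norm (exp v - z)" by (simp add: norm_mult)
      finally show ?thesis .
    qed
    show ?case
    proof
      fix v assume v: "v \<in> hcontour 0 b"
      consider "Im v = b" | "Im v = - b" | "Re v = 0"
        using v assms(4) by (auto simp: hcontour_def abs_if split: if_splits)
      thus "norm (exp v - of_real (R p) * q p) \<ge> c * norm (of_real (R p) * q p)"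
        unfolding z_def[symmetric]
      proof cases
        case 1
        thus "c * norm z \<le> norm (exp v - z)" using side[of v "- b"] elim by simp
      next
        case 2
        thus "c * norm z \<le> norm (exp v - z)" using side[of v b] elim by simp
      next
        case 3
        have "norm z \<ge> 2" using elim nz by (simp add: mult.commute)
        have "c * norm z \<le> 1 / 2 * norm z" using c2(1) by (intro mult_right_mono) auto
        also have "\<dots> \<le> norm z - 1" using \<open>norm z \<ge> 2\<close> by simp
        also have "\<dots> = norm z - norm (exp v)" using 3 by simp
        also have "\<dots> \<le> norm (exp v - z)" by (metis norm_minus_commute norm_triangle_ineq2)
        finally show "c * norm z \<le> norm (exp v - z)" .
      qed
    qed
  qed
  from that[OF c this] show thesis .
qed

text \<open>For \<open>u\<close> of order \<open>log n / n\<close> the product \<open>n * u\<close>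
  may grow, but \<open>n * |u|^2\<close> vanishes. So only the linear terms of
  \<open>Ln (1 + u)\<close> and of the power \<open>\<rho>\<close> of \<open>1 + u\<close> matter in
  an exponent of size \<open>n\<close>.\<close>

lemma perturbation_limits:
  fixes u :: "'p \<Rightarrow> complex" and N :: "'p \<Rightarrow> nat"
  assumes "filterlim N sequentially F" "\<rho> > 0" "\<alpha> \<ge> 0" "\<beta> \<ge> 0"
    and bd: "eventually (\<lambda>p. norm (u p) \<le> (\<alpha> * ln (real (N p)) + \<beta>) / real (N p)) F"
  shows "(u \<longlongrightarrow> 0) F"
    and "((\<lambda>p. of_nat (N p) * (Ln (1 + u p) - u p)) \<longlongrightarrow> 0) F"
    and "((\<lambda>p. of_nat (N p) * (exp (of_real \<rho> * Ln (1 + u p)) - 1 - of_real \<rho> * u p)) \<longlongrightarrow> 0) F"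
proof -
  show u0: "(u \<longlongrightarrow> 0) F"
  proof (rule Lim_null_comparison[OF bd])
    have "(\<lambda>n. (\<alpha> * ln (real n) + \<beta>) / real n) \<longlonglongrightarrow> 0" by real_asymp
    from filterlim_compose[OF this assms(1)]
    show "((\<lambda>p. (\<alpha> * ln (real (N p)) + \<beta>) / real (N p)) \<longlongrightarrow> 0) F" .
  qed
  have sq: "((\<lambda>p. real (N p) * norm (u p) ^ 2) \<longlongrightarrow> 0) F"
  proof (rule Lim_null_comparison)
    show "eventually (\<lambda>p. norm (real (N p) * norm (u p) ^ 2) \<le> real (N p) * ((\<alpha> * ln (real (N p)) + \<beta>) / real (N p)) ^ 2) F"
      using bd
    proof (rule eventually_mono)
      fix p assume "norm (u p) \<le> (\<alpha> * ln (real (N p)) + \<beta>) / real (N p)"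
      hence "norm (u p) ^ 2 \<le> ((\<alpha> * ln (real (N p)) + \<beta>) / real (N p)) ^ 2" by (intro power_mono) auto
      thus "norm (real (N p) * norm (u p) ^ 2) \<le> real (N p) * ((\<alpha> * ln (real (N p)) + \<beta>) / real (N p)) ^ 2"
        by (simp add: mult_left_mono)
    qed
    have "(\<lambda>n. (\<alpha> * ln (real n) + \<beta>) / sqrt (real n)) \<longlonglongrightarrow> 0" by real_asymp
    from tendsto_power[OF this, of 2]
    have "(\<lambda>n. ((\<alpha> * ln (real n) + \<beta>) / sqrt (real n)) ^ 2) \<longlonglongrightarrow> 0" by simp
    moreover have "((\<alpha> * ln (real n) + \<beta>) / sqrt (real n)) ^ 2 = real n * ((\<alpha> * ln (real n) + \<beta>) / real n) ^ 2" for n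
      by (cases "n = 0") (simp_all add: power_divide power2_eq_square[of "real n"])
    ultimately have "(\<lambda>n. real n * ((\<alpha> * ln (real n) + \<beta>) / real n) ^ 2) \<longlonglongrightarrow> 0" by simp
    from filterlim_compose[OF this assms(1)]
    show "((\<lambda>p. real (N p) * ((\<alpha> * ln (real (N p)) + \<beta>) / real (N p)) ^ 2) \<longlongrightarrow> 0) F" .
  qed
  \<comment> \<open>The first bound makes the estimates for \<open>Ln (1 + u)\<close> applicable,
    the second yields \<open>|\<rho> * Ln (1 + u)| \<le> 1\<close>.\<close>
  define \<delta> where "\<delta> = min (1 / 4) (1 / (2 * \<rho>))"
  have "\<delta> > 0" using assms(2) by (simp add: \<delta>_def)
  hence small: "eventually (\<lambda>p. norm (u p) < \<delta>) F" using u0 by (auto simp: tendsto_iff dist_norm)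
  have L: "norm (Ln (1 + u p) - u p) \<le> 2 * norm (u p) ^ 2" if "norm (u p) < \<delta>" for p
  proof -
    have u: "norm (u p) < 1 / 2" using that by (auto simp: \<delta>_def)
    have "norm (Ln (1 + u p) - u p) \<le> norm (u p) ^ 2 / (1 - norm (u p))"
      by (rule Ln_approx_linear) (use u in simp)
    also have "\<dots> \<le> norm (u p) ^ 2 / (1 / 2)" by (intro divide_left_mono) (use u in auto)
    finally show ?thesis by simp
  qed
  show "((\<lambda>p. of_nat (N p) * (Ln (1 + u p) - u p)) \<longlongrightarrow> 0) F"
  proof (rule Lim_null_comparison)
    show "eventually (\<lambda>p. norm (of_nat (N p) * (Ln (1 + u p) - u p)) \<le> 2 * (real (N p) * norm (u p) ^ 2)) F"
      using small
    proof (rule eventually_mono)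
      fix p assume "norm (u p) < \<delta>"
      from mult_left_mono[OF L[OF this], of "real (N p)"]
      show "norm (of_nat (N p) * (Ln (1 + u p) - u p)) \<le> 2 * (real (N p) * norm (u p) ^ 2)"
        by (simp add: norm_mult mult_ac)
    qed
    show "((\<lambda>p. 2 * (real (N p) * norm (u p) ^ 2)) \<longlongrightarrow> 0) F" using tendsto_mult_right_zero[OF sq] .
  qed
  \<comment> \<open>The quadratic bound for \<open>exp y - 1 - y\<close> with
    \<open>|y| \<le> 2 * \<rho> * |u|\<close>, plus \<open>\<rho>\<close> times the bound for
    \<open>Ln (1 + u) - u\<close>.\<close>
  define M where "M = exp 1 * (2 * \<rho>) ^ 2 + \<rho> * 2"
  show "((\<lambda>p. of_nat (N p) * (exp (of_real \<rho> * Ln (1 + u p)) - 1 - of_real \<rho> * u p)) \<longlongrightarrow> 0) F"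
  proof (rule Lim_null_comparison)
    show "eventually (\<lambda>p. norm (of_nat (N p) * (exp (of_real \<rho> * Ln (1 + u p)) - 1 - of_real \<rho> * u p))
         \<le> M * (real (N p) * norm (u p) ^ 2)) F"
      using small
    proof (rule eventually_mono)
      fix p assume *: "norm (u p) < \<delta>"
      define y where "y = of_real \<rho> * Ln (1 + u p)"
      have "norm (u p) < 1 / 2" using * by (auto simp: \<delta>_def)
      from norm_Ln_le[OF this] have y: "norm y \<le> 2 * \<rho> * norm (u p)"
        using assms(2) by (simp add: y_def norm_mult)
      also have "\<dots> \<le> 2 * \<rho> * (1 / (2 * \<rho>))" using * assms(2) by (intro mult_left_mono) (auto simp: \<delta>_def)
      finally have y1: "norm y \<le> 1" using assms(2) by simp
      have "norm (exp y - (1 + y)) \<le> exp \<bar>Re y\<bar> * norm y ^ 2"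
        using Taylor_exp[of y 1] by (simp add: numeral_2_eq_2)
      also have "\<dots> \<le> exp 1 * (2 * \<rho> * norm (u p)) ^ 2"
        using y y1 abs_Re_le_cmod[of y] by (intro mult_mono power_mono) auto
      finally have 1: "norm (exp y - (1 + y)) \<le> exp 1 * (2 * \<rho>) ^ 2 * norm (u p) ^ 2"
        by (simp add: power_mult_distrib mult_ac)
      have "norm (of_real \<rho> * (Ln (1 + u p) - u p)) \<le> \<rho> * (2 * norm (u p) ^ 2)"
        using L[OF *] assms(2) by (simp add: norm_mult)
      hence "norm (exp y - (1 + y)) + norm (of_real \<rho> * (Ln (1 + u p) - u p)) \<le> M * norm (u p) ^ 2"
        using 1 by (simp add: M_def algebra_simps)
      hence "norm ((exp y - (1 + y)) + of_real \<rho> * (Ln (1 + u p) - u p)) \<le> M * norm (u p) ^ 2"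
        using norm_triangle_ineq order_trans by blast
      also have "(exp y - (1 + y)) + of_real \<rho> * (Ln (1 + u p) - u p) = exp y - 1 - of_real \<rho> * u p"
        by (simp add: y_def algebra_simps)
      finally have "norm (exp y - 1 - of_real \<rho> * u p) \<le> M * norm (u p) ^ 2" .
      from mult_left_mono[OF this, of "real (N p)"]
      show "norm (of_nat (N p) * (exp (of_real \<rho> * Ln (1 + u p)) - 1 - of_real \<rho> * u p))
         \<le> M * (real (N p) * norm (u p) ^ 2)"
        by (simp add: norm_mult mult_ac y_def)
    qed
    show "((\<lambda>p. M * (real (N p) * norm (u p) ^ 2)) \<longlongrightarrow> 0) F" using tendsto_mult_right_zero[OF sq] .
  qed
qed

section \<open>Phases, compact sets and points of the curve\<close>

lemma cis_rcong: "[x = y] (rmod (2 * pi)) \<Longrightarrow> cis x = cis y"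
proof -
  assume "[x = y] (rmod (2 * pi))"
  then obtain n :: int where "y = x + of_int n * (2 * pi)" by (auto simp: rcong_altdef)
  hence "cis y = cis x * cis (2 * pi * of_int n)" by (simp add: cis_mult mult_ac)
  thus ?thesis by (simp add: cis_multiple_2pi)
qed

text \<open>The two effects of reducing modulo \<open>2 * pi\<close> that the limits rely on:
  bounded angles keep the perturbation of order \<open>log n / n\<close>, and the phase factors are
  unchanged.\<close>

lemma reduced_argsD:
  assumes "reduced_args x \<tau>"
  shows "\<bar>\<tau> n\<bar> \<le> pi" and "exp (\<i> * of_real (\<tau> n)) = exp (\<i> * of_real (x n))"
proof -
  have *: "[\<tau> n = x n] (rmod (2 * pi))" "- pi < \<tau> n" "\<tau> n \<le> pi" using assms by (auto simp: reduced_args_def)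
  thus "\<bar>\<tau> n\<bar> \<le> pi" by linarith
  show "exp (\<i> * of_real (\<tau> n)) = exp (\<i> * of_real (x n))"
    using cis_rcong[OF *(1)] by (simp only: cis_conv_exp)
qed

lemma bounded_on_prod_filter:
  fixes f :: "'b :: topological_space \<Rightarrow> 'c :: real_normed_vector"
  assumes "compact K" "continuous_on K f"
  obtains B where "B \<ge> 0" "eventually (\<lambda>p. norm (f (snd p)) \<le> B) (F \<times>\<^sub>F principal K)"
proof -
  have "bounded (f ` K)" using assms by (intro compact_imp_bounded compact_continuous_image)
  then obtain B where B: "\<And>x. x \<in> K \<Longrightarrow> norm (f x) \<le> B" by (auto simp: bounded_iff)
  have "eventually (\<lambda>p. snd p \<in> K) (F \<times>\<^sub>F principal K)"
    using eventually_prodI[of "\<lambda>_. True" F "\<lambda>x. x \<in> K" "principal K"] by (simp add: eventually_principal)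
  hence "eventually (\<lambda>p. norm (f (snd p)) \<le> max B 0) (F \<times>\<^sub>F principal K)"
    by (rule eventually_mono) (use B in \<open>auto intro: max.coboundedI1\<close>)
  thus thesis using that[of "max B 0"] by simp
qed

text \<open>The angle in the parametrisation and \<open>Arg \<xi>\<close> agree modulo
  \<open>2 * pi\<close>; their ranges force equality, so the point satisfies the equation of the
  non-circular part.\<close>

lemma szego_curve_sectorD:
  assumes "\<rho> > 1" "\<xi> \<in> szego_curve \<rho>" "0 < Arg \<xi>" "Arg \<xi> < pi / (2 * \<rho>)"
  shows "norm \<xi> powr \<rho> * cos (\<rho> * Arg \<xi>) - 1 - \<rho> * ln (norm \<xi>) = 0"
proof -
  define \<phi> where "\<phi> = Arg \<xi>"
  from assms(2) obtain \<sigma> \<theta> where *: "\<xi> = of_real \<sigma> * cis \<theta>" "\<sigma> > 0"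
      "- pi / (2 * \<rho>) \<le> \<theta>" "\<theta> < 2 * pi - pi / (2 * \<rho>)"
      "\<theta> \<le> pi / (2 * \<rho>) \<Longrightarrow> \<sigma> powr \<rho> * cos (\<theta> * \<rho>) - 1 - \<rho> * ln \<sigma> = 0"
    by (auto simp: szego_curve_def)
  have n: "norm \<xi> = \<sigma>" using * by (simp add: norm_mult)
  have "\<xi> \<noteq> 0" using *(2) n by auto
  have "of_real \<sigma> * cis \<theta> = of_real \<sigma> * cis \<phi>"
    using Arg_eq[OF \<open>\<xi> \<noteq> 0\<close>] n *(1) by (simp add: \<phi>_def cis_conv_exp)
  hence "exp (\<i> * of_real \<theta>) = exp (\<i> * of_real \<phi>)" using *(2) by (simp add: cis_conv_exp)
  hence "\<i> * of_real \<theta> = \<i> * of_real \<phi>"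
  proof (rule exp_inj_strip)
    have "pi / (2 * \<rho>) < pi / 2" using assms(1) by (intro divide_strict_left_mono) auto
    thus "\<bar>Im (\<i> * of_real \<theta>) - Im (\<i> * of_real \<phi>)\<bar> < 2 * pi"
      using *(3,4) assms(3,4) pi_gt_zero by (simp add: \<phi>_def abs_if)
  qed
  hence "\<theta> = \<phi>" by simp
  thus ?thesis using *(5) assms(4) n by (simp add: \<phi>_def mult.commute)
qed

text \<open>Applied with an exponential of \<zeta>, bounded on the compact set, as \<open>f\<close>;
  it turns a relative error into an absolute one.\<close>

lemma tendsto_bounded_mult_null:
  fixes f g :: "'p \<Rightarrow> 'a :: real_normed_field"
  assumes "eventually (\<lambda>p. norm (f p) \<le> B) F" "(g \<longlongrightarrow> 0) F"
  shows "((\<lambda>p. f p * g p) \<longlongrightarrow> 0) F"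
proof (rule Lim_null_comparison)
  show "eventually (\<lambda>p. norm (f p * g p) \<le> B * norm (g p)) F"
    using assms(1) by (rule eventually_mono) (auto simp: norm_mult intro: mult_right_mono)
  show "((\<lambda>p. B * norm (g p)) \<longlongrightarrow> 0) F"
    using tendsto_mult_right_zero[OF tendsto_norm_zero[OF assms(2)]] .
qed

text \<open>Two comparisons are multiplied: \<open>E\<close> against its exponential main term, with
  quotient \<open>X\<close>, and that main term against the \<open>n\<close>-th term of the series,
  where an exact identity of exponents collects all errors in \<open>T\<close>.\<close>

lemma mittag_leffler_sector_limit:
  fixes \<xi> :: complex and \<tau>n :: "nat \<Rightarrow> real" and K :: "complex set"
  assumes \<rho>: "\<rho> > 1" and \<xi>: "\<xi> \<noteq> 0" and \<phi>: "\<phi> = Arg \<xi>" "0 < \<phi>" "\<phi> < pi / (2 * \<rho>)"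
    and curve: "norm \<xi> powr \<rho> * cos (\<rho> * \<phi>) - 1 - \<rho> * ln (norm \<xi>) = 0"
    and \<tau>: "\<tau> = norm \<xi> powr \<rho> * sin (\<phi> * \<rho>) - \<rho> * \<phi>"
    and red: "reduced_args (\<lambda>n. \<tau> / \<rho> * real n) \<tau>n" and K: "compact K"
  defines "F \<equiv> sequentially \<times>\<^sub>F principal K"
    and "w \<equiv> \<lambda>p. szego_w \<rho> \<xi> (\<tau>n (fst p)) (fst p) (snd p)"
    and "a \<equiv> (\<rho> - 1) / (2 * \<rho>)"
  shows "(w \<longlongrightarrow> 1) F"
    and "((\<lambda>p. scaled_ratio (mittag_leffler \<rho>) \<rho> (fst p) (\<xi> * w p)
         - of_real (sqrt (2 * pi * \<rho>)) * exp (of_real a * (\<xi> powr of_real \<rho> - 1)) * exp (snd p)) \<longlongrightarrow> 0) F"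
proof -
  define L where "L = Ln \<xi>"
  define s where "s = \<xi> powr of_real \<rho>"
  have expL: "exp L = \<xi>" using \<xi> by (simp add: L_def)
  have ReL: "Re L = ln (norm \<xi>)" and ImL: "Im L = \<phi>" using \<xi> \<phi>(1) by (simp_all add: L_def Arg_eq_Im_Ln)
  have s_exp: "s = exp (of_real \<rho> * L)" using \<xi> by (simp add: s_def powr_def L_def)
  have Res: "Re s = norm \<xi> powr \<rho> * cos (\<rho> * \<phi>)" and Ims: "Im s = norm \<xi> powr \<rho> * sin (\<rho> * \<phi>)"
    using \<xi> by (simp_all add: s_exp Re_exp Im_exp ReL ImL powr_def)
  \<comment> \<open>The real part of this identity is the equation of the curve, the imaginary part
    the definition of \<open>\<tau>\<close>.\<close>
  have sL: "s - 1 - of_real \<rho> * L = \<i> * of_real \<tau>"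
    using curve \<tau> by (simp add: complex_eq_iff Res Ims ReL ImL mult.commute)
  have \<rho>\<phi>: "0 < \<rho> * \<phi>" "\<rho> * \<phi> < pi / 2"
    using \<rho> \<phi> by (simp_all add: pos_less_divide_eq mult_ac)
  hence "sin (\<rho> * \<phi>) > 0" using pi_gt_zero by (intro sin_gt_zero) linarith+
  \<comment> \<open>Keeps \<open>s\<close> away from 1, so that the divisions by
    \<open>1 - s\<close> in \<open>szego_w\<close> are genuine.\<close>
  hence "Im s \<noteq> 0" using \<xi> by (simp add: Ims)
  hence s1: "1 - s \<noteq> 0" by (auto simp: complex_eq_iff)
  have N: "filterlim fst sequentially F" unfolding F_def by (rule filterlim_fst)
  have Npos: "eventually (\<lambda>p. fst p > 0) F"
    using filterlim_at_top[THEN iffD1, OF N, rule_format, of 1] by (rule eventually_mono) simp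
  define u where "u = (\<lambda>p. w p - 1)"
  obtain B where B: "B \<ge> 0" "eventually (\<lambda>p. norm (snd p) \<le> B) F"
    using bounded_on_prod_filter[OF K, of "\<lambda>x. x" sequentially] unfolding F_def by auto
  note \<tau>n_bd = reduced_argsD(1)[OF red]
  \<comment> \<open>The three terms for which \<open>szego_w\<close> is designed: half a logarithm
    against Stirling's square root, the variable \<zeta>, and the phase. The exponent contains them
    with the opposite sign.\<close>
  have u_eq: "of_nat (fst p) * u p * (1 - s) = of_real (ln (real (fst p))) / 2 - snd p + \<i> * of_real (\<tau>n (fst p))"
    if "fst p > 0" for p
  proof -
    have "x * (1 + A / (2 * y * x) - B / (y * x) - 1) * y = A / 2 - B" if "x \<noteq> 0" "y \<noteq> 0" for x y A B :: complex
      using that by (simp add: field_simps)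
    from this[of "of_nat (fst p)" "1 - s" "of_real (ln (real (fst p)))" "snd p - \<i> * of_real (\<tau>n (fst p))"]
    show ?thesis using that s1 unfolding u_def w_def szego_w_def s_def[symmetric] by simp
  qed
  define c1 where "c1 = norm (1 - s)"
  have c1: "c1 > 0" using s1 by (simp add: c1_def)
  have ubd: "eventually (\<lambda>p. norm (u p) \<le> (1 / (2 * c1) * ln (real (fst p)) + (B + pi) / c1) / real (fst p)) F"
    using Npos B(2)
  proof eventually_elim
    case (elim p)
    have "norm (of_nat (fst p) * u p * (1 - s)) \<le> norm (of_real (ln (real (fst p))) / 2 - snd p)
        + norm (\<i> * of_real (\<tau>n (fst p)) :: complex)"
      unfolding u_eq[OF elim(1)] by (rule norm_triangle_ineq)
    also have "norm (of_real (ln (real (fst p))) / 2 - snd p) \<le> norm (of_real (ln (real (fst p))) / 2 :: complex) + norm (snd p)"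
      by (rule norm_triangle_ineq4)
    also have "norm (of_real (ln (real (fst p))) / 2 :: complex) = ln (real (fst p)) / 2"
      using elim(1) by (simp add: norm_divide)
    also have "norm (\<i> * of_real (\<tau>n (fst p)) :: complex) = \<bar>\<tau>n (fst p)\<bar>" by (simp add: norm_mult)
    finally have "norm (of_nat (fst p) * u p * (1 - s)) \<le> ln (real (fst p)) / 2 + B + pi"
      using elim(2) \<tau>n_bd[of "fst p"] by linarith
    hence "real (fst p) * norm (u p) * c1 \<le> ln (real (fst p)) / 2 + B + pi"
      by (simp add: norm_mult c1_def)
    hence "norm (u p) \<le> (ln (real (fst p)) / 2 + B + pi) / c1 / real (fst p)"
      using c1 elim by (simp add: pos_le_divide_eq mult_ac)
    thus ?case by (simp add: add_divide_distrib add.assoc)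
  qed
  define r1 where "r1 = (\<lambda>p. exp (of_real \<rho> * Ln (1 + u p)) - 1 - of_real \<rho> * u p)"
  define r2 where "r2 = (\<lambda>p. Ln (1 + u p) - u p)"
  have u0: "(u \<longlongrightarrow> 0) F" and r2_lim: "((\<lambda>p. of_nat (fst p) * r2 p) \<longlongrightarrow> 0) F"
    and r1_lim: "((\<lambda>p. of_nat (fst p) * r1 p) \<longlongrightarrow> 0) F"
    unfolding r1_def r2_def
    by (rule perturbation_limits[OF N _ _ _ ubd, of \<rho>]; use \<rho> c1 B pi_gt_zero in simp)+
  from tendsto_add[OF tendsto_const[of 1] u0] show w1: "(w \<longlongrightarrow> 1) F" by (simp add: u_def)
  have w_u: "w p = 1 + u p" for p by (simp add: u_def)
  have wne: "eventually (\<lambda>p. w p \<noteq> 0) F" using tendsto_imp_eventually_ne[OF w1] by simp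
  have Ln0: "((\<lambda>p. Ln (1 + u p)) \<longlongrightarrow> 0) F"
    using tendsto_Ln[OF w1] by (simp add: w_u[abs_def])
  have r1_0: "(r1 \<longlongrightarrow> 0) F"
  proof -
    have "((\<lambda>p. exp (of_real \<rho> * Ln (1 + u p)) - 1 - of_real \<rho> * u p) \<longlongrightarrow> exp (of_real \<rho> * 0) - 1 - of_real \<rho> * 0) F"
      by (intro tendsto_intros Ln0 u0)
    thus ?thesis by (simp add: r1_def)
  qed
  define R where "R = (\<lambda>p :: nat \<times> complex. ml_R \<rho> (fst p))"
  have Rpos: "R p > 0" for p unfolding R_def by (rule ml_R_pos[OF \<rho>])
  have R_top: "filterlim R at_top F" unfolding R_def by (rule filterlim_compose[OF filterlim_ml_R[OF \<rho>] N])
  \<comment> \<open>A logarithm of \<open>z\<close> assembled from its factors, so that its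
    imaginary part tends to \<open>\<phi>\<close>.\<close>
  define v where "v = (\<lambda>p. of_real (ln (R p)) + L + Ln (1 + u p))"
  define z where "z = (\<lambda>p. of_real (R p) * (\<xi> * w p))"
  have exp_v: "exp (v p) = z p" if "w p \<noteq> 0" for p
    using that Rpos[of p] by (simp add: v_def exp_add expL z_def exp_of_real w_u)
  define D1 where "D1 = (\<lambda>n. ln_Gamma (1 + real n / \<rho>) - real n * ln (ml_R \<rho> n) - (ln (2 * pi * (real n / \<rho>)) / 2 - real n / \<rho>))"
  define e where "e = (\<lambda>n. ml_R \<rho> n powr \<rho> - real n / \<rho>)"
  have D1_lim: "((\<lambda>p. complex_of_real (D1 (fst p))) \<longlongrightarrow> of_real (- a)) F"
    unfolding D1_def a_def
    by (intro tendsto_of_real filterlim_compose[OF Gamma_div_ml_R_power_limit[OF \<rho>] N])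
  have e_lim: "((\<lambda>p. complex_of_real (e (fst p))) \<longlongrightarrow> of_real a) F"
    unfolding e_def a_def
    by (intro tendsto_of_real filterlim_compose[OF ml_R_powr_limit[OF \<rho>] N])
  \<comment> \<open>The part of the exponent that tends to 0: \<open>u\<close> itself occurs only
    with bounded factors, and what is multiplied by \<open>n\<close> is one of the quadratic
    remainders \<open>r1\<close>, \<open>r2\<close>.\<close>
  define T where "T = (\<lambda>p. (of_real (D1 (fst p)) + of_real a)
     + s * (of_real (e (fst p)) * (1 + of_real \<rho> * u p + r1 p) - of_real a)
     + (s / of_real \<rho>) * (of_nat (fst p) * r1 p) - of_nat (fst p) * r2 p)"
  have T0: "(T \<longlongrightarrow> 0) F"
  proof -
    have "(T \<longlongrightarrow> (of_real (- a) + of_real a) + s * (of_real a * (1 + of_real \<rho> * 0 + 0) - of_real a)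
        + (s / of_real \<rho>) * 0 - 0) F"
      unfolding T_def by (intro tendsto_intros D1_lim e_lim u0 r1_0 r1_lim r2_lim)
    thus ?thesis by simp
  qed
  define C0 where "C0 = complex_of_real (sqrt (2 * pi * \<rho>)) * exp (of_real a * (s - 1))"
  have main: "of_real \<rho> * exp (exp (of_real \<rho> * v p)) / (of_real (ml_coeff \<rho> (fst p)) * z p ^ fst p)
      = C0 * exp (snd p) * exp (T p)" if "fst p > 0" "w p \<noteq> 0" for p
  proof -
    define n where "n = fst p"
    have n: "n > 0" using that by (simp add: n_def)
    have Rn: "ml_R \<rho> n > 0" by (rule ml_R_pos[OF \<rho>])
    have "exp (of_real \<rho> * v p) = exp (of_real (\<rho> * ln (ml_R \<rho> n))) * s * exp (of_real \<rho> * Ln (1 + u p))"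
      by (simp add: v_def s_exp distrib_left exp_add R_def n_def)
    also have "exp (of_real (\<rho> * ln (ml_R \<rho> n))) = complex_of_real (real n / \<rho> + e n)"
      unfolding exp_of_real using Rn by (simp add: e_def powr_def)
    also have "exp (of_real \<rho> * Ln (1 + u p)) = 1 + of_real \<rho> * u p + r1 p" by (simp add: r1_def)
    finally have E1: "exp (of_real \<rho> * v p) = of_real (real n / \<rho> + e n) * s * (1 + of_real \<rho> * u p + r1 p)" .
    note G = inverse_ml_coeff_eq_exp[OF \<rho>, of n]
    have zn: "z p ^ n = exp (of_nat n * v p)" using exp_v[OF that(2)] by (simp add: exp_of_nat_mult)
    have "of_real \<rho> * exp (exp (of_real \<rho> * v p)) / (of_real (ml_coeff \<rho> n) * z p ^ n)
      = of_real \<rho> * exp (exp (of_real \<rho> * v p)) * (1 / of_real (ml_coeff \<rho> n)) * inverse (z p ^ n)"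
      by (simp add: divide_inverse)
    also have "\<dots> = exp (of_real (ln \<rho>) + exp (of_real \<rho> * v p) + of_real (ln_Gamma (1 + real n / \<rho>)) - of_nat n * v p)"
    proof -
      have "exp (complex_of_real (ln \<rho>)) = of_real \<rho>" using \<rho> by (simp add: exp_of_real)
      thus ?thesis unfolding exp_add exp_diff G zn by (simp add: divide_inverse)
    qed
    also have "of_real (ln \<rho>) + exp (of_real \<rho> * v p) + of_real (ln_Gamma (1 + real n / \<rho>)) - of_nat n * v p
       = of_real (ln (2 * pi * \<rho>) / 2) + of_real a * (s - 1) + snd p + T p + \<i> * of_real (\<tau> / \<rho> * real n - \<tau>n n)"
    proof -
      have lg: "complex_of_real (ln_Gamma (1 + real n / \<rho>)) = of_real (D1 n) + of_nat n * of_real (ln (ml_R \<rho> n))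
          + of_real (ln (2 * pi * (real n / \<rho>)) / 2) - of_nat n / of_real \<rho>"
        by (simp add: D1_def)
      \<comment> \<open>The factor \<open>\<rho>\<close> from the residue turns
        \<open>sqrt (2 * pi * n / \<rho>)\<close> into
        \<open>sqrt (2 * pi * \<rho>) * sqrt n\<close>; the scaling removes
        \<open>sqrt n\<close>.\<close>
      have "ln \<rho> + ln (2 * pi * (real n / \<rho>)) / 2 - ln (2 * pi * \<rho>) / 2 = ln (real n) / 2"
      proof -
        have l1: "ln (2 * pi * (real n / \<rho>)) = ln (2 * pi) + (ln (real n) - ln \<rho>)"
          using n \<rho> by (simp add: ln_mult_pos ln_divide_pos)
        have l2: "ln (2 * pi * \<rho>) = ln (2 * pi) + ln \<rho>"
          using \<rho> by (simp add: ln_mult_pos)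
        show ?thesis unfolding l1 l2 by (simp add: field_simps)
      qed
      hence "ln \<rho> + ln (2 * pi * (real n / \<rho>)) / 2 = ln (2 * pi * \<rho>) / 2 + ln (real n) / 2" by linarith
      hence "complex_of_real (ln \<rho> + ln (2 * pi * (real n / \<rho>)) / 2) = of_real (ln (2 * pi * \<rho>) / 2 + ln (real n) / 2)"
        by (rule arg_cong)
      hence lns: "complex_of_real (ln \<rho>) + of_real (ln (2 * pi * (real n / \<rho>)) / 2)
          = of_real (ln (2 * pi * \<rho>) / 2) + of_real (ln (real n)) / 2"
        by simp
      have nu: "of_nat n * u p * (1 - s) = of_real (ln (real n)) / 2 - snd p + \<i> * of_real (\<tau>n n)"
        using u_eq[OF that(1)] by (simp add: n_def)
      have nL: "of_nat n / of_real \<rho> * (s - 1 - of_real \<rho> * L) = \<i> * of_real (\<tau> / \<rho> * real n)"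
        unfolding sL by simp
      \<comment> \<open>The linear terms \<open>n * s * u\<close>, from
        \<open>z powr \<rho>\<close>, and \<open>- n * u\<close>, from \<open>z ^ n\<close>, combine
        to \<open>- n * u * (1 - s)\<close>.\<close>
      have ring: "(of_nat n / of_real \<rho> + of_real (e n)) * s * (1 + of_real \<rho> * u p + r1 p) - of_nat n / of_real \<rho>
          - of_nat n * L - of_nat n * (u p + r2 p)
        = of_nat n / of_real \<rho> * (s - 1 - of_real \<rho> * L) - of_nat n * u p * (1 - s)
          + s * (of_real (e n) * (1 + of_real \<rho> * u p + r1 p)) + (s / of_real \<rho>) * (of_nat n * r1 p) - of_nat n * r2 p"
      proof -
        define k where "k = complex_of_nat n / of_real \<rho>"
        have nk: "of_nat n = k * of_real \<rho>" using \<rho> by (simp add: k_def)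
        have "(s / of_real \<rho>) * (of_nat n * r1 p) = s * k * r1 p" by (simp add: k_def)
        moreover have "(k + E) * s * (1 + P * U + A) - k - k * P * M - k * P * (U + B)
            = k * (s - 1 - P * M) - k * P * U * (1 - s) + s * (E * (1 + P * U + A)) + s * k * A - k * P * B"
          for E P U A B M :: complex by (simp add: algebra_simps)
        ultimately show ?thesis unfolding k_def[symmetric] nk using \<rho> by simp
      qed
      have Lnu: "Ln (1 + u p) = u p + r2 p" by (simp add: r2_def)
      have "of_real (ln \<rho>) + exp (of_real \<rho> * v p) + of_real (ln_Gamma (1 + real n / \<rho>)) - of_nat n * v p
        = (of_real (ln \<rho>) + of_real (ln (2 * pi * (real n / \<rho>)) / 2)) + of_real (D1 n)
          + ((of_nat n / of_real \<rho> + of_real (e n)) * s * (1 + of_real \<rho> * u p + r1 p) - of_nat n / of_real \<rho>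
          - of_nat n * L - of_nat n * (u p + r2 p))"
      proof -
        have "of_nat n * v p = of_nat n * of_real (ln (ml_R \<rho> n)) + of_nat n * L + of_nat n * (u p + r2 p)"
          unfolding v_def Lnu R_def n_def[symmetric] by (simp add: algebra_simps)
        thus ?thesis unfolding E1 lg by simp
      qed
      also have "\<dots> = of_real (ln (2 * pi * \<rho>) / 2) + of_real (ln (real n)) / 2 + of_real (D1 n)
          + (\<i> * of_real (\<tau> / \<rho> * real n) - (of_real (ln (real n)) / 2 - snd p + \<i> * of_real (\<tau>n n))
          + s * (of_real (e n) * (1 + of_real \<rho> * u p + r1 p)) + (s / of_real \<rho>) * (of_nat n * r1 p) - of_nat n * r2 p)"
        unfolding ring nL nu lns ..
      also have "\<dots> = of_real (ln (2 * pi * \<rho>) / 2) + of_real a * (s - 1) + snd p + T p + \<i> * of_real (\<tau> / \<rho> * real n - \<tau>n n)"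
        unfolding T_def n_def[symmetric] by (simp add: algebra_simps)
      finally show ?thesis .
    qed
    also have "exp \<dots> = exp (of_real (ln (2 * pi * \<rho>) / 2)) * exp (of_real a * (s - 1)) * exp (snd p) * exp (T p)
        * exp (\<i> * of_real (\<tau> / \<rho> * real n - \<tau>n n))"
      by (simp only: exp_add)
    also have "exp (\<i> * of_real (\<tau> / \<rho> * real n - \<tau>n n)) = 1"
      by (simp only: of_real_diff right_diff_distrib exp_diff reduced_argsD(2)[OF red]) simp
    also have "exp (complex_of_real (ln (2 * pi * \<rho>) / 2)) = of_real (sqrt (2 * pi * \<rho>))"
    proof -
      have "ln (2 * pi * \<rho>) / 2 = ln (sqrt (2 * pi * \<rho>))" using \<rho> by (simp add: ln_sqrt)
      hence "exp (ln (2 * pi * \<rho>) / 2) = sqrt (2 * pi * \<rho>)" using \<rho> by simp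
      thus ?thesis by (simp only: exp_of_real)
    qed
    finally show ?thesis by (simp add: C0_def n_def)
  qed
  \<comment> \<open>Beyond \<open>pi / (2 * \<rho>)\<close> the kernel decays along the rays; beyond \<open>\<phi>\<close> the pole is enclosed.\<close>
  define b where "b = pi / \<rho> - \<phi>"
  have "\<rho> * b = pi - \<rho> * \<phi>" using \<rho> by (simp add: b_def right_diff_distrib)
  hence \<rho>b: "pi / 2 < \<rho> * b" "\<rho> * b \<le> pi" using \<rho>\<phi> by auto
  have pr: "pi / \<rho> < pi" using \<rho> by (simp add: divide_less_eq)
  have "pi / (2 * \<rho>) = (pi / \<rho>) / 2" by simp
  hence b\<phi>: "\<phi> < b" "b > 0" using \<phi> by (auto simp: b_def)
  have "\<xi> = of_real (norm \<xi>) * cis \<phi>" using Arg_eq[OF \<xi>] \<phi>(1) by (simp add: cis_conv_exp)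
  hence im: "Im (\<xi> * cis t) = norm \<xi> * sin (\<phi> + t)" for t
  proof -
    assume "\<xi> = of_real (norm \<xi>) * cis \<phi>"
    from arg_cong[OF this, of "\<lambda>x. x * cis t"] have "\<xi> * cis t = of_real (norm \<xi>) * cis (\<phi> + t)"
      by (simp only: mult.assoc cis_mult)
    thus ?thesis by simp
  qed
  \<comment> \<open>The two angles are \<open>pi / \<rho>\<close> and
    \<open>pi / \<rho> - 2 * \<phi>\<close>, both strictly between 0 and \<open>pi\<close>.\<close>
  have "sin (\<phi> + b) > 0" using pr \<rho> by (intro sin_gt_zero) (auto simp: b_def)
  moreover have "sin (b - \<phi>) > 0" using b\<phi> pr \<phi> by (intro sin_gt_zero) (auto simp: b_def)
  hence "sin (\<phi> - b) \<noteq> 0" using sin_minus[of "b - \<phi>"] by simp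
  ultimately have imne: "Im (\<xi> * cis b) \<noteq> 0" "Im (\<xi> * cis (- b)) \<noteq> 0" using \<xi> im[of b] im[of "- b"] by auto
  have q_lim: "((\<lambda>p. \<xi> * w p) \<longlongrightarrow> \<xi>) F" using tendsto_mult[OF tendsto_const w1, of \<xi>] by simp
  obtain c where c: "c > 0" and sep: "eventually (\<lambda>p. \<forall>x\<in>hcontour 0 b. norm (exp x - z p) \<ge> c * norm (z p)) F"
    unfolding z_def by (rule hcontour_separation[OF q_lim \<xi> R_top less_imp_le[OF b\<phi>(2)] imne]) blast
  obtain C where C: "C \<ge> 0" "\<And>z. z \<noteq> 0 \<Longrightarrow> (\<And>v. v \<in> hcontour 0 b \<Longrightarrow> norm (exp v - z) \<ge> c * norm z) \<Longrightarrow>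
    norm (hankel_term \<rho> b z + of_real (1 / Gamma (1 - 1 / \<rho>)) / z) \<le> C / norm z ^ 2"
    by (rule hankel_cauchy_kernel_asymp[OF \<rho> \<rho>b c]) blast
  define g where "g = complex_of_real (1 / Gamma (1 - 1 / \<rho>))"
  have LL: "((\<lambda>p. L + Ln (1 + u p)) \<longlongrightarrow> L) F" using tendsto_add[OF tendsto_const Ln0, of L] by simp
  have "filterlim (\<lambda>p. Re (L + Ln (1 + u p)) + ln (R p)) at_top F"
    by (intro filterlim_tendsto_add_at_top[OF tendsto_Re[OF LL]] filterlim_compose[OF ln_at_top R_top])
  hence Rev_top: "filterlim (\<lambda>p. Re (v p)) at_top F" by (simp add: v_def add_ac)
  hence Rev: "eventually (\<lambda>p. Re (v p) > 0) F" by (auto simp: filterlim_at_top_dense)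
  have Imv: "((\<lambda>p. Im (v p)) \<longlongrightarrow> \<phi>) F" using tendsto_Im[OF LL] by (simp add: v_def ImL)
  have Imv1: "eventually (\<lambda>p. Im (v p) < pi / (2 * \<rho>)) F" "eventually (\<lambda>p. Im (v p) > 0) F"
      "eventually (\<lambda>p. Im (v p) < b) F"
    using order_tendstoD[OF Imv] \<phi> b\<phi> by auto
  define X where "X = (\<lambda>p. mittag_leffler \<rho> (z p) / (of_real \<rho> * exp (exp (of_real \<rho> * v p))))"
  have X1: "((\<lambda>p. X p - 1) \<longlongrightarrow> 0) F"
  proof (rule Lim_null_comparison)
    show "eventually (\<lambda>p. norm (X p - 1) \<le> (C * exp (- Re (v p)) ^ 2 + norm g * exp (- Re (v p))) / \<rho>) F"
      using sep Rev Imv1 wne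
    proof eventually_elim
      case (elim p)
      have zv: "z p = exp (v p)" using exp_v elim by simp
      have nz: "norm (z p) = exp (Re (v p))" by (simp add: zv)
      have E: "mittag_leffler \<rho> (z p) = \<rho> * exp (exp (\<rho> * v p)) + hankel_term \<rho> b (z p)"
        unfolding zv
        by (rule mittag_leffler_hankel_inside[OF \<rho> \<rho>b c]) (use elim zv in auto)
      have "norm (hankel_term \<rho> b (z p) + g / z p) \<le> C / norm (z p) ^ 2"
        unfolding g_def by (rule C(2)) (use elim zv in auto)
      hence h: "norm (hankel_term \<rho> b (z p)) \<le> C / norm (z p) ^ 2 + norm (g / z p)"
        using norm_triangle_ineq4[of "hankel_term \<rho> b (z p) + g / z p" "g / z p"]
        by simp
      \<comment> \<open>Inside the sector the exponential has modulus at least 1, so the algebraic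
        terms, of order \<open>1 / |z|\<close>, are negligible against it.\<close>
      have "Re (exp (of_real \<rho> * v p)) \<ge> 0"
      proof -
        have "0 \<le> \<rho> * Im (v p)" "\<rho> * Im (v p) \<le> pi / 2" using elim \<rho> by (simp_all add: pos_less_divide_eq mult_ac)
        hence "cos (\<rho> * Im (v p)) \<ge> 0" by (intro cos_ge_zero) auto
        thus ?thesis by (simp add: Re_exp)
      qed
      hence big: "\<rho> \<le> norm (of_real \<rho> * exp (exp (of_real \<rho> * v p)))" using \<rho> by (simp add: norm_mult)
      have "X p - 1 = hankel_term \<rho> b (z p) / (of_real \<rho> * exp (exp (of_real \<rho> * v p)))"
        using \<rho> unfolding X_def E add_divide_distrib by simp
      hence "norm (X p - 1) = norm (hankel_term \<rho> b (z p))
          / norm (of_real \<rho> * exp (exp (of_real \<rho> * v p)))" by (simp only: norm_divide)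
      also have "\<dots> \<le> (C / norm (z p) ^ 2 + norm (g / z p)) / \<rho>"
        by (rule frac_le) (use h big \<rho> C(1) in auto)
      also have "\<dots> = (C * exp (- Re (v p)) ^ 2 + norm g * exp (- Re (v p))) / \<rho>"
        by (simp add: nz norm_divide norm_mult norm_inverse exp_minus divide_inverse power_inverse)
      finally show ?case .
    qed
    have "((\<lambda>p. exp (- Re (v p))) \<longlongrightarrow> 0) F"
      by (rule filterlim_compose[OF exp_at_bot]) (use Rev_top in \<open>simp add: filterlim_uminus_at_bot\<close>)
    hence "((\<lambda>p. (C * exp (- Re (v p)) ^ 2 + norm g * exp (- Re (v p))) / \<rho>) \<longlongrightarrow> (C * 0 ^ 2 + norm g * 0) / \<rho>) F"
      by (intro tendsto_intros) (use \<rho> in auto)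
    thus "((\<lambda>p. (C * exp (- Re (v p)) ^ 2 + norm g * exp (- Re (v p))) / \<rho>) \<longlongrightarrow> 0) F" by simp
  qed
  have XT: "((\<lambda>p. X p * exp (T p) - 1) \<longlongrightarrow> 0) F"
  proof -
    have "((\<lambda>p. (X p - 1 + 1) * exp (T p) - 1) \<longlongrightarrow> (0 + 1) * exp 0 - 1) F"
      by (intro tendsto_intros X1 T0)
    thus ?thesis by simp
  qed
  have "continuous_on K (\<lambda>x. C0 * exp x)" by (intro continuous_intros)
  then obtain B' where "eventually (\<lambda>p. norm (C0 * exp (snd p)) \<le> B') F"
    unfolding F_def using bounded_on_prod_filter[OF K, of "\<lambda>x. C0 * exp x" sequentially] by blast
  from tendsto_bounded_mult_null[OF this XT]
  have "((\<lambda>p. C0 * exp (snd p) * (X p * exp (T p) - 1)) \<longlongrightarrow> 0) F" .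
  thus "((\<lambda>p. scaled_ratio (mittag_leffler \<rho>) \<rho> (fst p) (\<xi> * w p)
         - of_real (sqrt (2 * pi * \<rho>)) * exp (of_real a * (\<xi> powr of_real \<rho> - 1)) * exp (snd p)) \<longlongrightarrow> 0) F"
  proof (rule Lim_transform_eventually, goal_cases)
    case 1
    show ?case
      using Npos wne
    proof eventually_elim
      case (elim p)
      have "mittag_leffler \<rho> (z p) = X p * (of_real \<rho> * exp (exp (of_real \<rho> * v p)))"
        using \<rho> by (simp add: X_def)
      hence "mittag_leffler \<rho> (z p) / (of_real (ml_coeff \<rho> (fst p)) * z p ^ fst p) =
         X p * (of_real \<rho> * exp (exp (of_real \<rho> * v p)) / (of_real (ml_coeff \<rho> (fst p)) * z p ^ fst p))"
        by simp
      also have "\<dots> = X p * (C0 * exp (snd p) * exp (T p))" by (simp only: main[OF elim])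
      finally have 1: "mittag_leffler \<rho> (z p) / (of_real (ml_coeff \<rho> (fst p)) * z p ^ fst p) =
         X p * (C0 * exp (snd p) * exp (T p))" .
      have "C0 * exp (snd p) * (X p * exp (T p) - 1) =
          mittag_leffler \<rho> (z p) / (of_real (ml_coeff \<rho> (fst p)) * z p ^ fst p) - C0 * exp (snd p)"
        unfolding 1 by (simp add: algebra_simps)
      thus ?case by (simp only: z_def R_def C0_def s_def)
    qed
  qed
qed

text \<open>Outside the sector no residue appears and \<open>E\<close> behaves like
  \<open>- 1 / (z * Gamma (1 - 1 / \<rho>))\<close>. The effective normalising power is therefore
  \<open>z ^ (n + 1)\<close>, which explains \<open>n + 1\<close> in the phases and in the
  scaling.\<close>

lemma mittag_leffler_arc_limit:
  fixes \<xi> :: complex and \<tau>n :: "nat \<Rightarrow> real" and K :: "complex set"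
  assumes \<rho>: "\<rho> > 1" and \<xi>_eq: "\<xi> = of_real (exp (- 1 / \<rho>)) * cis \<phi>" and \<phi>: "pi / (2 * \<rho>) < \<phi>" "\<phi> \<le> pi"
    and red: "reduced_args (\<lambda>n. real (n + 1) * \<phi>) \<tau>n" and K: "compact K"
  defines "F \<equiv> sequentially \<times>\<^sub>F principal K"
    and "w \<equiv> \<lambda>p. szego_w_arc \<rho> (\<tau>n (fst p)) (fst p) (snd p)"
  shows "(w \<longlongrightarrow> 1) F"
    and "((\<lambda>p. scaled_ratio (mittag_leffler \<rho>) \<rho> (fst p) (\<xi> * w p)
         + of_real (sqrt (2 * pi * exp ((3 - \<rho>) / \<rho>)) / (\<rho> powr (1 / 2 - 1 / \<rho>) * Gamma (1 - 1 / \<rho>)))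
             * exp (- snd p)) \<longlongrightarrow> 0) F"
proof -
  define a where "a = (\<rho> - 1) / (2 * \<rho>)"
  \<comment> \<open>1/2 comes from the square root in Stirling's formula, \<open>1 / \<rho>\<close>
    from the additional factor \<open>R\<close>, of order
    \<open>n powr (1 / \<rho>)\<close>.\<close>
  define \<kappa> where "\<kappa> = 1 / 2 - 1 / \<rho>"
  \<comment> \<open>The real part makes \<open>|\<xi>| ^ (- n)\<close> equal to
    \<open>exp (n / \<rho>)\<close>, which cancels the factor \<open>exp (- n / \<rho>)\<close> in
    \<open>Gamma (1 + n / \<rho>) / R^n\<close>.\<close>
  define L where "L = of_real (- 1 / \<rho>) + \<i> * of_real \<phi>"
  have expL: "exp L = \<xi>" by (simp only: L_def exp_add exp_of_real \<xi>_eq cis_conv_exp)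
  have \<xi>: "\<xi> \<noteq> 0" using expL by (metis exp_not_eq_zero)
  have n\<xi>: "norm \<xi> = exp (- 1 / \<rho>)" by (simp add: \<xi>_eq norm_mult)
  have N: "filterlim fst sequentially F" unfolding F_def by (rule filterlim_fst)
  have Npos: "eventually (\<lambda>p. fst p > 0) F"
    using filterlim_at_top[THEN iffD1, OF N, rule_format, of 1] by (rule eventually_mono) simp
  define u where "u = (\<lambda>p. w p - 1)"
  obtain B where B: "B \<ge> 0" "eventually (\<lambda>p. norm (snd p) \<le> B) F"
    using bounded_on_prod_filter[OF K, of "\<lambda>x. x" sequentially] unfolding F_def by auto
  note \<tau>n_bd = reduced_argsD(1)[OF red]
  have u_eq: "u p = of_real (\<kappa> * (ln (real (fst p)) / real (fst p))) + (snd p - \<i> * of_real (\<tau>n (fst p))) / of_nat (fst p + 1)" for p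
    unfolding u_def w_def szego_w_arc_def \<kappa>_def by (simp only: add_diff_cancel_left' add.assoc)
  have ubd: "eventually (\<lambda>p. norm (u p) \<le> (\<bar>\<kappa>\<bar> * ln (real (fst p)) + (B + pi)) / real (fst p)) F"
    using Npos B(2)
  proof eventually_elim
    case (elim p)
    have "norm (u p) \<le> norm (complex_of_real (\<kappa> * (ln (real (fst p)) / real (fst p)))) +
        norm ((snd p - \<i> * of_real (\<tau>n (fst p))) / of_nat (fst p + 1))"
      unfolding u_eq by (rule norm_triangle_ineq)
    also have "norm (complex_of_real (\<kappa> * (ln (real (fst p)) / real (fst p)))) = \<bar>\<kappa>\<bar> * ln (real (fst p)) / real (fst p)"
    proof -
      have "ln (real (fst p)) \<ge> 0" using elim by simp
      thus ?thesis unfolding norm_of_real by (simp add: abs_mult)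
    qed
    also have "norm ((snd p - \<i> * of_real (\<tau>n (fst p))) / of_nat (fst p + 1)) \<le> (B + pi) / real (fst p)"
    proof -
      have "norm (snd p - \<i> * of_real (\<tau>n (fst p))) \<le> norm (snd p) + norm (\<i> * of_real (\<tau>n (fst p)) :: complex)"
        by (rule norm_triangle_ineq4)
      also have "norm (\<i> * of_real (\<tau>n (fst p)) :: complex) = \<bar>\<tau>n (fst p)\<bar>" by (simp add: norm_mult)
      finally have 1: "norm (snd p - \<i> * of_real (\<tau>n (fst p))) \<le> B + pi" using elim(2) \<tau>n_bd[of "fst p"] by linarith
      have "norm (snd p - \<i> * of_real (\<tau>n (fst p))) / real (fst p + 1) \<le> (B + pi) / real (fst p)"
        by (rule frac_le) (use 1 elim B(1) pi_gt_zero in auto)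
      thus ?thesis by (simp only: norm_divide norm_of_nat)
    qed
    finally show ?case by (simp add: add_divide_distrib)
  qed
  define r2 where "r2 = (\<lambda>p. Ln (1 + u p) - u p)"
  have u0: "(u \<longlongrightarrow> 0) F" and r2_lim: "((\<lambda>p. of_nat (fst p) * r2 p) \<longlongrightarrow> 0) F"
    unfolding r2_def
    by (rule perturbation_limits[OF N _ _ _ ubd, of \<rho>]; use \<rho> B pi_gt_zero in simp)+
  from tendsto_add[OF tendsto_const[of 1] u0] show w1: "(w \<longlongrightarrow> 1) F" by (simp add: u_def)
  have w_u: "w p = 1 + u p" for p by (simp add: u_def)
  have wne: "eventually (\<lambda>p. w p \<noteq> 0) F" using tendsto_imp_eventually_ne[OF w1] by simp
  have Ln0: "((\<lambda>p. Ln (1 + u p)) \<longlongrightarrow> 0) F"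
    using tendsto_Ln[OF w1] by (simp add: w_u[abs_def])
  have r2_0: "(r2 \<longlongrightarrow> 0) F" unfolding r2_def using tendsto_diff[OF Ln0 u0] by simp
  define R where "R = (\<lambda>p :: nat \<times> complex. ml_R \<rho> (fst p))"
  have Rpos: "R p > 0" for p unfolding R_def by (rule ml_R_pos[OF \<rho>])
  have R_top: "filterlim R at_top F" unfolding R_def by (rule filterlim_compose[OF filterlim_ml_R[OF \<rho>] N])
  define v where "v = (\<lambda>p. of_real (ln (R p)) + L + Ln (1 + u p))"
  define z where "z = (\<lambda>p. of_real (R p) * (\<xi> * w p))"
  have exp_v: "exp (v p) = z p" if "w p \<noteq> 0" for p
    using that Rpos[of p] by (simp add: v_def exp_add expL z_def exp_of_real w_u)
  define D1 where "D1 = (\<lambda>n. ln_Gamma (1 + real n / \<rho>) - real n * ln (ml_R \<rho> n) - (ln (2 * pi * (real n / \<rho>)) / 2 - real n / \<rho>))"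
  define d where "d = (\<lambda>n. ln (ml_R \<rho> n) - ln (real n / \<rho>) / \<rho>)"
  have D1_lim: "((\<lambda>p. complex_of_real (D1 (fst p))) \<longlongrightarrow> of_real (- a)) F"
    unfolding D1_def a_def
    by (intro tendsto_of_real filterlim_compose[OF Gamma_div_ml_R_power_limit[OF \<rho>] N])
  have d0: "d \<longlonglongrightarrow> 0"
  proof -
    have "(\<lambda>n. (\<rho> * ln (ml_R \<rho> n) - ln (real n / \<rho>)) / \<rho>) \<longlonglongrightarrow> 0 / \<rho>"
      by (intro tendsto_divide ln_ml_R_asymp \<rho> tendsto_const) (use \<rho> in simp)
    thus ?thesis using \<rho> by (simp add: d_def diff_divide_distrib)
  qed
  have d_lim: "((\<lambda>p. complex_of_real (d (fst p))) \<longlongrightarrow> of_real 0) F"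
    by (intro tendsto_of_real filterlim_compose[OF d0 N])
  have l_lim: "((\<lambda>p. complex_of_real (\<kappa> * (ln (real (fst p)) / real (fst p)))) \<longlongrightarrow> of_real (\<kappa> * 0)) F"
  proof (intro tendsto_of_real tendsto_mult tendsto_const)
    have "(\<lambda>n. ln (real n) / real n) \<longlonglongrightarrow> 0" by real_asymp
    from filterlim_compose[OF this N] show "((\<lambda>p. ln (real (fst p)) / real (fst p)) \<longlongrightarrow> 0) F" .
  qed
  \<comment> \<open>Effects of \<open>n + 1\<close> in place of \<open>n\<close>: one more factor
    \<open>R\<close> brings \<open>d\<close>, \<open>(n + 1) * ln n / n\<close> exceeds
    \<open>ln n\<close> by a null sequence, and \<open>(n + 1) * r2\<close> is split to use the
    limit of \<open>n * r2\<close>.\<close>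
  define T where "T = (\<lambda>p. of_real (D1 (fst p)) + of_real a - of_real (d (fst p))
     - of_real (\<kappa> * (ln (real (fst p)) / real (fst p))) - (of_nat (fst p) * r2 p + r2 p))"
  have T0: "(T \<longlongrightarrow> 0) F"
  proof -
    have "(T \<longlongrightarrow> of_real (- a) + of_real a - of_real 0 - of_real (\<kappa> * 0) - (0 + 0)) F"
      unfolding T_def by (intro tendsto_intros D1_lim d_lim l_lim r2_lim r2_0)
    thus ?thesis by simp
  qed
  define C2 where "C2 = sqrt (2 * pi * exp ((3 - \<rho>) / \<rho>)) / \<rho> powr \<kappa>"
  have lnC2: "C2 = exp (ln (2 * pi) / 2 + (3 - \<rho>) / (2 * \<rho>) - \<kappa> * ln \<rho>)"
  proof -
    have "sqrt (2 * pi * exp ((3 - \<rho>) / \<rho>)) = exp (ln (sqrt (2 * pi * exp ((3 - \<rho>) / \<rho>))))" by simp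
    also have "ln (sqrt (2 * pi * exp ((3 - \<rho>) / \<rho>))) = ln (2 * pi * exp ((3 - \<rho>) / \<rho>)) / 2"
      by (rule ln_sqrt) simp
    also have "ln (2 * pi * exp ((3 - \<rho>) / \<rho>)) = ln (2 * pi) + (3 - \<rho>) / \<rho>"
      by (subst ln_mult_pos) simp_all
    finally have "sqrt (2 * pi * exp ((3 - \<rho>) / \<rho>)) = exp ((ln (2 * pi) + (3 - \<rho>) / \<rho>) / 2)" .
    moreover have "(ln (2 * pi) + (3 - \<rho>) / \<rho>) / 2 = ln (2 * pi) / 2 + (3 - \<rho>) / (2 * \<rho>)"
      by (simp add: add_divide_distrib)
    ultimately show ?thesis using \<rho> by (simp add: C2_def powr_def exp_diff)
  qed
  \<comment> \<open>An exact identity again: the whole error sits in \<open>T\<close>.\<close>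
  have main: "1 / (of_real (ml_coeff \<rho> (fst p)) * z p ^ (fst p + 1)) = of_real C2 * exp (- snd p) * exp (T p)"
    if "fst p > 0" "w p \<noteq> 0" for p
  proof -
    define n where "n = fst p"
    have n: "n > 0" using that by (simp add: n_def)
    note G = inverse_ml_coeff_eq_exp[OF \<rho>, of n]
    have zn: "z p ^ (n + 1) = exp (of_nat (n + 1) * v p)" using exp_v[OF that(2)] by (simp only: exp_of_nat_mult)
    have "1 / (of_real (ml_coeff \<rho> n) * z p ^ (n + 1)) = (1 / of_real (ml_coeff \<rho> n)) / z p ^ (n + 1)"
      by simp
    also have "\<dots> = exp (of_real (ln_Gamma (1 + real n / \<rho>)) - of_nat (n + 1) * v p)"
      unfolding G zn exp_diff ..
    also have "of_real (ln_Gamma (1 + real n / \<rho>)) - of_nat (n + 1) * v p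
       = of_real (ln (2 * pi) / 2 + (3 - \<rho>) / (2 * \<rho>) - \<kappa> * ln \<rho>) + (- snd p) + T p + \<i> * of_real (\<tau>n n - real (n + 1) * \<phi>)"
    proof -
      have nn: "complex_of_nat (n + 1) \<noteq> 0" by (simp only: of_nat_eq_0_iff)
      have nu: "of_nat (n + 1) * u p = of_real (\<kappa> * ln (real n)) + of_real (\<kappa> * (ln (real n) / real n)) + (snd p - \<i> * of_real (\<tau>n n))"
      proof -
        have "of_nat (n + 1) * u p = of_nat (n + 1) * of_real (\<kappa> * (ln (real n) / real n)) + (snd p - \<i> * of_real (\<tau>n n))"
          unfolding u_eq n_def[symmetric] distrib_left using nn by (simp del: of_nat_add of_nat_Suc)
        moreover have "of_nat (n + 1) * of_real (\<kappa> * (ln (real n) / real n))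
            = complex_of_real (\<kappa> * ln (real n)) + of_real (\<kappa> * (ln (real n) / real n))"
        proof -
          have "real (n + 1) * (\<kappa> * (ln (real n) / real n)) = \<kappa> * ln (real n) + \<kappa> * (ln (real n) / real n)"
            using n by (simp add: field_simps)
          hence "complex_of_real (real (n + 1) * (\<kappa> * (ln (real n) / real n))) = of_real (\<kappa> * ln (real n) + \<kappa> * (ln (real n) / real n))"
            by (rule arg_cong)
          thus ?thesis by (simp only: of_real_mult of_real_add of_real_of_nat_eq)
        qed
        ultimately show ?thesis by simp
      qed
      have real_eq: "ln_Gamma (1 + real n / \<rho>) - real (n + 1) * ln (ml_R \<rho> n) + real (n + 1) / \<rho> - \<kappa> * ln (real n)
         = ln (2 * pi) / 2 + (3 - \<rho>) / (2 * \<rho>) - \<kappa> * ln \<rho> + D1 n + a - d n"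
      proof -
        have l1: "ln (2 * pi * (real n / \<rho>)) = ln (2 * pi) + (ln (real n) - ln \<rho>)"
          using n \<rho> by (simp add: ln_mult_pos ln_divide_pos)
        have l2: "ln (real n / \<rho>) = ln (real n) - ln \<rho>" using n \<rho> by (simp add: ln_divide_pos)
        \<comment> \<open>The origin of \<open>3 - \<rho>\<close>: one factor
          \<open>exp (1 / \<rho>)\<close> is left over from \<open>|\<xi>| ^ (- n - 1)\<close>, and
          the Gamma quotient contributes \<open>exp (- a)\<close> in the limit.\<close>
        have q: "1 / \<rho> = (3 - \<rho>) / (2 * \<rho>) + a" using \<rho> by (simp add: a_def field_simps)
        have q2: "real (n + 1) / \<rho> = real n / \<rho> + 1 / \<rho>" by (simp add: add_divide_distrib)
        have q3: "\<kappa> * ln (real n) = ln (real n) / 2 - ln (real n) / \<rho>" "\<kappa> * ln \<rho> = ln \<rho> / 2 - ln \<rho> / \<rho>"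
          by (simp_all add: \<kappa>_def left_diff_distrib)
        have q4: "real (n + 1) * ln (ml_R \<rho> n) = real n * ln (ml_R \<rho> n) + ln (ml_R \<rho> n)"
          by (simp add: distrib_right)
        have q5: "(ln (real n) - ln \<rho>) / \<rho> = ln (real n) / \<rho> - ln \<rho> / \<rho>" by (rule diff_divide_distrib)
        show ?thesis unfolding D1_def d_def l1 l2 q2 q3 q4 q5 using q by argo
      qed
      have real_eq': "complex_of_real (ln_Gamma (1 + real n / \<rho>)) - of_nat (n + 1) * of_real (ln (ml_R \<rho> n))
           + of_real (real (n + 1) / \<rho>) - of_real (\<kappa> * ln (real n))
         = of_real (ln (2 * pi) / 2 + (3 - \<rho>) / (2 * \<rho>) - \<kappa> * ln \<rho>) + of_real (D1 n) + of_real a - of_real (d n)"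
      proof -
        have "complex_of_real (ln_Gamma (1 + real n / \<rho>) - real (n + 1) * ln (ml_R \<rho> n) + real (n + 1) / \<rho> - \<kappa> * ln (real n))
            = of_real (ln (2 * pi) / 2 + (3 - \<rho>) / (2 * \<rho>) - \<kappa> * ln \<rho> + D1 n + a - d n)"
          unfolding real_eq ..
        thus ?thesis
          unfolding of_real_add[of _ "a"] of_real_diff[of _ "d n"] of_real_add[of _ "D1 n"]
            of_real_diff[of _ "\<kappa> * ln (real n)"] of_real_add[of _ "real (n + 1) / \<rho>"]
            of_real_diff[of _ "real (n + 1) * ln (ml_R \<rho> n)"] of_real_mult[of "real (n + 1)"] of_real_of_nat_eq .
      qed
      have Lnu: "Ln (1 + u p) = u p + r2 p" by (simp add: r2_def)
      have nL: "of_nat (n + 1) * L = - of_real (real (n + 1) / \<rho>) + \<i> * of_real (real (n + 1) * \<phi>)"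
        by (simp add: L_def algebra_simps add_divide_distrib)
      have nv: "of_nat (n + 1) * v p = of_nat (n + 1) * of_real (ln (ml_R \<rho> n)) + of_nat (n + 1) * L
          + (of_nat (n + 1) * u p + (of_nat n * r2 p + r2 p))"
        unfolding v_def Lnu R_def n_def[symmetric] by (simp add: algebra_simps)
      have "of_real (ln_Gamma (1 + real n / \<rho>)) - of_nat (n + 1) * v p
        = (of_real (ln_Gamma (1 + real n / \<rho>)) - of_nat (n + 1) * of_real (ln (ml_R \<rho> n))
           + of_real (real (n + 1) / \<rho>) - of_real (\<kappa> * ln (real n)))
          - \<i> * of_real (real (n + 1) * \<phi>) - of_real (\<kappa> * (ln (real n) / real n)) - (snd p - \<i> * of_real (\<tau>n n))
          - (of_nat n * r2 p + r2 p)"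
        unfolding nv nL nu by simp
      also have "\<dots> = of_real (ln (2 * pi) / 2 + (3 - \<rho>) / (2 * \<rho>) - \<kappa> * ln \<rho>) + (- snd p) + T p
          + (\<i> * of_real (\<tau>n n) - \<i> * of_real (real (n + 1) * \<phi>))"
        unfolding real_eq' T_def n_def[symmetric] by simp
      finally show ?thesis by (simp only: of_real_diff right_diff_distrib)
    qed
    also have "exp \<dots> = exp (of_real (ln (2 * pi) / 2 + (3 - \<rho>) / (2 * \<rho>) - \<kappa> * ln \<rho>)) * exp (- snd p) * exp (T p)
        * exp (\<i> * of_real (\<tau>n n - real (n + 1) * \<phi>))"
      by (simp only: exp_add)
    also have "exp (\<i> * of_real (\<tau>n n - real (n + 1) * \<phi>)) = 1"
      by (simp only: of_real_diff right_diff_distrib exp_diff reduced_argsD(2)[OF red]) simp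
    also have "exp (complex_of_real (ln (2 * pi) / 2 + (3 - \<rho>) / (2 * \<rho>) - \<kappa> * ln \<rho>)) = of_real C2"
      unfolding lnC2 by (simp only: exp_of_real)
    finally show ?thesis by (simp add: n_def)
  qed
  define m where "m = min \<phi> (pi / \<rho>)"
  have "pi / (2 * \<rho>) < pi / \<rho>" using \<rho> by (intro divide_strict_left_mono) auto
  hence mlt: "pi / (2 * \<rho>) < m" using \<phi> by (simp add: m_def)
  \<comment> \<open>\<open>hcontour_separation\<close> compares with full lines, so the direction opposite to the lower ray is excluded too.\<close>
  obtain b where b: "pi / (2 * \<rho>) < b" "b < m" "b \<noteq> pi - \<phi>"
  proof -
    obtain b1 where b1: "pi / (2 * \<rho>) < b1" "b1 < m" using dense[OF mlt] by blast
    obtain b2 where b2: "b1 < b2" "b2 < m" using dense[OF b1(2)] by blast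
    show thesis using that[of b1] that[of b2] b1 b2 by (cases "b1 = pi - \<phi>") auto
  qed
  have \<rho>b: "pi / 2 < \<rho> * b" "\<rho> * b \<le> pi"
    using b \<rho> by (simp_all add: m_def pos_divide_less_eq pos_less_divide_eq mult_ac)
  have pr: "pi / \<rho> < pi" using \<rho> by (simp add: divide_less_eq)
  have b0: "b > 0" using b(1) \<rho> pi_gt_zero by (meson divide_pos_pos less_trans mult_pos_pos zero_less_numeral zero_less_one)
  have b\<phi>: "b < \<phi>" "b < pi" using b pr by (auto simp: m_def)
  have im: "Im (\<xi> * cis t) = exp (- 1 / \<rho>) * sin (\<phi> + t)" for t
  proof -
    have "\<xi> * cis t = of_real (exp (- 1 / \<rho>)) * cis (\<phi> + t)" by (simp only: \<xi>_eq mult.assoc cis_mult)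
    thus ?thesis by simp
  qed
  have "sin (\<phi> - b) > 0" using b\<phi> \<phi> b0 by (intro sin_gt_zero) auto
  moreover have "sin (\<phi> + b) \<noteq> 0"
  proof (cases "\<phi> + b < pi")
    case True
    hence "sin (\<phi> + b) > 0" using b0 b\<phi> by (intro sin_gt_zero) auto
    thus ?thesis by simp
  next
    case False
    hence "sin (\<phi> + b) < 0" using b(3) b\<phi> \<phi> b0 by (intro sin_lt_zero) auto
    thus ?thesis by simp
  qed
  ultimately have imne: "Im (\<xi> * cis b) \<noteq> 0" "Im (\<xi> * cis (- b)) \<noteq> 0" using im[of b] im[of "- b"] by auto
  have q_lim: "((\<lambda>p. \<xi> * w p) \<longlongrightarrow> \<xi>) F" using tendsto_mult[OF tendsto_const w1, of \<xi>] by simp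
  obtain c where c: "c > 0" and sep: "eventually (\<lambda>p. \<forall>x\<in>hcontour 0 b. norm (exp x - z p) \<ge> c * norm (z p)) F"
    unfolding z_def by (rule hcontour_separation[OF q_lim \<xi> R_top less_imp_le[OF b0] imne]) blast
  obtain C where C: "C \<ge> 0" "\<And>z. z \<noteq> 0 \<Longrightarrow> (\<And>v. v \<in> hcontour 0 b \<Longrightarrow> norm (exp v - z) \<ge> c * norm z) \<Longrightarrow>
    norm (hankel_term \<rho> b z + of_real (1 / Gamma (1 - 1 / \<rho>)) / z) \<le> C / norm z ^ 2"
    by (rule hankel_cauchy_kernel_asymp[OF \<rho> \<rho>b c]) blast
  define g where "g = complex_of_real (1 / Gamma (1 - 1 / \<rho>))"
  \<comment> \<open>The angle is tested through its cosine: for \<open>\<phi> = pi\<close> the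
    points \<open>\<xi> * w\<close> may cross the negative real axis, where the argument jumps but
    the cosine is continuous. All logarithms of \<open>z\<close> are covered at once.\<close>
  have "cos \<phi> < cos b" using b\<phi> b0 \<phi> by (intro cos_monotone_0_pi) auto
  hence "Re \<xi> / norm \<xi> < cos b" by (simp add: \<xi>_eq norm_mult)
  moreover have "((\<lambda>p. Re (\<xi> * w p) / norm (\<xi> * w p)) \<longlongrightarrow> Re \<xi> / norm \<xi>) F"
    by (intro tendsto_intros q_lim) (use \<xi> in simp)
  ultimately have cosb: "eventually (\<lambda>p. Re (\<xi> * w p) / norm (\<xi> * w p) < cos b) F"
    using order_tendstoD(2) by blast
  have LL: "((\<lambda>p. L + Ln (1 + u p)) \<longlongrightarrow> L) F" using tendsto_add[OF tendsto_const Ln0, of L] by simp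
  have "filterlim (\<lambda>p. Re (L + Ln (1 + u p)) + ln (R p)) at_top F"
    by (intro filterlim_tendsto_add_at_top[OF tendsto_Re[OF LL]] filterlim_compose[OF ln_at_top R_top])
  hence Rev_top: "filterlim (\<lambda>p. Re (v p)) at_top F" by (simp add: v_def add_ac)
  have zE: "((\<lambda>p. z p * mittag_leffler \<rho> (z p) + g) \<longlongrightarrow> 0) F"
  proof (rule Lim_null_comparison)
    show "eventually (\<lambda>p. norm (z p * mittag_leffler \<rho> (z p) + g) \<le> C * exp (- Re (v p))) F"
      using sep cosb wne
    proof eventually_elim
      case (elim p)
      have zv: "z p = exp (v p)" using exp_v elim by simp
      have nz: "norm (z p) = exp (Re (v p))" by (simp add: zv)
      have z0: "z p \<noteq> 0" by (simp add: zv)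
      have out: "exp x \<noteq> z p" if x: "\<bar>Im x\<bar> \<le> b" for x
      proof
        assume ex: "exp x = z p"
        have "Re (z p) = R p * Re (\<xi> * w p)" "norm (z p) = R p * norm (\<xi> * w p)"
          using Rpos[of p] by (simp_all add: z_def norm_mult)
        hence "Re (z p) / norm (z p) = Re (\<xi> * w p) / norm (\<xi> * w p)" using Rpos[of p] by simp
        moreover have "Re (z p) / norm (z p) = cos (Im x)" unfolding ex[symmetric] by (simp add: Re_exp)
        moreover have "cos (Im x) = cos \<bar>Im x\<bar>" by (simp add: abs_if)
        moreover have "cos b \<le> cos \<bar>Im x\<bar>" using x b\<phi> by (intro cos_monotone_0_pi_le) auto
        ultimately show False using elim by linarith
      qed
      have E: "mittag_leffler \<rho> (z p) = hankel_term \<rho> b (z p)"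
        by (rule mittag_leffler_hankel_outside[OF _ \<rho>b c z0 _ out]) (use elim \<rho> in auto)
      have "norm (mittag_leffler \<rho> (z p) + g / z p) \<le> C / norm (z p) ^ 2"
        unfolding g_def E by (rule C(2)[OF z0]) (use elim in auto)
      hence "norm (z p) * norm (mittag_leffler \<rho> (z p) + g / z p) \<le> norm (z p) * (C / norm (z p) ^ 2)"
        by (intro mult_left_mono) auto
      moreover have "z p * mittag_leffler \<rho> (z p) + g = z p * (mittag_leffler \<rho> (z p) + g / z p)"
        using z0 by (simp add: distrib_left)
      ultimately have "norm (z p * mittag_leffler \<rho> (z p) + g) \<le> norm (z p) * (C / norm (z p) ^ 2)"
        by (simp only: norm_mult)
      also have "\<dots> = C * exp (- Re (v p))"
        unfolding nz by (simp add: power2_eq_square exp_minus divide_inverse)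
      finally show ?case .
    qed
    have "((\<lambda>p. exp (- Re (v p))) \<longlongrightarrow> 0) F"
      by (rule filterlim_compose[OF exp_at_bot]) (use Rev_top in \<open>simp add: filterlim_uminus_at_bot\<close>)
    thus "((\<lambda>p. C * exp (- Re (v p))) \<longlongrightarrow> 0) F" by (rule tendsto_mult_right_zero)
  qed
  have XT: "((\<lambda>p. z p * mittag_leffler \<rho> (z p) * exp (T p) + g) \<longlongrightarrow> 0) F"
  proof -
    have "((\<lambda>p. (z p * mittag_leffler \<rho> (z p) + g - g) * exp (T p) + g) \<longlongrightarrow> (0 - g) * exp 0 + g) F"
      by (intro tendsto_intros zE T0)
    thus ?thesis by simp
  qed
  have "continuous_on K (\<lambda>x. of_real C2 * exp (- x))" by (intro continuous_intros)
  then obtain B' where "eventually (\<lambda>p. norm (of_real C2 * exp (- snd p)) \<le> B') F"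
    unfolding F_def using bounded_on_prod_filter[OF K, of "\<lambda>x. of_real C2 * exp (- x)" sequentially] by blast
  from tendsto_bounded_mult_null[OF this XT]
  have lim: "((\<lambda>p. of_real C2 * exp (- snd p) * (z p * mittag_leffler \<rho> (z p) * exp (T p) + g)) \<longlongrightarrow> 0) F" .
  show "((\<lambda>p. scaled_ratio (mittag_leffler \<rho>) \<rho> (fst p) (\<xi> * w p)
         + of_real (sqrt (2 * pi * exp ((3 - \<rho>) / \<rho>)) / (\<rho> powr (1 / 2 - 1 / \<rho>) * Gamma (1 - 1 / \<rho>)))
             * exp (- snd p)) \<longlongrightarrow> 0) F"
  proof (rule Lim_transform_eventually[OF lim], goal_cases)
    case 1
    show ?case
      using Npos wne
    proof eventually_elim
      case (elim p)
      have z0: "z p \<noteq> 0" using exp_v[OF elim(2)] by (metis exp_not_eq_zero)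
      have "mittag_leffler \<rho> (z p) / (of_real (ml_coeff \<rho> (fst p)) * z p ^ fst p) =
         z p * mittag_leffler \<rho> (z p) * (1 / (of_real (ml_coeff \<rho> (fst p)) * z p ^ (fst p + 1)))"
        using z0 by simp
      also have "\<dots> = z p * mittag_leffler \<rho> (z p) * (of_real C2 * exp (- snd p) * exp (T p))"
        by (simp only: main[OF elim])
      finally have 1: "mittag_leffler \<rho> (z p) / (of_real (ml_coeff \<rho> (fst p)) * z p ^ fst p) =
          z p * mittag_leffler \<rho> (z p) * (of_real C2 * exp (- snd p) * exp (T p))" .
      have 2: "complex_of_real (sqrt (2 * pi * exp ((3 - \<rho>) / \<rho>)) / (\<rho> powr (1 / 2 - 1 / \<rho>) * Gamma (1 - 1 / \<rho>)))
          = of_real C2 * g"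
      proof -
        have "sqrt (2 * pi * exp ((3 - \<rho>) / \<rho>)) / (\<rho> powr (1 / 2 - 1 / \<rho>) * Gamma (1 - 1 / \<rho>)) = C2 * (1 / Gamma (1 - 1 / \<rho>))"
          by (simp add: C2_def \<kappa>_def)
        thus ?thesis unfolding g_def by (simp only: of_real_mult)
      qed
      have "of_real C2 * exp (- snd p) * (z p * mittag_leffler \<rho> (z p) * exp (T p) + g) =
          mittag_leffler \<rho> (z p) / (of_real (ml_coeff \<rho> (fst p)) * z p ^ fst p) + of_real C2 * g * exp (- snd p)"
        unfolding 1 by (simp add: algebra_simps)
      thus ?case unfolding 2 by (simp only: z_def R_def)
    qed
  qed
qed

section \<open>Limits of the normalised combinations of sections and tails\<close>

theorem theorem4:
  fixes \<rho> :: real and lam :: complex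
  assumes rho: "\<rho> > 1"
  shows
    "(\<forall>(\<xi>::complex) (\<phi>::real) (\<tau>::real) (\<tau>\<^sub>n::nat \<Rightarrow> real) (K::complex set).
        \<xi> \<in> szego_curve \<rho> \<and> Arg \<xi> = \<phi> \<and> 0 < \<phi> \<and> \<phi> < pi / (2 * \<rho>) \<and>
        \<tau> = norm \<xi> powr \<rho> * sin (\<phi> * \<rho>) - \<rho> * \<phi> \<and>
        reduced_args (\<lambda>n. \<tau> / \<rho> * real n) \<tau>\<^sub>n \<and> compact K \<longrightarrow>
        (norm \<xi> < 1 \<longrightarrow>
          uniform_limit K
            (\<lambda>n \<zeta>. normalized_I \<rho> lam \<xi> n (szego_w \<rho> \<xi> (\<tau>\<^sub>n n) n \<zeta>))
            (\<lambda>\<zeta>. (1 - lam) * of_real (sqrt (2 * pi * \<rho>)) *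
                  exp (of_real ((\<rho> - 1) / (2 * \<rho>)) * (\<xi> powr of_real \<rho> - 1)) * exp \<zeta> - \<xi> / (1 - \<xi>)) sequentially) \<and>
        (norm \<xi> > 1 \<longrightarrow>
          uniform_limit K
            (\<lambda>n \<zeta>. normalized_I \<rho> lam \<xi> n (szego_w \<rho> \<xi> (\<tau>\<^sub>n n) n \<zeta>))
            (\<lambda>\<zeta>. - lam * of_real (sqrt (2 * pi * \<rho>)) *
                  exp (of_real ((\<rho> - 1) / (2 * \<rho>)) * (\<xi> powr of_real \<rho> - 1)) * exp \<zeta> - \<xi> / (1 - \<xi>)) sequentially))
   \<and>
     (\<forall>(\<xi>::complex) (\<phi>::real) (\<tau>\<^sub>n'::nat \<Rightarrow> real) (K::complex set).
        \<xi> = of_real (exp (- 1 / \<rho>)) * cis \<phi> \<and> pi / (2 * \<rho>) < \<phi> \<and> \<phi> \<le> pi \<and>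
        reduced_args (\<lambda>n. real (n + 1) * \<phi>) \<tau>\<^sub>n' \<and> compact K \<longrightarrow>
        uniform_limit K
          (\<lambda>n \<zeta>. normalized_I \<rho> lam \<xi> n (szego_w_arc \<rho> (\<tau>\<^sub>n' n) n \<zeta>))
          (\<lambda>\<zeta>. (lam - 1) * of_real (sqrt (2 * pi * exp ((3 - \<rho>) / \<rho>)) /
                    (\<rho> powr (1 / 2 - 1 / \<rho>) * Gamma (1 - 1 / \<rho>))) * exp (- \<zeta>) - \<xi> / (1 - \<xi>)) sequentially)"
proof ((rule conjI; intro allI impI), goal_cases)
  case (1 \<xi> \<phi> \<tau> \<tau>n K)
  let ?F = "sequentially \<times>\<^sub>F principal K"
  define w where "w = (\<lambda>p. szego_w \<rho> \<xi> (\<tau>n (fst p)) (fst p) (snd p))"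
  define z where "z = (\<lambda>p. of_real (ml_R \<rho> (fst p)) * (\<xi> * w p))"
  define S where "S = (\<lambda>p. of_real (ml_coeff \<rho> (fst p)) * z p ^ fst p)"
  define C0 where "C0 = complex_of_real (sqrt (2 * pi * \<rho>)) *
      exp (of_real ((\<rho> - 1) / (2 * \<rho>)) * (\<xi> powr of_real \<rho> - 1))"
  have \<xi>: "\<xi> \<noteq> 0" using 1 Arg_zero by auto
  have curve: "norm \<xi> powr \<rho> * cos (\<rho> * \<phi>) - 1 - \<rho> * ln (norm \<xi>) = 0"
    using szego_curve_sectorD[OF rho, of \<xi>] 1 by auto
  have lim: "(w \<longlongrightarrow> 1) ?F" "((\<lambda>p. mittag_leffler \<rho> (z p) / S p - C0 * exp (snd p)) \<longlongrightarrow> 0) ?F"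
    using mittag_leffler_sector_limit[OF rho \<xi> _ _ _ curve, of \<tau> \<tau>n K] 1
    unfolding w_def z_def S_def C0_def by blast+
  have N: "filterlim fst sequentially ?F" by (rule filterlim_fst)
  have q: "((\<lambda>p. \<xi> * w p) \<longlongrightarrow> \<xi>) ?F" using tendsto_mult[OF tendsto_const lim(1), of \<xi>] by simp
  have I: "normalized_I \<rho> lam \<xi> (fst p) (szego_w \<rho> \<xi> (\<tau>n (fst p)) (fst p) (snd p)) = ml_I \<rho> (fst p) (z p) lam / S p" for p
    unfolding normalized_I_eq z_def S_def w_def ..
  show ?case
    unfolding uniform_limit_iff_prod_filter I
  proof (intro conjI impI, goal_cases)
    case 1
    have t: "((\<lambda>p. ml_tail \<rho> (fst p + 1) (z p) / S p) \<longlongrightarrow> \<xi> / (1 - \<xi>)) ?F"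
      unfolding z_def S_def by (rule ml_tail_limit[OF rho N q 1 \<xi>])
    \<comment> \<open>The error to be estimated is this linear combination of two errors that are
      known to vanish.\<close>
    have "((\<lambda>p. (1 - lam) * (mittag_leffler \<rho> (z p) / S p - C0 * exp (snd p))
        - (ml_tail \<rho> (fst p + 1) (z p) / S p - \<xi> / (1 - \<xi>))) \<longlongrightarrow> 0) ?F"
      using tendsto_diff[OF tendsto_mult_right_zero[OF lim(2), of "1 - lam"] LIM_zero[OF t]] by (simp only: diff_0_right)
    thus ?case
      by (rule Lim_transform_eventually, intro always_eventually allI, unfold ml_I_eq(1)[OF rho] C0_def)
         (simp only: diff_divide_distrib right_diff_distrib mult.assoc times_divide_eq_right, simp)
  next
    case 2
    have t: "((\<lambda>p. ml_section \<rho> (fst p) (z p) / S p) \<longlongrightarrow> - \<xi> / (1 - \<xi>)) ?F"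
      unfolding z_def S_def by (rule ml_section_limit[OF rho N q 2])
    \<comment> \<open>The same combination for the form \<open>s - lam * E\<close>, in which the
      section has the finite limit.\<close>
    have "((\<lambda>p. - lam * (mittag_leffler \<rho> (z p) / S p - C0 * exp (snd p))
        + (ml_section \<rho> (fst p) (z p) / S p - - \<xi> / (1 - \<xi>))) \<longlongrightarrow> 0) ?F"
      using tendsto_add[OF tendsto_mult_right_zero[OF lim(2), of "- lam"] LIM_zero[OF t]] by (simp only: add_0_right)
    thus ?case
      by (rule Lim_transform_eventually, intro always_eventually allI, unfold ml_I_eq(2)[OF rho] C0_def)
         (simp only: diff_divide_distrib right_diff_distrib mult.assoc times_divide_eq_right, simp)
  qed
next
  case (2 \<xi> \<phi> \<tau>n K)
  let ?F = "sequentially \<times>\<^sub>F principal K"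
  define w where "w = (\<lambda>p. szego_w_arc \<rho> (\<tau>n (fst p)) (fst p) (snd p))"
  define z where "z = (\<lambda>p. of_real (ml_R \<rho> (fst p)) * (\<xi> * w p))"
  define S where "S = (\<lambda>p. of_real (ml_coeff \<rho> (fst p)) * z p ^ fst p)"
  define C2 where "C2 = complex_of_real (sqrt (2 * pi * exp ((3 - \<rho>) / \<rho>)) /
                    (\<rho> powr (1 / 2 - 1 / \<rho>) * Gamma (1 - 1 / \<rho>)))"
  have n: "norm \<xi> = exp (- 1 / \<rho>)" using 2 by (simp add: norm_mult)
  have \<xi>: "\<xi> \<noteq> 0" using n by auto
  \<comment> \<open>The arc lies inside the unit disc, so the form with the tail serves for every
    \<open>\<phi>\<close>.\<close>
  have n1: "norm \<xi> < 1" unfolding n using rho by simp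
  have lim: "(w \<longlongrightarrow> 1) ?F" "((\<lambda>p. mittag_leffler \<rho> (z p) / S p + C2 * exp (- snd p)) \<longlongrightarrow> 0) ?F"
    using mittag_leffler_arc_limit[OF rho, of \<xi> \<phi> \<tau>n K] 2
    unfolding w_def z_def S_def C2_def by blast+
  have N: "filterlim fst sequentially ?F" by (rule filterlim_fst)
  have q: "((\<lambda>p. \<xi> * w p) \<longlongrightarrow> \<xi>) ?F" using tendsto_mult[OF tendsto_const lim(1), of \<xi>] by simp
  have I: "normalized_I \<rho> lam \<xi> (fst p) (szego_w_arc \<rho> (\<tau>n (fst p)) (fst p) (snd p)) = ml_I \<rho> (fst p) (z p) lam / S p" for p
    unfolding normalized_I_eq z_def S_def w_def ..
  have t: "((\<lambda>p. ml_tail \<rho> (fst p + 1) (z p) / S p) \<longlongrightarrow> \<xi> / (1 - \<xi>)) ?F"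
    unfolding z_def S_def by (rule ml_tail_limit[OF rho N q n1 \<xi>])
  have "((\<lambda>p. (1 - lam) * (mittag_leffler \<rho> (z p) / S p + C2 * exp (- snd p))
      - (ml_tail \<rho> (fst p + 1) (z p) / S p - \<xi> / (1 - \<xi>))) \<longlongrightarrow> 0) ?F"
    using tendsto_diff[OF tendsto_mult_right_zero[OF lim(2), of "1 - lam"] LIM_zero[OF t]] by (simp only: diff_0_right)
  thus ?case
    unfolding uniform_limit_iff_prod_filter I C2_def[symmetric]
    by (rule Lim_transform_eventually, intro always_eventually allI, unfold ml_I_eq(1)[OF rho])
       (simp add: diff_divide_distrib add_divide_distrib algebra_simps)
qed

end
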